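(* For integers $k\ge1$, as rational functions of $n$ (which are in fact polynomials): $$a^{\emptyset}_{\mathrm{id}_k}(n)=\frac1{k!}\binom nk,\qquad a^{(1)}_{\mathrm{id}_k}(n)=\frac{2^{k-1}\prod_{i=1}^{k-1}(2n-2i+1)}{(2k-1)!}-\frac1{k!}\binom{n-1}{k-1},$$ and for integers $k\ge 2$, $$a^{(2)}_{\mathrm{id}_k}(n)=-\frac{1}{n\,k!}\binom{n-2}{k-1}+\frac{1}{2(k-1)!}\binom{n-1}{k-2}-\frac{2^{k-1}\big((2k-4)n+(2k-1)\big)\prod_{i=2}^{k-1}(2n-2i+1)}{n\,(2k-1)!},$$ $$a^{(1,1)}_{\mathrm{id}_k}(n)=\frac1{k!}\binom{n-2}{k-2}+\frac{1}{n\,k!}\binom{n-2}{k-1}+\frac{1}{2(k-1)!}\binom{n-1}{k-2}-\frac{2^{k-1}\big(2kn-(2k-1)\big)\prod_{i=2}^{k-1}(2n-2i+1)}{n\,(2k-1)!},$$ where $\prod_{i=2}^{k-1}(2n-2i+1)=1$ when $k=2$. Moreover $a^\lambda_{\mathrm{id}_k}(n)=\langle\chi^{\lambda[n]},M_{\mathrm{id}_k,n}\rangle$ holds for all integers $n\ge0$ when $\lambda=\emptyset$, for all $n\ge k$ when $\lambda=(1)$, and for all $n\ge k+1$ when $\lambda\in\{(2),(1,1)\}$, in each case whenever $\lambda[n]$ is a partition.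
   Context: $\mathrm{id}_k=12\cdots k$; $N_{\mathrm{id}_k}(\pi)$ is the number of increasing subsequences of length $k$ of $\pi\in S_n$ (index sets $i_1<\dots<i_k$ with $\pi(i_1)<\dots<\pi(i_k)$). $M_{\mathrm{id}_k,n}(\pi)$ is the average of $N_{\mathrm{id}_k}$ over the conjugacy class of $\pi$ in $S_n$. $\langle f,g\rangle=\frac1{n!}\sum_{\pi\in S_n}f(\pi)\overline{g(\pi)}$; $\chi^\mu$ is the irreducible character of $S_n$ indexed by $\mu\vdash n$; $\lambda[n]=(n-|\lambda|,\lambda_1,\lambda_2,\dots)$. $a^\lambda_{\mathrm{id}_k}(n)$ denotes the unique polynomial in $n$ agreeing with $\langle\chi^{\lambda[n]},M_{\mathrm{id}_k,n}\rangle$ for all sufficiently large $n$. Binomial coefficients $\binom{x}{m}$ with polynomial top entry mean $x(x-1)\cdots(x-m+1)/m!$ for integers $m\ge0$ and $0$ for $m<0$. *)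

theory Defs
  imports
    Complex_Main
    "HOL-Library.Function_Algebras"
    "HOL-Combinatorics.Permutations"
    "HOL-Computational_Algebra.Computational_Algebra"
begin

section \<open>Rational functions in one variable\<close>

instance fract :: ("{idom, ring_char_0}") ring_char_0
proof
  have "of_nat m = to_fract (of_nat m :: 'a)" for m
    by (induction m) simp_all
  then show "inj (of_nat :: nat \<Rightarrow> 'a fract)"
    by (simp add: inj_on_def)
qed

instance fract :: ("{idom, ring_char_0}") field_char_0 ..

text \<open>The indeterminate \<open>n\<close> of the field of rational functions over the complex numbers.\<close>

abbreviation X :: "complex poly fract" where
  "X \<equiv> to_fract [:0, 1:]"


section \<open>Characters of the symmetric group\<close>

text \<open>
  Throughout, the symmetric group on \<open>n\<close> letters is the set of all \<open>p\<close> with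
  \<open>p permutes {1..n}\<close>, under composition.

  Partitions are weakly decreasing lists; trailing zeros are allowed, so that \<open>pad [] 0 = [0]\<close>
  is a partition of \<open>0\<close>.
\<close>

definition is_partition :: "nat list \<Rightarrow> nat \<Rightarrow> bool" where
  "is_partition \<mu> n \<longleftrightarrow> sorted_wrt (\<ge>) \<mu> \<and> sum_list \<mu> = n"

text \<open>
  The padded partition \<open>\<nu>[n]\<close>. The subtraction is truncated, but if \<open>n < sum_list \<nu>\<close>
  then the result has the wrong size and is not a partition of \<open>n\<close>.
\<close>

definition pad :: "nat list \<Rightarrow> nat \<Rightarrow> nat list" where
  "pad \<nu> n = (n - sum_list \<nu>) # \<nu>"

definition cells :: "nat list \<Rightarrow> (nat \<times> nat) set" where
  "cells \<mu> = {(i, j). i < length \<mu> \<and> j < \<mu> ! i}"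

definition tableau :: "nat list \<Rightarrow> (nat \<times> nat \<Rightarrow> nat) \<Rightarrow> bool" where
  "tableau \<mu> t \<longleftrightarrow> bij_betw t (cells \<mu>) {1..sum_list \<mu>}"

text \<open>A tabloid is the list of the (unordered) rows of a tableau.\<close>

definition tabloid :: "nat list \<Rightarrow> (nat \<times> nat \<Rightarrow> nat) \<Rightarrow> nat set list" where
  "tabloid \<mu> t = map (\<lambda>i. t ` {c \<in> cells \<mu>. fst c = i}) [0..<length \<mu>]"

definition tabloid_act :: "(nat \<Rightarrow> nat) \<Rightarrow> nat set list \<Rightarrow> nat set list" where
  "tabloid_act p T = map ((`) p) T"

definition column_stabilizer :: "nat list \<Rightarrow> (nat \<times> nat \<Rightarrow> nat) \<Rightarrow> (nat \<Rightarrow> nat) set" where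
  "column_stabilizer \<mu> t = {p. p permutes {1..sum_list \<mu>} \<and>
     (\<forall>j. p ` t ` {c \<in> cells \<mu>. snd c = j} = t ` {c \<in> cells \<mu>. snd c = j})}"

text \<open>
  The formal linear combination \<open>\<Sum>T. v T \<cdot> T\<close> of tabloids is represented by its coefficient
  function \<open>v\<close>. So \<open>polytabloid \<mu> t\<close> is the sum of \<open>sign p \<cdot> p{t}\<close> over the column
  stabilizer of \<open>t\<close>, and \<open>perm_act\<close> is the linear extension of \<open>tabloid_act\<close>.
\<close>

definition polytabloid :: "nat list \<Rightarrow> (nat \<times> nat \<Rightarrow> nat) \<Rightarrow> nat set list \<Rightarrow> complex" where
  "polytabloid \<mu> t = (\<lambda>T. \<Sum>p \<in> column_stabilizer \<mu> t.
     if T = tabloid_act p (tabloid \<mu> t) then of_int (sign p) else 0)"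

definition perm_act :: "(nat \<Rightarrow> nat) \<Rightarrow> (nat set list \<Rightarrow> complex) \<Rightarrow> nat set list \<Rightarrow> complex" where
  "perm_act p v = (\<lambda>T. v (tabloid_act (inv p) T))"

global_interpretation cfun: vector_space "\<lambda>(c::complex) (f::'a \<Rightarrow> complex) x. c * f x"
  by unfold_locales (auto simp: fun_eq_iff algebra_simps)

definition specht :: "nat list \<Rightarrow> (nat set list \<Rightarrow> complex) set" where
  "specht \<mu> = cfun.span {polytabloid \<mu> t | t. tableau \<mu> t}"

text \<open>
  The trace of a linear endomorphism \<open>f\<close> of a finite-dimensional space \<open>V\<close>. It does not
  depend on the chosen basis.
\<close>

definition trace_on :: "('a \<Rightarrow> complex) set \<Rightarrow> (('a \<Rightarrow> complex) \<Rightarrow> 'a \<Rightarrow> complex) \<Rightarrow> complex" where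
  "trace_on V f = (let B = (SOME B. cfun.independent B \<and> cfun.span B = V)
                   in \<Sum>b\<in>B. cfun.representation B (f b) b)"

text \<open>The irreducible character indexed by \<open>\<mu>\<close>: the character of the Specht module.\<close>

definition irr_char :: "nat list \<Rightarrow> (nat \<Rightarrow> nat) \<Rightarrow> complex" where
  "irr_char \<mu> p = trace_on (specht \<mu>) (perm_act p)"

definition class_inner :: "nat \<Rightarrow> ((nat \<Rightarrow> nat) \<Rightarrow> complex) \<Rightarrow> ((nat \<Rightarrow> nat) \<Rightarrow> complex) \<Rightarrow> complex" where
  "class_inner n f g = (\<Sum>p | p permutes {1..n}. f p * cnj (g p)) / fact n"


section \<open>Increasing subsequences\<close>

definition N_id :: "nat \<Rightarrow> nat \<Rightarrow> (nat \<Rightarrow> nat) \<Rightarrow> nat" where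
  "N_id k n p = card {I. I \<subseteq> {1..n} \<and> card I = k \<and> strict_mono_on I p}"

definition conj_class :: "nat \<Rightarrow> (nat \<Rightarrow> nat) \<Rightarrow> (nat \<Rightarrow> nat) set" where
  "conj_class n p = {q \<circ> p \<circ> inv q | q. q permutes {1..n}}"

definition M_id :: "nat \<Rightarrow> nat \<Rightarrow> (nat \<Rightarrow> nat) \<Rightarrow> complex" where
  "M_id k n p = (\<Sum>q \<in> conj_class n p. of_nat (N_id k n q)) / of_nat (card (conj_class n p))"

definition a_id :: "nat list \<Rightarrow> nat \<Rightarrow> complex poly" where
  "a_id \<nu> k = (THE P. \<forall>\<^sub>F n in sequentially.
     poly P (of_nat n) = class_inner n (irr_char (pad \<nu> n)) (M_id k n))"

end

theory Submission
  imports Defs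
begin

text \<open>
  The characters in question are polynomials in the numbers of fixed points and of two-cycles:
  each Specht module has an explicit equivariant projection from the tabloid module, and the trace
  of a permutation on the module is read off from the projected basis vectors. Since characters are
  class functions, averaging over conjugacy classes can be dropped, and the inner products become
  counts of pairs \<open>(I, J)\<close> of \<open>k\<close>-subsets, with \<open>I\<close> mapped increasingly onto \<open>J\<close>, in which marked
  points have equal rank. These counts are two- and threefold convolutions of squared binomial
  coefficients. The series \<open>F = \<Sum> (m choose j)\<^sup>2 x\<^sup>m y\<^sup>j\<close> is the inverse square root of
  \<open>\<Delta> = 1 - 2 (1 + y) x + (1 - y)\<^sup>2 x\<^sup>2\<close> by the Legendre recurrence, so \<open>F\<^sup>2\<close> and \<open>F\<^sup>3\<close> are
  the unique solutions of \<open>\<Delta> G = 1\<close> and \<open>\<Delta> H = F\<close>, which the closed forms satisfy.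
\<close>

subsection \<open>Convolutions of squared binomial coefficients\<close>

text \<open>Squares of binomials arise because \<open>I\<close> and \<open>J\<close> are independent
  sets split at the same marked position: \<open>u\<close> points below it, of which
  \<open>r\<close> are chosen, give \<open>C(u, r) C(n - 1 - u, k - 1 - r)\<close> choices for each.
  Two-cycles break this, since the marked point sits at \<open>a\<close> in \<open>I\<close> and at
  \<open>b\<close> in \<open>J\<close>. Summed over all pairs, the unequal positions nevertheless
  fill a full square, which factors, plus one extra copy of its diagonal, which is again a
  convolution of squares. The factor \<open>(n - k)! / n!\<close> from the points outside
  \<open>I\<close> cancels one falling factorial in each closed form and leaves a polynomial in
  \<open>n\<close>. For the twofold convolution this polynomial has only half-integer roots, so it
  misses the zeros of the count at \<open>n < k\<close>; that is the origin of the bound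
  \<open>n \<ge> k\<close>, and of \<open>n \<ge> k + 1\<close> where one further point is
  prescribed outside \<open>I\<close>. Polynomiality is obvious except for the two-cycle part
  divided by \<open>n\<close>, whose numerator has to be shown to vanish at 0.\<close>

definition binsq_poly :: "nat \<Rightarrow> complex poly" where
  "binsq_poly m = (\<Sum>j\<le>m. monom (of_nat (m choose j) ^ 2) j)"

lemma coeff_binsq_poly [simp]: "coeff (binsq_poly m) j = of_nat (m choose j) ^ 2"
  by (simp add: binsq_poly_def coeff_sum binomial_eq_0 cong: if_cong)

text \<open>The series \<open>F\<close>, in \<open>x\<close> with coefficients polynomial in
  \<open>y\<close>. Its coefficient of \<open>x^m\<close> is
  \<open>(1 - y)^m P_m((1 + y) / (1 - y))\<close> with \<open>P_m\<close> the Legendre polynomial;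
  the three-term recurrence of \<open>P_m\<close>, rescaled accordingly, has
  \<open>a = 1 + y\<close> and \<open>b = (1 - y)^2\<close>.\<close>

definition binsq_fps :: "complex poly fps" where
  "binsq_fps = Abs_fps binsq_poly"

definition disc_fps :: "'a \<Rightarrow> 'a \<Rightarrow> 'a :: comm_ring_1 fps" where
  "disc_fps a b = 1 - fps_const (2 * a) * fps_X + fps_const b * fps_X ^ 2"

lemma disc_fps_mult_nth:
  "fps_nth (disc_fps a b * f) 0 = fps_nth f 0"
  "fps_nth (disc_fps a b * f) (Suc 0) = fps_nth f (Suc 0) - 2 * a * fps_nth f 0"
  "fps_nth (disc_fps a b * f) (Suc (Suc m)) =
     fps_nth f (Suc (Suc m)) - 2 * a * fps_nth f (Suc m) + b * fps_nth f m"
proof -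
  have *: "disc_fps a b * f = f - fps_const (2 * a) * (fps_X * f)
      + fps_const b * (fps_X * (fps_X * f))"
    unfolding disc_fps_def power2_eq_square by (simp only: ring_distribs mult.assoc mult_1)
  show "fps_nth (disc_fps a b * f) 0 = fps_nth f 0"
    "fps_nth (disc_fps a b * f) (Suc 0) = fps_nth f (Suc 0) - 2 * a * fps_nth f 0"
    "fps_nth (disc_fps a b * f) (Suc (Suc m)) =
     fps_nth f (Suc (Suc m)) - 2 * a * fps_nth f (Suc m) + b * fps_nth f m"
    unfolding * by simp_all
qed

text \<open>The coefficient of \<open>x^(m+1)\<close> is twice the recurrence at \<open>m\<close>,
  and the constant one is \<open>F1\<close>. The equation says that \<open>\<Delta> F^2\<close> has
  logarithmic derivative zero, written without division so that it makes sense over any commutative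
  ring.\<close>

lemma legendre_ode:
  fixes F :: "'a :: comm_ring_1 fps"
  assumes F1: "fps_nth F (Suc 0) = a * fps_nth F 0"
    and rec: "\<And>m. of_nat (m + 2) * fps_nth F (Suc (Suc m))
      = of_nat (2 * m + 3) * (a * fps_nth F (Suc m)) - of_nat (m + 1) * (b * fps_nth F m)"
  shows "2 * (disc_fps a b * fps_deriv F) + fps_deriv (disc_fps a b) * F = 0"
proof (rule fps_ext)
  fix i
  have D: "fps_deriv (disc_fps a b) * F =
      fps_const 2 * (fps_const b * (fps_X * F)) - fps_const 2 * (fps_const a * F)"
    unfolding disc_fps_def
    by (simp add: algebra_simps power2_eq_square fps_const_mult[symmetric] numeral_fps_const del: fps_const_mult)
  have two: "fps_nth (2 * f) i = 2 * fps_nth f i" for f :: "'a fps" and i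
    by (simp add: numeral_fps_const)
  have DN: "fps_nth (fps_const 2 * (fps_const b * (fps_X * F)) - fps_const 2 * (fps_const a * F)) i
      = 2 * (b * (if i = 0 then 0 else fps_nth F (i - 1))) - 2 * (a * fps_nth F i)" for i
    by simp
  consider "i = 0" | "i = Suc 0" | j where "i = Suc (Suc j)"
    by (metis not0_implies_Suc)
  then have "fps_nth (2 * (disc_fps a b * fps_deriv F) + fps_deriv (disc_fps a b) * F) i = 0"
  proof cases
    case 1
    show ?thesis
      unfolding 1 D DN fps_add_nth two disc_fps_mult_nth by (simp add: F1)
  next
    case 2
    show ?thesis
      unfolding 2 D DN fps_add_nth two disc_fps_mult_nth
      using arg_cong[OF rec[of 0], of "\<lambda>x. 2 * x"] by (simp add: F1 algebra_simps)
  next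
    case (3 j)
    show ?thesis
      unfolding 3 D DN fps_add_nth two disc_fps_mult_nth
      using arg_cong[OF rec[of "Suc j"], of "\<lambda>x. 2 * x"] by (simp add: algebra_simps)
  qed
  then show "fps_nth (2 * (disc_fps a b * fps_deriv F) + fps_deriv (disc_fps a b) * F) i = fps_nth 0 i"
    by simp
qed

text \<open>\<open>F\<close> times the differential equation is the derivative of
  \<open>\<Delta> F^2\<close>. In characteristic zero a series with zero derivative is constant, and
  the constant is read off at \<open>x = 0\<close>.\<close>

lemma legendre_square:
  fixes F :: "'a :: {idom, ring_char_0} fps"
  assumes F0: "fps_nth F 0 = 1" and F1: "fps_nth F (Suc 0) = a"
    and rec: "\<And>m. of_nat (m + 2) * fps_nth F (Suc (Suc m))
      = of_nat (2 * m + 3) * (a * fps_nth F (Suc m)) - of_nat (m + 1) * (b * fps_nth F m)"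
  shows "disc_fps a b * (F * F) = 1"
proof -
  let ?G = "disc_fps a b * (F * F)"
  have "fps_deriv ?G = F * (2 * (disc_fps a b * fps_deriv F) + fps_deriv (disc_fps a b) * F)"
    by (simp add: algebra_simps)
  also have "\<dots> = 0"
    using legendre_ode[of F a b] assms by simp
  finally have "?G = fps_const (fps_nth ?G 0)"
    unfolding fps_deriv_eq_0_iff .
  also have "fps_nth ?G 0 = 1"
    unfolding disc_fps_mult_nth by (simp add: F0)
  finally show ?thesis by simp
qed

text \<open>The subtraction is taken in the ring, so nothing is truncated and the relation extends
  to \<open>j > m\<close>, where both binomials vanish.\<close>

lemma binomial_step:
  "of_nat (Suc j) * of_nat (m choose Suc j) = (of_nat m - of_nat j) * (of_nat (m choose j) :: 'a :: comm_ring_1)"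
proof (cases "j \<le> m")
  case True
  have "Suc j * (m choose Suc j) = (m - j) * (m choose j)"
    by (metis binomial_absorb_comp binomial_absorption mult.commute)
  then have "of_nat (Suc j * (m choose Suc j)) = (of_nat ((m - j) * (m choose j)) :: 'a)"
    by simp
  then show ?thesis
    using True by (simp only: of_nat_mult of_nat_diff)
qed (simp add: binomial_eq_0)

text \<open>Here \<open>p\<close>, \<open>q\<close>, \<open>r\<close> stand for the neighbours
  \<open>C(m-1, j)\<close>, \<open>C(m-1, j-1)\<close>, \<open>C(m-1, j-2)\<close>, tied by their
  step relations. By Pascal the needed entries of rows \<open>m - 1\<close>, \<open>m\<close> and
  \<open>m + 1\<close> are linear in them, so the recurrence becomes a quadratic identity.\<close>

lemma binsq_aux:
  fixes m j p q r :: complex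
  assumes 1: "j * p = (m - j) * q" and 2: "(m - j + 1) * r = (j - 1) * q"
    and 3: "j \<noteq> 0" "m - j + 1 \<noteq> 0"
  shows "(m + 1) * (p + 2 * q + r)\<^sup>2 = (2 * m + 1) * ((p + q)\<^sup>2 + (q + r)\<^sup>2) - m * (p\<^sup>2 - 2 * q\<^sup>2 + r\<^sup>2)"
proof -
  \<comment> \<open>\<open>E\<close> is half the difference of the two sides. After multiplication
    by \<open>j * (m - j + 1)\<close> the step relations eliminate \<open>p\<close> and
    \<open>r\<close>, and the resulting multiple of \<open>q^2\<close> is zero.\<close>
  define E where "E = (1 - m) * q\<^sup>2 + p * q + q * r + (m + 1) * (p * r)"
  have "j * (m - j + 1) * E = (1 - m) * q\<^sup>2 * j * (m - j + 1) + (j * p) * q * (m - j + 1)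
      + q * j * ((m - j + 1) * r) + (m + 1) * ((j * p) * ((m - j + 1) * r))"
    by (simp add: E_def algebra_simps)
  also have "\<dots> = 0"
    unfolding 1 2 by (simp add: algebra_simps power2_eq_square)
  finally have "E = 0"
    using 3 by simp
  moreover have "(m + 1) * (p + 2 * q + r)\<^sup>2
      - ((2 * m + 1) * ((p + q)\<^sup>2 + (q + r)\<^sup>2) - m * (p\<^sup>2 - 2 * q\<^sup>2 + r\<^sup>2)) = 2 * E"
    by (simp add: E_def algebra_simps power2_eq_square)
  ultimately show ?thesis by simp
qed

lemma legendre_coeff:
  defines "c \<equiv> \<lambda>m j. of_nat (m choose j) :: complex"
  shows "of_nat (m + 2) * c (m + 2) (j + 2) ^ 2
    = of_nat (2 * m + 3) * (c (m + 1) (j + 2) ^ 2 + c (m + 1) (j + 1) ^ 2)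
      - of_nat (m + 1) * (c m (j + 2) ^ 2 - 2 * c m (j + 1) ^ 2 + c m j ^ 2)"
proof (cases "j \<le> m")
  case True
  have P: "c (m + 1) (j + 2) = c m (j + 2) + c m (j + 1)" "c (m + 1) (j + 1) = c m (j + 1) + c m j"
     "c (m + 2) (j + 2) = c m (j + 2) + 2 * c m (j + 1) + c m j"
    by (simp_all add: c_def)
  show ?thesis
  \<comment> \<open>At \<open>j = m\<close> the second denominator of the auxiliary identity, which
    is \<open>m - j\<close> here, vanishes, so this boundary coefficient is computed
    directly.\<close>
  proof (cases "j = m")
    case False
    have "(of_nat m + 1 + 1) * (c m (j + 2) + 2 * c m (j + 1) + c m j)\<^sup>2
       = (2 * (of_nat m + 1) + 1) * ((c m (j + 2) + c m (j + 1))\<^sup>2 + (c m (j + 1) + c m j)\<^sup>2)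
        - (of_nat m + 1) * ((c m (j + 2))\<^sup>2 - 2 * (c m (j + 1))\<^sup>2 + (c m j)\<^sup>2)"
    proof (rule binsq_aux[where j = "of_nat j + 2"])
      show "(of_nat j + 2) * c m (j + 2) = (of_nat m + 1 - (of_nat j + 2)) * c m (j + 1)"
        using binomial_step[of "j + 1" m, where 'a = complex] by (simp add: c_def algebra_simps)
      show "(of_nat m + 1 - (of_nat j + 2) + 1) * c m j = (of_nat j + 2 - 1) * c m (j + 1)"
        using binomial_step[of "j" m, where 'a = complex] by (simp add: c_def algebra_simps)
      show "of_nat j + 2 \<noteq> (0 :: complex)"
        by (metis of_nat_add of_nat_eq_0_iff of_nat_numeral add_is_0 zero_neq_numeral)
      show "of_nat m + 1 - (of_nat j + 2) + 1 \<noteq> (0 :: complex)"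
        using False True by simp
    qed
    then show ?thesis
      unfolding P by (simp add: algebra_simps)
  qed (auto simp: c_def binomial_eq_0)
next
  case False
  then show ?thesis by (auto simp: c_def binomial_eq_0 not_le)
qed

lemma coeff_pCons_mult:
  fixes p :: "'a :: comm_ring_1 poly"
  shows "coeff ([:a, b:] * p) 0 = a * coeff p 0"
    "coeff ([:a, b:] * p) (Suc j) = a * coeff p (Suc j) + b * coeff p j"
    "coeff ([:a, b, c:] * p) 0 = a * coeff p 0"
    "coeff ([:a, b, c:] * p) (Suc 0) = a * coeff p (Suc 0) + b * coeff p 0"
    "coeff ([:a, b, c:] * p) (Suc (Suc j)) = a * coeff p (Suc (Suc j)) + b * coeff p (Suc j) + c * coeff p j"
  by simp_all

lemma legendre_rec:
  "of_nat (m + 2) * binsq_poly (m + 2)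
     = of_nat (2 * m + 3) * ([:1, 1:] * binsq_poly (m + 1)) - of_nat (m + 1) * ([:1, -2, 1:] * binsq_poly m)"
proof (rule poly_eqI)
  fix i
  have C: "coeff (of_nat n * p) i = of_nat n * coeff p i" for n i and p :: "complex poly"
    by (simp add: of_nat_poly)
  consider "i = 0" | "i = Suc 0" | j where "i = Suc (Suc j)"
    by (metis not0_implies_Suc)
  then show "coeff (of_nat (m + 2) * binsq_poly (m + 2)) i =
     coeff (of_nat (2 * m + 3) * ([:1, 1:] * binsq_poly (m + 1)) - of_nat (m + 1) * ([:1, -2, 1:] * binsq_poly m)) i"
  proof cases
    case 1
    show ?thesis
      unfolding 1 coeff_diff C coeff_pCons_mult coeff_binsq_poly by simp
  next
    case 2
    show ?thesis
      unfolding 2 coeff_diff C coeff_pCons_mult coeff_binsq_poly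
      by (simp add: algebra_simps power2_eq_square)
  next
    case (3 j)
    show ?thesis
      unfolding 3 coeff_diff C coeff_pCons_mult coeff_binsq_poly
      using legendre_coeff[of m j] by (simp only: add_2_eq_Suc' Suc_eq_plus1[symmetric] mult_1 mult_minus_left diff_conv_add_uminus)
  qed
qed

lemma disc_binsq_sq: "disc_fps [:1, 1:] [:1, -2, 1:] * (binsq_fps * binsq_fps) = 1"
proof (rule legendre_square)
  show "fps_nth binsq_fps 0 = 1" "fps_nth binsq_fps (Suc 0) = [:1, 1:]"
    by (simp_all add: binsq_fps_def binsq_poly_def monom_Suc one_pCons)
  show "of_nat (m + 2) * fps_nth binsq_fps (Suc (Suc m)) =
      of_nat (2 * m + 3) * ([:1, 1:] * fps_nth binsq_fps (Suc m)) - of_nat (m + 1) * ([:1, -2, 1:] * fps_nth binsq_fps m)" for m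
    using legendre_rec[of m] unfolding binsq_fps_def fps_nth_Abs_fps by (simp only: add_2_eq_Suc' Suc_eq_plus1)
qed

text \<open>The coefficient of \<open>x^m\<close> in \<open>1 / \<Delta>\<close>. With
  \<open>y = s^2\<close>, \<open>\<Delta>\<close> factors as
  \<open>(1 - (1 + s)^2 x) (1 - (1 - s)^2 x)\<close>, and partial fractions give
  \<open>((1 + s)^(2 m + 2) - (1 - s)^(2 m + 2)) / (4 s)\<close>.\<close>

definition binsq2_poly :: "nat \<Rightarrow> complex poly" where
  "binsq2_poly m = (\<Sum>j\<le>m. monom (of_nat ((2 * m + 2) choose (2 * j + 1)) / 2) j)"

lemma coeff_binsq2_poly [simp]: "coeff (binsq2_poly m) j = of_nat ((2 * m + 2) choose (2 * j + 1)) / 2"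
  by (auto simp add: binsq2_poly_def coeff_sum binomial_eq_0 simp del: binomial_Suc_Suc cong: if_cong)

text \<open>The coefficient of \<open>x^m\<close> in \<open>\<Delta>^(-3/2)\<close>, a rescaled
  Gegenbauer polynomial of parameter 3/2. Its coefficients are Narayana numbers times
  \<open>(m + 1) (m + 2) / 2\<close>.\<close>

definition binsq3_poly :: "nat \<Rightarrow> complex poly" where
  "binsq3_poly m = (\<Sum>j\<le>m. monom (of_nat (m + 2) / 2 * of_nat (Suc m choose Suc j) * of_nat (Suc m choose j)) j)"

lemma coeff_binsq3_poly [simp]:
  "coeff (binsq3_poly m) j = of_nat (m + 2) / 2 * of_nat (Suc m choose Suc j) * of_nat (Suc m choose j)"
  by (auto simp add: binsq3_poly_def coeff_sum binomial_eq_0 simp del: binomial_Suc_Suc cong: if_cong)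

lemma coeff_two_mult: "coeff (2 * p * q) i = 2 * coeff (p * q) i" for p q :: "complex poly"
  by (simp add: numeral_poly mult.assoc)

lemma binsq2_rec:
  "binsq2_poly (Suc (Suc m)) - 2 * [:1, 1:] * binsq2_poly (Suc m) + [:1, -2, 1:] * binsq2_poly m = 0"
proof (rule poly_eqI)
  fix i
  let ?M = "2 * m + 2"
  \<comment> \<open>Writing the arguments as towers of \<open>Suc\<close> lets Pascal's rule bring
    every binomial down to row \<open>2 m + 2\<close>, where the identity is linear.\<close>
  have e: "2 * Suc m + 2 = Suc (Suc ?M)" "2 * Suc (Suc m) + 2 = Suc (Suc (Suc (Suc ?M)))"
    "2 * 0 + 1 = Suc 0" "2 * Suc 0 + 1 = Suc (Suc (Suc 0))"
    "2 * Suc j + 1 = Suc (Suc (2 * j + 1))" "2 * Suc (Suc j) + 1 = Suc (Suc (Suc (Suc (2 * j + 1))))" for j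
    by simp_all
  consider "i = 0" | "i = Suc 0" | j where "i = Suc (Suc j)"
    by (metis not0_implies_Suc)
  then have "coeff (binsq2_poly (Suc (Suc m)) - 2 * [:1, 1:] * binsq2_poly (Suc m) + [:1, -2, 1:] * binsq2_poly m) i = 0"
  proof cases
    case 1
    show ?thesis
      unfolding 1 coeff_diff coeff_add coeff_two_mult coeff_pCons_mult coeff_binsq2_poly e
        binomial_Suc_Suc binomial_1 binomial_n_0 of_nat_add
      by (simp add: field_simps)
  next
    case 2
    show ?thesis
      unfolding 2 coeff_diff coeff_add coeff_two_mult coeff_pCons_mult coeff_binsq2_poly e
        binomial_Suc_Suc binomial_1 binomial_n_0 of_nat_add
      by (simp add: field_simps)
  next
    case (3 j)
    show ?thesis
      unfolding 3 coeff_diff coeff_add coeff_two_mult coeff_pCons_mult coeff_binsq2_poly e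
        binomial_Suc_Suc binomial_1 binomial_n_0 of_nat_add
      by (simp add: field_simps)
  qed
  then show "coeff (binsq2_poly (Suc (Suc m)) - 2 * [:1, 1:] * binsq2_poly (Suc m) + [:1, -2, 1:] * binsq2_poly m) i = coeff 0 i"
    by simp
qed

lemma binsq_square: "binsq_fps * binsq_fps = Abs_fps binsq2_poly"
proof -
  let ?D = "disc_fps [:1, 1:] [:1, -2, 1:] :: complex poly fps"
  have "?D * Abs_fps binsq2_poly = 1"
  proof (rule fps_ext)
    fix i
    consider "i = 0" | "i = Suc 0" | j where "i = Suc (Suc j)"
      by (metis not0_implies_Suc)
    then show "fps_nth (?D * Abs_fps binsq2_poly) i = fps_nth 1 i"
    proof cases
      case 1
      show ?thesis unfolding 1 disc_fps_mult_nth by (simp add: binsq2_poly_def)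
    next
      case 2
      show ?thesis unfolding 2 disc_fps_mult_nth
        by (simp add: binsq2_poly_def eval_nat_numeral monom_Suc numeral_poly monom_0)
    next
      case (3 j)
      show ?thesis unfolding 3 disc_fps_mult_nth using binsq2_rec[of j] by simp
    qed
  qed
  then have "binsq_fps * binsq_fps = (binsq_fps * binsq_fps) * (?D * Abs_fps binsq2_poly)"
    by (simp only: mult_1_right)
  also have "\<dots> = (?D * (binsq_fps * binsq_fps)) * Abs_fps binsq2_poly"
    by (simp only: mult_ac)
  finally show ?thesis
    by (simp only: disc_binsq_sq mult_1)
qed

text \<open>\<open>c0\<close>, \<open>c1\<close>, \<open>c2\<close>, \<open>c3\<close> are
  \<open>C(m-1, j+1)\<close> down to \<open>C(m-1, j-2)\<close>. Four neighbours occur because each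
  coefficient is a product of two binomials with adjacent lower indices.\<close>

lemma binsq3_aux:
  fixes c0 c1 c2 c3 j m :: complex
  assumes 1: "(j + 1) * c0 = (m - 1 - j) * c1" and 2: "(m + 1 - j) * c3 = (j - 1) * c2"
    and 3: "j + 1 \<noteq> 0" "m + 1 - j \<noteq> 0"
  shows "(m + 2) / 2 * (c0 + 2 * c1 + c2) * (c1 + 2 * c2 + c3)
     - 2 * ((m + 1) / 2 * (c0 + c1) * (c1 + c2) + (m + 1) / 2 * (c1 + c2) * (c2 + c3))
     + (m / 2 * c0 * c1 - 2 * (m / 2 * c1 * c2) + m / 2 * c2 * c3) = (c1 + c2)\<^sup>2"
proof -
  \<comment> \<open>\<open>E\<close> is twice the difference of the two sides; the factor
    \<open>(j + 1) * (m + 1 - j)\<close> clears the denominators of \<open>c0\<close> in terms of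
    \<open>c1\<close> and of \<open>c3\<close> in terms of \<open>c2\<close>.\<close>
  define E where "E = 2 * c0 * c2 + (m + 2) * c0 * c3 + (2 - m) * c1 * c2 + 2 * c1 * c3"
  have "(j + 1) * (m + 1 - j) * E = 2 * c2 * ((j + 1) * c0) * (m + 1 - j) + (m + 2) * ((j + 1) * c0) * ((m + 1 - j) * c3)
     + (2 - m) * c1 * c2 * ((j + 1) * (m + 1 - j)) + 2 * c1 * (j + 1) * ((m + 1 - j) * c3)"
    by (simp add: E_def algebra_simps)
  also have "\<dots> = 0"
    unfolding 1 2 by (simp add: algebra_simps)
  finally have "E = 0"
    using 3 by simp
  moreover have "(m + 2) / 2 * (c0 + 2 * c1 + c2) * (c1 + 2 * c2 + c3)
     - 2 * ((m + 1) / 2 * (c0 + c1) * (c1 + c2) + (m + 1) / 2 * (c1 + c2) * (c2 + c3))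
     + (m / 2 * c0 * c1 - 2 * (m / 2 * c1 * c2) + m / 2 * c2 * c3) - (c1 + c2)\<^sup>2 = E / 2"
    by (simp add: E_def field_simps power2_eq_square)
  ultimately show ?thesis by simp
qed

lemma binsq3_rec:
  "binsq3_poly (Suc (Suc m)) - 2 * [:1, 1:] * binsq3_poly (Suc m) + [:1, -2, 1:] * binsq3_poly m = binsq_poly (Suc (Suc m))"
proof (rule poly_eqI)
  fix i
  define c where "c j = (of_nat (Suc m choose j) :: complex)" for j
  have c0: "c 0 = 1" and c1: "c (Suc 0) = of_nat m + 1"
    by (simp_all add: c_def)
  have step: "of_nat (Suc j) * c (Suc j) = (of_nat (Suc m) - of_nat j) * c j" for j
    unfolding c_def by (rule binomial_step)
  have P: "of_nat (Suc m choose j) = c j" "of_nat (Suc (Suc m) choose 0) = (1 :: complex)"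
      "of_nat (Suc (Suc (Suc m)) choose 0) = (1 :: complex)"
      "of_nat (Suc (Suc m) choose Suc j) = c j + c (Suc j)"
      "of_nat (Suc (Suc (Suc m)) choose Suc 0) = 2 * c 0 + c (Suc 0)"
      "of_nat (Suc (Suc (Suc m)) choose Suc (Suc j)) = c j + 2 * c (Suc j) + c (Suc (Suc j))" for j
    by (simp_all add: c_def)
  \<comment> \<open>\<open>C2\<close> and \<open>C3\<close> play the parts of
    \<open>c (i - 1)\<close> and \<open>c (i - 2)\<close>. They are parameters because these indices
    are negative for \<open>i < 2\<close>, where the value 0 satisfies the required
    relation.\<close>
  have aux: "of_nat (Suc (Suc m) + 2) / 2 * (c (Suc i) + 2 * c i + C2) * (c i + 2 * C2 + C3)
     - 2 * (of_nat (Suc m + 2) / 2 * (c (Suc i) + c i) * (c i + C2) + of_nat (Suc m + 2) / 2 * (c i + C2) * (C2 + C3))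
     + (of_nat (m + 2) / 2 * c (Suc i) * c i - 2 * (of_nat (m + 2) / 2 * c i * C2) + of_nat (m + 2) / 2 * C2 * C3) = (c i + C2)\<^sup>2"
    if "i \<le> m + 2" "(of_nat m + 3 - of_nat i) * C3 = (of_nat i - 1) * C2" for C2 C3
  proof -
    have "(of_nat m + 2 + 1 - of_nat i :: complex) = of_nat (m + 3 - i)"
      using that by (simp add: of_nat_diff)
    also have "\<dots> \<noteq> 0"
      using that by (subst of_nat_eq_0_iff) simp
    finally have nz: "(of_nat m + 2 + 1 - of_nat i :: complex) \<noteq> 0" .
    have "(of_nat i + 1 :: complex) \<noteq> 0"
      by (metis of_nat_Suc of_nat_neq_0 add.commute)
    from binsq3_aux[of "of_nat i" "c (Suc i)" "of_nat m + 2" "c i" C3 C2, OF _ _ this nz]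
    show ?thesis
      using step[of i] that by (simp add: algebra_simps)
  qed
  show "coeff (binsq3_poly (Suc (Suc m)) - 2 * [:1, 1:] * binsq3_poly (Suc m) + [:1, -2, 1:] * binsq3_poly m) i
     = coeff (binsq_poly (Suc (Suc m))) i"
  proof (cases "i \<le> m + 2")
    case True
    consider "i = 0" | "i = Suc 0" | j where "i = Suc (Suc j)"
      by (metis not0_implies_Suc)
    then show ?thesis
    proof cases
      case 1
      show ?thesis
        using aux[where ?C2.0 = 0 and ?C3.0 = 0]
        unfolding 1 coeff_diff coeff_add coeff_two_mult coeff_pCons_mult coeff_binsq_poly coeff_binsq3_poly P
        by (simp add: c0 c1 algebra_simps)
    next
      case 2
      show ?thesis
        using aux[where ?C2.0 = "c 0" and ?C3.0 = 0] True
        unfolding 2 coeff_diff coeff_add coeff_two_mult coeff_pCons_mult coeff_binsq_poly coeff_binsq3_poly P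
        by (simp add: c0 algebra_simps)
    next
      case (3 j)
      show ?thesis
        using aux[where ?C2.0 = "c (Suc j)" and ?C3.0 = "c j"] step[of j] True
        unfolding 3 coeff_diff coeff_add coeff_two_mult coeff_pCons_mult coeff_binsq_poly coeff_binsq3_poly P
        by (simp add: algebra_simps)
    qed
  next
    case False
    then obtain j where i: "i = Suc (Suc j)" "j > m"
      by (metis add_2_eq_Suc' not_le Suc_less_eq less_iff_Suc_add add_Suc_right)
    then show ?thesis
      unfolding i coeff_diff coeff_add coeff_two_mult coeff_pCons_mult coeff_binsq_poly coeff_binsq3_poly
      by (simp add: binomial_eq_0 del: binomial_Suc_Suc)
  qed
qed

lemma binsq_cube: "binsq_fps * (binsq_fps * binsq_fps) = Abs_fps binsq3_poly"
proof -
  let ?D = "disc_fps [:1, 1:] [:1, -2, 1:] :: complex poly fps"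
  have "?D * Abs_fps binsq3_poly = binsq_fps"
  proof (rule fps_ext)
    fix i
    consider "i = 0" | "i = Suc 0" | j where "i = Suc (Suc j)"
      by (metis not0_implies_Suc)
    then show "fps_nth (?D * Abs_fps binsq3_poly) i = fps_nth binsq_fps i"
    proof cases
      case 1
      show ?thesis unfolding 1 disc_fps_mult_nth by (simp add: binsq3_poly_def binsq_fps_def binsq_poly_def)
    next
      case 2
      show ?thesis unfolding 2 disc_fps_mult_nth
        by (simp add: binsq3_poly_def binsq_fps_def binsq_poly_def eval_nat_numeral monom_Suc numeral_poly monom_0)
    next
      case (3 j)
      show ?thesis unfolding 3 disc_fps_mult_nth binsq_fps_def using binsq3_rec[of j] by simp
    qed
  qed
  then have "binsq_fps * (binsq_fps * binsq_fps) = (?D * Abs_fps binsq3_poly) * (binsq_fps * binsq_fps)"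
    by (simp only:)
  also have "\<dots> = (?D * (binsq_fps * binsq_fps)) * Abs_fps binsq3_poly"
    by (simp only: mult_ac)
  finally show ?thesis
    by (simp only: disc_binsq_sq mult_1)
qed

text \<open>Both sides are the coefficient of \<open>x^m y^j\<close> in \<open>F^2\<close>.\<close>

lemma sum_binomial_sq_conv2:
  "(\<Sum>i\<le>m. \<Sum>r\<le>j. of_nat ((i choose r) * ((m - i) choose (j - r))) ^ 2)
     = (of_nat ((2 * m + 2) choose (2 * j + 1)) / 2 :: complex)"
proof -
  have "coeff (fps_nth (binsq_fps * binsq_fps) m) j = of_nat ((2 * m + 2) choose (2 * j + 1)) / 2"
    unfolding binsq_square by simp
  then show ?thesis
    unfolding fps_mult_nth coeff_sum coeff_mult binsq_fps_def fps_nth_Abs_fps coeff_binsq_poly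
      of_nat_mult power_mult_distrib atLeast0AtMost .
qed

text \<open>Both sides are the coefficient of \<open>x^m y^j\<close> in \<open>F^3\<close>, the left
  one expanded as \<open>F\<close> times \<open>F^2\<close>.\<close>

lemma sum_binomial_sq_conv3:
  "(\<Sum>i\<le>m. \<Sum>l\<le>m - i. \<Sum>r\<le>j. \<Sum>s\<le>j - r.
       of_nat ((i choose r) * (l choose s) * ((m - i - l) choose (j - r - s))) ^ 2)
     = (of_nat (m + 2) / 2 * of_nat (Suc m choose Suc j) * of_nat (Suc m choose j) :: complex)"
proof -
  have "coeff (fps_nth (binsq_fps * (binsq_fps * binsq_fps)) m) j
      = (\<Sum>i\<le>m. \<Sum>l\<le>m - i. \<Sum>r\<le>j. \<Sum>s\<le>j - r.
       of_nat ((i choose r) * (l choose s) * ((m - i - l) choose (j - r - s))) ^ 2)"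
    unfolding fps_mult_nth coeff_sum coeff_mult binsq_fps_def fps_nth_Abs_fps coeff_binsq_poly sum_distrib_left
      of_nat_mult power_mult_distrib mult.assoc atLeast0AtMost ..
  then show ?thesis
    unfolding binsq_cube by simp
qed

subsection \<open>Permutations increasing on a given set\<close>

lemma ex_bij_betw_extending:
  assumes "finite A" "finite B" "card A = card B" and C: "C \<subseteq> A" "inj_on g C" "g ` C \<subseteq> B"
  shows "\<exists>f. bij_betw f A B \<and> (\<forall>x\<in>C. f x = g x)"
proof -
  have fin: "finite C" using assms finite_subset by blast
  have "card (A - C) = card (B - g ` C)"
    using fin assms by (simp add: card_Diff_subset card_image)
  then obtain h where h: "bij_betw h (A - C) (B - g ` C)"
    using assms by (metis finite_Diff finite_same_card_bij)
  define q where "q x = (if x \<in> C then g x else h x)" for x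
  have "bij_betw q (C \<union> (A - C)) (g ` C \<union> (B - g ` C))"
  proof (rule bij_betw_combine)
    show "bij_betw q C (g ` C)"
      using C by (auto simp: bij_betw_def inj_on_def q_def)
    show "bij_betw q (A - C) (B - g ` C)"
      using h by (rule bij_betw_cong[THEN iffD1, rotated]) (auto simp: q_def)
  qed auto
  moreover have "C \<union> (A - C) = A" "g ` C \<union> (B - g ` C) = B"
    using C by auto
  ultimately show ?thesis
    by (intro exI[of _ q]) (simp add: q_def)
qed

text \<open>Left composition with one fixed extension \<open>q\<close> of \<open>g\<close> carries
  the permutations of \<open>S - C\<close> bijectively onto this set.\<close>

lemma card_permutes_extending:
  assumes S: "finite S" and C: "C \<subseteq> S" "inj_on g C" "g ` C \<subseteq> S"
  shows "card {p. p permutes S \<and> (\<forall>x\<in>C. p x = g x)} = fact (card S - card C)"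
proof -
  have fin: "finite C" using S C(1) finite_subset by blast
  obtain h where h: "bij_betw h S S" "\<And>x. x \<in> C \<Longrightarrow> h x = g x"
    using ex_bij_betw_extending[OF S S refl C] by blast
  define q where "q x = (if x \<in> S then h x else x)" for x
  have "bij_betw q S S"
    using h(1) by (rule bij_betw_cong[THEN iffD1, rotated]) (simp add: q_def)
  then have q: "q permutes S"
    by (rule bij_imp_permutes) (simp add: q_def)
  have qC: "q x = g x" if "x \<in> C" for x
    using that C(1) h(2) by (auto simp: q_def)
  have "bij_betw (\<lambda>p. q \<circ> p) {p. p permutes (S - C)} {p. p permutes S \<and> (\<forall>x\<in>C. p x = g x)}"
  proof (rule bij_betw_byWitness[where f' = "\<lambda>p. inv q \<circ> p"])
    show "\<forall>p\<in>{p. p permutes (S - C)}. inv q \<circ> (q \<circ> p) = p"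
      using permutes_inv_o[OF q] by (simp add: o_assoc)
    show "\<forall>p\<in>{p. p permutes S \<and> (\<forall>x\<in>C. p x = g x)}. q \<circ> (inv q \<circ> p) = p"
      using permutes_inv_o[OF q] by (simp add: o_assoc)
    have "(q \<circ> p) permutes S \<and> (\<forall>x\<in>C. (q \<circ> p) x = g x)" if "p permutes (S - C)" for p
      using that q C by (auto simp: qC permutes_not_in intro!: permutes_compose permutes_subset[OF that])
    then show "(\<lambda>p. q \<circ> p) ` {p. p permutes (S - C)} \<subseteq> {p. p permutes S \<and> (\<forall>x\<in>C. p x = g x)}"
      by blast
    have "(inv q \<circ> p) permutes (S - C)" if p: "p permutes S" "\<forall>x\<in>C. p x = g x" for p
    proof (rule permutes_superset)
      show "(inv q \<circ> p) permutes S"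
        by (intro permutes_compose permutes_inv q p)
      show "(inv q \<circ> p) x = x" if "x \<in> S - (S - C)" for x
        using that p(2) permutes_inv_eq[OF q] by (auto simp: qC)
    qed
    then show "(\<lambda>p. inv q \<circ> p) ` {p. p permutes S \<and> (\<forall>x\<in>C. p x = g x)} \<subseteq> {p. p permutes (S - C)}"
      by blast
  qed
  then have "card {p. p permutes S \<and> (\<forall>x\<in>C. p x = g x)} = card {p. p permutes (S - C)}"
    by (rule bij_betw_same_card[symmetric])
  also have "\<dots> = fact (card S - card C)"
    using S C fin by (simp add: card_permutations card_Diff_subset)
  finally show ?thesis .
qed

definition rank :: "nat set \<Rightarrow> nat \<Rightarrow> nat" where
  "rank I a = card {x \<in> I. x < a}"

lemma rank_less:
  assumes "finite I" "a \<in> I" "a < b"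
  shows "rank I a < rank I b"
  unfolding rank_def using assms by (intro psubset_card_mono) auto

lemma inj_on_rank: "finite I \<Longrightarrow> inj_on (rank I) I"
  by (rule linorder_inj_onI) (use rank_less in fastforce)+

lemma bij_betw_rank:
  assumes "finite I"
  shows "bij_betw (rank I) I {..<card I}"
proof -
  have "rank I ` I \<subseteq> {..<card I}"
    unfolding rank_def using assms by (auto intro!: psubset_card_mono)
  then show ?thesis
    using inj_on_rank[OF assms] assms
    by (simp add: bij_betw_def card_image card_subset_eq)
qed

lemma rank_strict_mono_image:
  assumes "strict_mono_on I p" "a \<in> I"
  shows "rank (p ` I) (p a) = rank I a"
proof -
  have inj: "inj_on p I"
    using assms(1) by (rule strict_mono_on_imp_inj_on)
  have "{y \<in> p ` I. y < p a} = p ` {x \<in> I. x < a}"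
    using strict_mono_on_less[OF assms(1)] assms(2) by blast
  moreover have "inj_on p {x \<in> I. x < a}"
    using inj by (rule inj_on_subset) auto
  ultimately show ?thesis
    by (simp add: rank_def card_image)
qed

lemma ex_strict_mono_on:
  fixes I J :: "nat set"
  assumes "finite I" "finite J" "card I = card J"
  obtains f where "strict_mono_on I f" "f ` I = J"
proof -
  obtain g where g: "bij_betw g {..<card J} J" "strict_mono_on {..<card J} g"
    using ex_bij_betw_strict_mono_card[OF assms(2)] by blast
  have r: "rank I ` I = {..<card J}"
    using bij_betw_rank[OF assms(1)] assms(3) by (simp add: bij_betw_def)
  show thesis
  proof
    have "g (rank I a) < g (rank I b)" if "a \<in> I" "b \<in> I" "a < b" for a b
    proof (rule strict_mono_onD[OF g(2)])
      show "rank I a \<in> {..<card J}" "rank I b \<in> {..<card J}"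
        using r that by blast+
      show "rank I a < rank I b"
        using rank_less[OF assms(1)] that by blast
    qed
    then show "strict_mono_on I (g \<circ> rank I)"
      by (simp add: strict_mono_on_def)
    show "(g \<circ> rank I) ` I = J"
      using r g by (simp only: image_comp[symmetric] bij_betw_def)
  qed
qed

text \<open>An increasing map of \<open>I\<close> onto \<open>J\<close> is forced, since it
  preserves ranks. The prescription \<open>h\<close> on \<open>C\<close> either contradicts it or
  adds only the values on \<open>C - I\<close>, and the remaining points are permuted
  freely.\<close>

lemma card_permutes_strict_mono:
  fixes I J C :: "nat set" and n :: nat
  assumes I: "I \<subseteq> {1..n}" "card I = k" and J: "J \<subseteq> {1..n}" "card J = k"
    and C: "C \<subseteq> {1..n}" "inj_on h C" "h ` C \<subseteq> {1..n}"
  shows "card {p. p permutes {1..n} \<and> strict_mono_on I p \<and> p ` I = J \<and> (\<forall>c\<in>C. p c = h c)}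
    = (if \<forall>c\<in>C. (c \<in> I \<longleftrightarrow> h c \<in> J) \<and> (c \<in> I \<longrightarrow> rank I c = rank J (h c))
       then fact (n - k - card (C - I)) else 0)"
proof (cases "\<forall>c\<in>C. (c \<in> I \<longleftrightarrow> h c \<in> J) \<and> (c \<in> I \<longrightarrow> rank I c = rank J (h c))")
  case True
  have fin: "finite I" "finite J" "finite C"
    using assms finite_subset by blast+
  obtain f where f: "strict_mono_on I f" "f ` I = J"
    using ex_strict_mono_on[OF fin(1,2)] I J by metis
  have rank_f: "rank I x = rank J (f x)" if "x \<in> I" for x
    using rank_strict_mono_image[OF f(1) that] f(2) by simp
  define g where "g x = (if x \<in> I then f x else h x)" for x
  have hf: "h c = f c" if "c \<in> C" "c \<in> I" for c
  proof -
    have "rank J (h c) = rank J (f c)" "h c \<in> J" "f c \<in> J"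
      using True that rank_f[of c] f(2) by auto
    then show ?thesis
      using inj_on_rank[OF fin(2)] by (simp add: inj_on_eq_iff)
  qed
  have iff: "strict_mono_on I p \<and> p ` I = J \<longleftrightarrow> (\<forall>x\<in>I. p x = f x)" for p
  proof
    assume p: "strict_mono_on I p \<and> p ` I = J"
    show "\<forall>x\<in>I. p x = f x"
    proof
      fix x assume x: "x \<in> I"
      have "rank J (p x) = rank J (f x)"
        using rank_strict_mono_image[of I p x] p rank_f[OF x] x by simp
      moreover have "p x \<in> J" "f x \<in> J"
        using p f x by blast+
      ultimately show "p x = f x"
        using inj_on_rank[OF fin(2)] by (simp add: inj_on_eq_iff)
    qed
  next
    assume "\<forall>x\<in>I. p x = f x"
    then show "strict_mono_on I p \<and> p ` I = J"
      using f by (auto simp: strict_mono_on_def)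
  qed
  have "{p. p permutes {1..n} \<and> strict_mono_on I p \<and> p ` I = J \<and> (\<forall>c\<in>C. p c = h c)}
     = {p. p permutes {1..n} \<and> (\<forall>x \<in> I \<union> C. p x = g x)}" (is "?L = ?R")
  proof -
    have "(strict_mono_on I p \<and> p ` I = J \<and> (\<forall>c\<in>C. p c = h c)) \<longleftrightarrow> (\<forall>x \<in> I \<union> C. p x = g x)" for p
      using iff[of p] hf by (auto simp: g_def)
    then show ?thesis by simp
  qed
  moreover have "card ?R = fact (card {1..n} - card (I \<union> C))"
  proof (rule card_permutes_extending)
    show "inj_on g (I \<union> C)"
    proof (rule inj_onI)
      fix x y assume xy: "x \<in> I \<union> C" "y \<in> I \<union> C" "g x = g y"
      \<comment> \<open>The points sent into \<open>J\<close> are exactly those of \<open>I\<close>,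
        so a collision of values lies within \<open>I\<close> or within \<open>C\<close>, where
        injectivity is known.\<close>
      have gI: "g z \<in> J \<longleftrightarrow> z \<in> I" if "z \<in> I \<union> C" for z
        using that True f(2) by (auto simp: g_def)
      then have "x \<in> I \<longleftrightarrow> y \<in> I"
        using xy by metis
      then show "x = y"
        using xy inj_onD[OF strict_mono_on_imp_inj_on[OF f(1)], of x y] inj_onD[OF C(2), of x y]
        by (auto simp: g_def)
    qed
    show "g ` (I \<union> C) \<subseteq> {1..n}"
      using f(2) J C by (auto simp: g_def)
  qed (use I C in auto)
  moreover have "card (I \<union> C) = k + card (C - I)"
    using fin I card_Un_disjoint[of I "C - I"] by simp
  ultimately show ?thesis
    using True by simp
next
  case False
  have "{p. p permutes {1..n} \<and> strict_mono_on I p \<and> p ` I = J \<and> (\<forall>c\<in>C. p c = h c)} = {}"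
  proof (rule ccontr)
    assume "\<not> ?thesis"
    then obtain p where p: "p permutes {1..n}" "strict_mono_on I p" "p ` I = J" "\<forall>c\<in>C. p c = h c"
      by blast
    have "c \<in> I \<longleftrightarrow> h c \<in> J" if "c \<in> C" for c
      using p(3,4) that inj_image_mem_iff[OF permutes_inj[OF p(1)], of c I] by auto
    moreover have "rank I c = rank J (h c)" if "c \<in> C" "c \<in> I" for c
      using rank_strict_mono_image[OF p(2) that(2)] p that by simp
    ultimately show False using False by blast
  qed
  then show ?thesis
    using False by (simp only: if_False card.empty)
qed

lemma sum_indicator_card: "finite A \<Longrightarrow> (\<Sum>x\<in>A. if P x then 1 else 0) = card {x \<in> A. P x}"
  by (simp add: sum.inter_filter[symmetric])

text \<open>For given \<open>p\<close> and \<open>I\<close> exactly one \<open>J\<close>, the image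
  of \<open>I\<close>, contributes. Making it a separate index turns the weighted sum into counts of
  permutations with \<open>I\<close> and \<open>J\<close> both fixed.\<close>

lemma sum_N_id_conditional:
  "(\<Sum>p | p permutes {1..n} \<and> Q p. N_id k n p) =
     (\<Sum>(I, J) \<in> {I. I \<subseteq> {1..n} \<and> card I = k} \<times> {I. I \<subseteq> {1..n} \<and> card I = k}.
        card {p. p permutes {1..n} \<and> strict_mono_on I p \<and> p ` I = J \<and> Q p})"
proof -
  let ?K = "{I. I \<subseteq> {1..n} \<and> card I = k}" and ?P = "{p. p permutes {1..n} \<and> Q p}"
  have fin: "finite ?P"
    using finite_permutations[of "{1..n}"] by (rule rev_finite_subset) auto
  have K: "finite ?K" by simp
  have N: "N_id k n p = (\<Sum>(I, J) \<in> ?K \<times> ?K. if strict_mono_on I p \<and> p ` I = J then 1 else 0)"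
    if "p \<in> ?P" for p
  proof -
    have im: "p ` I \<in> ?K" if "I \<in> ?K" for I
    proof -
      have p: "p permutes {1..n}" using \<open>p \<in> ?P\<close> by simp
      have "card (p ` I) = card I"
        by (rule card_image) (rule inj_on_subset[OF permutes_inj[OF p]], simp)
      moreover have "p ` I \<subseteq> {1..n}"
        using that permutes_image[OF p] by blast
      ultimately show ?thesis
        using that by simp
    qed
    have "N_id k n p = card {I \<in> ?K. strict_mono_on I p}"
      by (simp add: N_id_def conj_assoc)
    also have "\<dots> = (\<Sum>I\<in>?K. if strict_mono_on I p then 1 else 0)"
      by (rule sum_indicator_card[OF K, symmetric])
    also have "\<dots> = (\<Sum>I\<in>?K. \<Sum>J\<in>?K. if strict_mono_on I p \<and> p ` I = J then 1 else 0)"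
    proof (rule sum.cong[OF refl])
      fix I assume I: "I \<in> ?K"
      have "(\<Sum>J\<in>?K. if strict_mono_on I p \<and> p ` I = J then 1 else 0)
         = (\<Sum>J\<in>?K. if p ` I = J then (if strict_mono_on I p then 1 else 0) else 0)"
        by (intro sum.cong) auto
      also have "\<dots> = (if strict_mono_on I p then 1 else 0)"
        using im[OF I] K by (simp only: sum.delta' if_True)
      finally show "(if strict_mono_on I p then 1 else 0 :: nat)
         = (\<Sum>J\<in>?K. if strict_mono_on I p \<and> p ` I = J then 1 else 0)" ..
    qed
    finally show ?thesis
      by (simp add: sum.cartesian_product)
  qed
  have S: "(\<Sum>p\<in>?P. if strict_mono_on I p \<and> p ` I = J then 1 else 0) =
      card {p. p permutes {1..n} \<and> strict_mono_on I p \<and> p ` I = J \<and> Q p}" for I J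
  proof -
    have "(\<Sum>p\<in>?P. if strict_mono_on I p \<and> p ` I = J then 1 else 0) = card {p \<in> ?P. strict_mono_on I p \<and> p ` I = J}"
      by (rule sum_indicator_card[OF fin])
    also have "{p \<in> ?P. strict_mono_on I p \<and> p ` I = J} = {p. p permutes {1..n} \<and> strict_mono_on I p \<and> p ` I = J \<and> Q p}"
      by auto
    finally show ?thesis .
  qed
  have "(\<Sum>p\<in>?P. N_id k n p) = (\<Sum>p\<in>?P. \<Sum>(I, J) \<in> ?K \<times> ?K. if strict_mono_on I p \<and> p ` I = J then 1 else 0)"
    by (rule sum.cong[OF refl N])
  also have "\<dots> = (\<Sum>(I, J) \<in> ?K \<times> ?K. \<Sum>p\<in>?P. if strict_mono_on I p \<and> p ` I = J then 1 else 0)"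
    unfolding case_prod_unfold by (rule sum.swap)
  finally show ?thesis
    unfolding S .
qed

subsection \<open>Pairs of subsets with marked elements of equal rank\<close>

definition ksubsets :: "nat set \<Rightarrow> nat \<Rightarrow> nat set set" where
  "ksubsets U k = {I. I \<subseteq> U \<and> card I = k}"

lemma finite_ksubsets [simp]: "finite U \<Longrightarrow> finite (ksubsets U k)"
  by (simp add: ksubsets_def)

lemma card_ksubsets: "finite U \<Longrightarrow> card (ksubsets U k) = card U choose k"
  by (simp add: ksubsets_def n_subsets)

lemma card_greater_rank:
  assumes "finite U" "b \<in> U"
  shows "card {x \<in> U. b < x} = card U - 1 - rank U b"
proof -
  have "U = {x \<in> U. x < b} \<union> {b} \<union> {x \<in> U. b < x}"
    using assms(2) by auto
  then have "card U = card ({x \<in> U. x < b} \<union> {b} \<union> {x \<in> U. b < x})"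
    by simp
  also have "\<dots> = rank U b + 1 + card {x \<in> U. b < x}"
    using assms(1) by (subst card_Un_disjoint, simp, simp, force)
      (subst card_Un_disjoint, auto simp: rank_def)
  finally show ?thesis by simp
qed

text \<open>Such a set is a choice of \<open>q\<close> elements below \<open>b\<close> and an
  independent choice of \<open>k - 1 - q\<close> above. The predicate \<open>P\<close> on the lower
  part lets a second marked element be treated by the same bijection.\<close>

lemma card_ksubsets_split:
  assumes U: "finite U" "b \<in> U" and q: "q < k"
  shows "card {I \<in> ksubsets U k. b \<in> I \<and> rank I b = q \<and> P {x \<in> I. x < b}}
    = card {A \<in> ksubsets {x \<in> U. x < b} q. P A} * ((card U - 1 - rank U b) choose (k - 1 - q))"
proof -
  let ?L = "{x \<in> U. x < b}" and ?R = "{x \<in> U. b < x}"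
  let ?S = "{I \<in> ksubsets U k. b \<in> I \<and> rank I b = q \<and> P {x \<in> I. x < b}}"
  let ?T = "{A \<in> ksubsets ?L q. P A} \<times> ksubsets ?R (k - 1 - q)"
  have "bij_betw (\<lambda>(A, B). insert b (A \<union> B)) ?T ?S"
  proof (rule bij_betw_byWitness[where f' = "\<lambda>I. ({x \<in> I. x < b}, {x \<in> I. b < x})"])
    show "\<forall>z\<in>?T. ({x \<in> (case z of (A, B) \<Rightarrow> insert b (A \<union> B)). x < b}, {x \<in> (case z of (A, B) \<Rightarrow> insert b (A \<union> B)). b < x}) = z"
      by (auto simp: ksubsets_def)
    show "\<forall>I\<in>?S. (case ({x \<in> I. x < b}, {x \<in> I. b < x}) of (A, B) \<Rightarrow> insert b (A \<union> B)) = I"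
      by auto
    show "(\<lambda>(A, B). insert b (A \<union> B)) ` ?T \<subseteq> ?S"
    proof -
      have "insert b (A \<union> B) \<in> ?S"
        if AB: "A \<in> ksubsets ?L q" "P A" "B \<in> ksubsets ?R (k - 1 - q)" for A B
      proof -
      have fin: "finite A" "finite B"
        using AB U(1) by (auto simp: ksubsets_def elim: rev_finite_subset)
      have lt: "{x \<in> insert b (A \<union> B). x < b} = A"
        using AB by (auto simp: ksubsets_def)
      have "card (A \<union> B) = q + (k - 1 - q)"
      proof -
        have "A \<inter> B = {}"
          using AB by (fastforce simp: ksubsets_def)
        then show ?thesis
          using AB fin by (simp add: card_Un_disjoint ksubsets_def)
      qed
      moreover have "b \<notin> A \<union> B"
        using AB by (auto simp: ksubsets_def)
      ultimately have "card (insert b (A \<union> B)) = k"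
        using fin q by simp
      moreover have "insert b (A \<union> B) \<subseteq> U"
        using AB U(2) by (auto simp: ksubsets_def)
      moreover have "rank (insert b (A \<union> B)) b = q"
        unfolding rank_def lt using AB by (simp add: ksubsets_def)
      ultimately show ?thesis
        unfolding mem_Collect_eq lt using AB by (simp add: ksubsets_def)
      qed
      then show ?thesis by auto
    qed
    show "(\<lambda>I. ({x \<in> I. x < b}, {x \<in> I. b < x})) ` ?S \<subseteq> ?T"
    proof -
      have "({x \<in> I. x < b}, {x \<in> I. b < x}) \<in> ?T"
        if I: "I \<in> ksubsets U k" "b \<in> I" "P {x \<in> I. x < b}" "q = rank I b" for I
      proof -
      have "finite I"
        using I U(1) by (auto simp: ksubsets_def elim: rev_finite_subset)
      from card_greater_rank[OF this I(2)] I(1)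
      have "card {x \<in> I. b < x} = k - 1 - rank I b"
        by (simp add: ksubsets_def)
      then have "{x \<in> I. b < x} \<in> ksubsets ?R (k - 1 - rank I b)"
        using I(1) by (auto simp: ksubsets_def)
      moreover have "{x \<in> I. x < b} \<in> ksubsets ?L (rank I b)"
        using I(1) by (auto simp: ksubsets_def rank_def)
      ultimately show ?thesis
        using I(3,4) by simp
      qed
      then show ?thesis by auto
    qed
  qed
  then have "card ?S = card ?T"
    by (rule bij_betw_same_card[symmetric])
  then show ?thesis
    using U by (simp add: card_cartesian_product card_ksubsets card_greater_rank)
qed

lemma card_ksubsets_rank:
  assumes "finite U" "a \<in> U" "r < k"
  shows "card {I \<in> ksubsets U k. a \<in> I \<and> rank I a = r}
    = (rank U a choose r) * ((card U - 1 - rank U a) choose (k - 1 - r))"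
proof -
  have "card (ksubsets {x \<in> U. x < a} r) = rank U a choose r"
    using assms(1) by (simp add: card_ksubsets rank_def)
  then show ?thesis
    using card_ksubsets_split[OF assms, of "\<lambda>_. True"] by simp
qed

lemma rank_lessThan_subset: "a < b \<Longrightarrow> rank {x \<in> I. x < b} a = rank I a"
  unfolding rank_def by (rule arg_cong[where f = card]) auto

text \<open>The set is split at the larger element \<open>b\<close>, and then its lower part at
  \<open>a\<close>; \<open>s\<close> counts the elements of \<open>I\<close> strictly between the
  two.\<close>

lemma card_ksubsets_rank2:
  assumes U: "finite U" "a \<in> U" "b \<in> U" and ab: "a < b" and rs: "r + s + 1 < k"
  shows "card {I \<in> ksubsets U k. a \<in> I \<and> b \<in> I \<and> rank I a = r \<and> rank I b = r + s + 1}
    = (rank U a choose r) * ((rank U b - rank U a - 1) choose s) * ((card U - 1 - rank U b) choose (k - 2 - r - s))"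
proof -
  have eq: "{I \<in> ksubsets U k. a \<in> I \<and> b \<in> I \<and> rank I a = r \<and> rank I b = r + s + 1}
    = {I \<in> ksubsets U k. b \<in> I \<and> rank I b = r + s + 1 \<and> (a \<in> {x \<in> I. x < b} \<and> rank {x \<in> I. x < b} a = r)}"
    using ab by (auto simp: rank_lessThan_subset)
  have "card {I \<in> ksubsets U k. a \<in> I \<and> b \<in> I \<and> rank I a = r \<and> rank I b = r + s + 1} = card {A \<in> ksubsets {x \<in> U. x < b} (r + s + 1). a \<in> A \<and> rank A a = r}
      * ((card U - 1 - rank U b) choose (k - 1 - (r + s + 1)))"
    unfolding eq by (rule card_ksubsets_split[where P = "\<lambda>A. a \<in> A \<and> rank A a = r", OF U(1,3)]) (use rs in simp)
  also have "card {A \<in> ksubsets {x \<in> U. x < b} (r + s + 1). a \<in> A \<and> rank A a = r}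
     = (rank U a choose r) * ((rank U b - 1 - rank U a) choose s)"
  proof -
    have "card {x \<in> U. x < b} = rank U b"
      by (simp add: rank_def)
    then show ?thesis
      using card_ksubsets_rank[of "{x \<in> U. x < b}" a r "r + s + 1"] U ab rank_lessThan_subset[OF ab, of U]
      by simp
  qed
  finally show ?thesis
    by (simp add: diff_commute)
qed

lemma card_pairs_eq:
  assumes "finite M" "finite N" "finite T" "f ` M \<subseteq> T"
  shows "card {(x, y). x \<in> M \<and> y \<in> N \<and> f x = g y} = (\<Sum>t\<in>T. card {x \<in> M. f x = t} * card {y \<in> N. g y = t})"
proof -
  have "{(x, y). x \<in> M \<and> y \<in> N \<and> f x = g y} = (\<Union>t\<in>T. {x \<in> M. f x = t} \<times> {y \<in> N. g y = t})"
    using assms(4) by auto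
  also have "card \<dots> = (\<Sum>t\<in>T. card ({x \<in> M. f x = t} \<times> {y \<in> N. g y = t}))"
    using assms by (intro card_UN_disjoint) auto
  finally show ?thesis
    by (simp add: card_cartesian_product)
qed

definition rank_pairs :: "nat set \<Rightarrow> nat set \<Rightarrow> nat \<Rightarrow> nat \<Rightarrow> nat \<Rightarrow> (nat set \<times> nat set) set" where
  "rank_pairs U V k a b = {(I, J). I \<in> ksubsets U k \<and> J \<in> ksubsets V k \<and> a \<in> I \<and> b \<in> J \<and> rank I a = rank J b}"

text \<open>
  For \<open>r < k\<close>, the number of \<open>k\<close>-subsets of an \<open>m\<close>-element chain that contain the element
  at position \<open>u\<close> (counted from 0) as their element of rank \<open>r\<close>.
\<close>

definition marked :: "nat \<Rightarrow> nat \<Rightarrow> nat \<Rightarrow> nat \<Rightarrow> nat" where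
  "marked m k u r = (u choose r) * ((m - 1 - u) choose (k - 1 - r))"

lemma rank_less_card: "finite I \<Longrightarrow> a \<in> I \<Longrightarrow> rank I a < card I"
  using bij_betw_rank[of I] by (auto simp: bij_betw_def)

lemma card_rank_pairs:
  assumes "finite U" "finite V" "a \<in> U" "b \<in> V"
  shows "card (rank_pairs U V k a b)
    = (\<Sum>r<k. marked (card U) k (rank U a) r * marked (card V) k (rank V b) r)"
proof -
  have "rank_pairs U V k a b = {(I, J). I \<in> {I \<in> ksubsets U k. a \<in> I} \<and> J \<in> {I \<in> ksubsets V k. b \<in> I} \<and> rank I a = rank J b}"
    by (auto simp: rank_pairs_def)
  also have "card \<dots> = (\<Sum>r<k. card {I \<in> {I \<in> ksubsets U k. a \<in> I}. rank I a = r} * card {I \<in> {I \<in> ksubsets V k. b \<in> I}. rank I b = r})"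
  proof (rule card_pairs_eq)
    show "(\<lambda>I. rank I a) ` {I \<in> ksubsets U k. a \<in> I} \<subseteq> {..<k}"
      using assms(1) by (auto simp: ksubsets_def intro!: rank_less_card elim: rev_finite_subset)
  qed (use assms in auto)
  also have "\<dots> = (\<Sum>r<k. marked (card U) k (rank U a) r * marked (card V) k (rank V b) r)"
    using assms by (intro sum.cong refl) (simp add: card_ksubsets_rank marked_def conj_assoc)
  finally show ?thesis .
qed

text \<open>Every \<open>k\<close>-subset has exactly one element of rank \<open>r\<close>, so
  summing over the position of that element counts each subset once.\<close>

lemma sum_marked:
  assumes "r < k"
  shows "(\<Sum>u<m. marked m k u r) = m choose k"
proof -
  let ?K = "ksubsets {..<m} k"
  have rk: "rank {..<m} a = a" if "a < m" for a
  proof -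
    have "{x \<in> {..<m}. x < a} = {..<a}" using that by auto
    then show ?thesis by (simp add: rank_def)
  qed
  have "(\<Sum>u<m. marked m k u r) = (\<Sum>u<m. card {I \<in> ?K. u \<in> I \<and> rank I u = r})"
    using assms by (intro sum.cong refl) (simp add: card_ksubsets_rank marked_def rk)
  also have "\<dots> = (\<Sum>u<m. \<Sum>I\<in>?K. if u \<in> I \<and> rank I u = r then 1 else 0)"
    by (simp add: sum_indicator_card)
  also have "\<dots> = (\<Sum>I\<in>?K. \<Sum>u<m. if u \<in> I \<and> rank I u = r then 1 else 0)"
    by (rule sum.swap)
  also have "\<dots> = (\<Sum>I\<in>?K. 1)"
  proof (rule sum.cong[OF refl])
    fix I assume I: "I \<in> ?K"
    then have sub: "I \<subseteq> {..<m}" and card: "card I = k"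
      by (auto simp: ksubsets_def)
    have fin: "finite I"
      using sub finite_subset by blast
    obtain x where x: "x \<in> I" "rank I x = r"
    proof -
      have "r \<in> rank I ` I"
        using bij_betw_rank[OF fin] assms card by (simp add: bij_betw_def)
      then show ?thesis using that by blast
    qed
    have "{u \<in> {..<m}. u \<in> I \<and> rank I u = r} = {x}"
      using x sub inj_on_rank[OF fin] by (auto dest: inj_onD)
    then show "(\<Sum>u<m. if u \<in> I \<and> rank I u = r then 1 else 0 :: nat) = 1"
      by (simp add: sum_indicator_card)
  qed
  also have "\<dots> = m choose k"
    by (simp add: card_ksubsets)
  finally show ?thesis .
qed

text \<open>For \<open>m, k \<ge> 1\<close> this is the coefficient of
  \<open>x^(m-1) y^(k-1)\<close> in \<open>F^2\<close>: the marked point cuts both the chain and the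
  chosen subset in two.\<close>

definition conv2 :: "nat \<Rightarrow> nat \<Rightarrow> nat" where
  "conv2 m k = (\<Sum>u<m. \<Sum>r<k. marked m k u r ^ 2)"

lemma sum_rank_pairs_diag:
  assumes "finite U"
  shows "(\<Sum>a\<in>U. card (rank_pairs U U k a a)) = conv2 (card U) k"
proof -
  have "(\<Sum>a\<in>U. card (rank_pairs U U k a a)) = (\<Sum>a\<in>U. \<Sum>r<k. marked (card U) k (rank U a) r ^ 2)"
    using assms by (intro sum.cong refl) (simp add: card_rank_pairs power2_eq_square)
  also have "\<dots> = conv2 (card U) k"
    unfolding conv2_def by (rule sum.reindex_bij_betw[OF bij_betw_rank[OF assms]])
  finally show ?thesis .
qed

lemma rank_interval:
  assumes "a \<in> {1..n}"
  shows "rank {1..n} a = a - 1"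
proof -
  have "{x \<in> {1..n}. x < a} = {1..<a}" using assms by auto
  then show ?thesis by (simp add: rank_def)
qed

lemma rank_interval_remove:
  assumes "a \<in> {1..n}" "b \<in> {1..n}"
  shows "a < b \<Longrightarrow> rank ({1..n} - {b}) a = a - 1" "b < a \<Longrightarrow> rank ({1..n} - {b}) a = a - 2"
proof -
  show "rank ({1..n} - {b}) a = a - 1" if "a < b"
  proof -
    have "{x \<in> {1..n} - {b}. x < a} = {1..<a}" using assms that by auto
    then show ?thesis by (simp add: rank_def)
  qed
  show "rank ({1..n} - {b}) a = a - 2" if "b < a"
  proof -
    have "{x \<in> {1..n} - {b}. x < a} = {1..<a} - {b}" using assms that by auto
    then show ?thesis using assms that by (simp add: rank_def)
  qed
qed

text \<open>After deletion of the other point, \<open>a\<close> and \<open>b\<close> sit at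
  positions \<open>(a - 1, b - 2)\<close> if \<open>a < b\<close> and \<open>(a - 2, b - 1)\<close>
  if \<open>a > b\<close>. The two cases therefore cover \<open>u \<le> v\<close> and
  \<open>u \<ge> v\<close>, meeting the diagonal twice. For each of the \<open>k\<close> ranks the
  full sum factors by \<open>sum_marked\<close>; the second copy of the diagonal is
  \<open>conv2\<close>.\<close>

lemma sum_rank_pairs_swap:
  "(\<Sum>a\<in>{1..n}. \<Sum>b\<in>{1..n} - {a}. card (rank_pairs ({1..n} - {b}) ({1..n} - {a}) k a b))
    = k * ((n - 1) choose k) ^ 2 + conv2 (n - 1) k"
proof -
  define G where "G u v = (\<Sum>r<k. marked (n - 1) k u r * marked (n - 1) k v r)" for u v
  let ?P = "\<lambda>R. {(a, b). a \<in> {1..n} \<and> b \<in> {1..n} \<and> R a b}"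
  let ?Q = "\<lambda>R. {(u, v). u < n - 1 \<and> v < n - 1 \<and> R u v}"
  have fin: "finite (?P R)" "finite (?Q R)" for R
    by (rule finite_subset[of _ "{1..n} \<times> {1..n}"], auto)
       (rule finite_subset[of _ "{..<n} \<times> {..<n}"], auto)
  have *: "card (rank_pairs ({1..n} - {b}) ({1..n} - {a}) k a b) = G (rank ({1..n} - {b}) a) (rank ({1..n} - {a}) b)"
    if "a \<in> {1..n}" "b \<in> {1..n} - {a}" for a b
    using that by (subst card_rank_pairs) (auto simp: G_def)
  have "(\<Sum>a\<in>{1..n}. \<Sum>b\<in>{1..n} - {a}. card (rank_pairs ({1..n} - {b}) ({1..n} - {a}) k a b))
     = (\<Sum>a\<in>{1..n}. \<Sum>b\<in>{1..n} - {a}. G (rank ({1..n} - {b}) a) (rank ({1..n} - {a}) b))"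
    by (intro sum.cong refl *)
  also have "\<dots> = (\<Sum>(a, b) \<in> ?P (<) \<union> ?P (>). G (rank ({1..n} - {b}) a) (rank ({1..n} - {a}) b))"
    by (subst sum.Sigma) (auto intro!: sum.cong)
  also have "\<dots> = (\<Sum>(a, b) \<in> ?P (<). G (rank ({1..n} - {b}) a) (rank ({1..n} - {a}) b))
      + (\<Sum>(a, b) \<in> ?P (>). G (rank ({1..n} - {b}) a) (rank ({1..n} - {a}) b))"
    by (intro sum.union_disjoint fin) auto
  also have "(\<Sum>(a, b) \<in> ?P (<). G (rank ({1..n} - {b}) a) (rank ({1..n} - {a}) b)) = (\<Sum>(u, v) \<in> ?Q (\<le>). G u v)"
    by (rule sum.reindex_bij_witness[where i = "\<lambda>(u, v). (u + 1, v + 2)" and j = "\<lambda>(a, b). (a - 1, b - 2)"])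
      (auto simp: rank_interval_remove simp del: One_nat_def)
  also have "(\<Sum>(a, b) \<in> ?P (>). G (rank ({1..n} - {b}) a) (rank ({1..n} - {a}) b)) = (\<Sum>(u, v) \<in> ?Q (\<ge>). G u v)"
    by (rule sum.reindex_bij_witness[where i = "\<lambda>(u, v). (u + 2, v + 1)" and j = "\<lambda>(a, b). (a - 2, b - 1)"])
      (auto simp: rank_interval_remove simp del: One_nat_def)
  also have "(\<Sum>(u, v) \<in> ?Q (\<le>). G u v) + (\<Sum>(u, v) \<in> ?Q (\<ge>). G u v)
      = (\<Sum>(u, v) \<in> ?Q (\<le>) \<union> ?Q (\<ge>). G u v) + (\<Sum>(u, v) \<in> ?Q (\<le>) \<inter> ?Q (\<ge>). G u v)"
    by (rule sum.union_inter[symmetric]) (rule fin)+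
  also have "?Q (\<le>) \<union> ?Q (\<ge>) = {..<n - 1} \<times> {..<n - 1}"
    by auto
  also have "(\<Sum>(u, v) \<in> ?Q (\<le>) \<inter> ?Q (\<ge>). G u v) = (\<Sum>u<n - 1. G u u)"
    by (rule sum.reindex_bij_witness[where i = "\<lambda>u. (u, u)" and j = fst]) auto
  also have "(\<Sum>u<n - 1. G u u) = conv2 (n - 1) k"
    by (simp add: G_def conv2_def power2_eq_square)
  also have "(\<Sum>(u, v) \<in> {..<n - 1} \<times> {..<n - 1}. G u v) = (\<Sum>u<n - 1. \<Sum>v<n - 1. G u v)"
    by (simp add: sum.cartesian_product)
  also have "\<dots> = (\<Sum>u<n - 1. \<Sum>r<k. \<Sum>v<n - 1. marked (n - 1) k u r * marked (n - 1) k v r)"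
    unfolding G_def by (intro sum.cong refl sum.swap)
  also have "\<dots> = (\<Sum>r<k. \<Sum>u<n - 1. \<Sum>v<n - 1. marked (n - 1) k u r * marked (n - 1) k v r)"
    by (rule sum.swap)
  also have "\<dots> = (\<Sum>r<k. (\<Sum>u<n - 1. marked (n - 1) k u r) * (\<Sum>v<n - 1. marked (n - 1) k v r))"
    by (simp only: sum_product)
  also have "\<dots> = k * ((n - 1) choose k) ^ 2"
    by (simp add: sum_marked power2_eq_square)
  finally show ?thesis .
qed

definition rank_pairs2 :: "nat set \<Rightarrow> nat \<Rightarrow> nat \<Rightarrow> nat \<Rightarrow> nat \<Rightarrow> nat \<Rightarrow> (nat set \<times> nat set) set" where
  "rank_pairs2 U k a b c d = {(I, J). I \<in> ksubsets U k \<and> J \<in> ksubsets U k \<and> a \<in> I \<and> b \<in> I \<and> c \<in> J \<and> d \<in> J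
     \<and> rank I a = rank J c \<and> rank I b = rank J d}"

text \<open>An increasing bijection cannot exchange two points, so a two-cycle never has both of its
  points in \<open>I\<close>.\<close>

lemma rank_pairs2_swap:
  assumes "finite U" "a \<noteq> b"
  shows "rank_pairs2 U k a b b a = {}"
proof -
  have "False" if "(I, J) \<in> rank_pairs2 U k a b b a" for I J
  proof -
    from that have *: "finite I" "finite J" "a \<in> I" "b \<in> I" "a \<in> J" "b \<in> J"
        "rank I a = rank J b" "rank I b = rank J a"
      using assms(1) by (auto simp: rank_pairs2_def ksubsets_def intro: finite_subset)
    show False
      using assms(2) rank_less[of I a b] rank_less[of J a b] rank_less[of I b a] rank_less[of J b a] *
      by (cases a b rule: linorder_cases) simp_all
  qed
  then show ?thesis by auto
qed

lemma rank_pairs2_commute: "rank_pairs2 U k a b c d = rank_pairs2 U k b a d c"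
  unfolding rank_pairs2_def by auto

lemma card_rank_pairs2:
  assumes U: "finite U" "a \<in> U" "b \<in> U" and ab: "a < b"
  shows "card (rank_pairs2 U k a b a b) = (\<Sum>(r, s) | r + s + 1 < k.
     ((rank U a choose r) * ((rank U b - rank U a - 1) choose s) * ((card U - 1 - rank U b) choose (k - 2 - r - s)))\<^sup>2)"
proof -
  let ?M = "{I \<in> ksubsets U k. a \<in> I \<and> b \<in> I}" and ?T = "{(r, s). r + s + 1 < k}"
  \<comment> \<open>Recording the gap between the two ranks instead of the rank of \<open>b\<close>
    gives the index set of a threefold convolution.\<close>
  let ?f = "\<lambda>I. (rank I a, rank I b - rank I a - 1)"
  have lt: "rank I a < rank I b" "rank I b < k" if "I \<in> ?M" for I
  proof -
    have "finite I" "card I = k"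
      using that U(1) by (auto simp: ksubsets_def intro: finite_subset)
    then show "rank I a < rank I b" "rank I b < k"
      using that rank_less[of I a b] ab rank_less_card[of I b] by auto
  qed
  have "rank_pairs2 U k a b a b = {(I, J). I \<in> ?M \<and> J \<in> ?M \<and> ?f I = ?f J}"
  proof -
    have "?f I = ?f J \<longleftrightarrow> rank I a = rank J a \<and> rank I b = rank J b" if "I \<in> ?M" "J \<in> ?M" for I J
      using lt[OF that(1)] lt[OF that(2)] by auto
    then show ?thesis
      unfolding rank_pairs2_def by blast
  qed
  moreover have "card {(I, J). I \<in> ?M \<and> J \<in> ?M \<and> ?f I = ?f J}
      = (\<Sum>t\<in>?T. card {I \<in> ?M. ?f I = t} * card {I \<in> ?M. ?f I = t})"
  proof (rule card_pairs_eq)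
    show "finite ?T"
      by (rule finite_subset[of _ "{..k} \<times> {..k}"]) auto
    show "?f ` ?M \<subseteq> ?T"
    proof (rule image_subsetI)
      fix I assume "I \<in> ?M"
      from lt[OF this] show "?f I \<in> ?T" by simp
    qed
  qed (use U in auto)
  moreover have "card {I \<in> ?M. ?f I = (r, s)}
     = (rank U a choose r) * ((rank U b - rank U a - 1) choose s) * ((card U - 1 - rank U b) choose (k - 2 - r - s))"
    if "r + s + 1 < k" for r s
  proof -
    have "?f I = (r, s) \<longleftrightarrow> rank I a = r \<and> rank I b = r + s + 1" if "I \<in> ?M" for I
      using lt[OF that] by auto
    then have "{I \<in> ?M. ?f I = (r, s)} = {I \<in> ksubsets U k. a \<in> I \<and> b \<in> I \<and> rank I a = r \<and> rank I b = r + s + 1}"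
      by blast
    then show ?thesis
      by (simp only: card_ksubsets_rank2[OF U ab that])
  qed
  ultimately show ?thesis
    by (auto simp: power2_eq_square intro!: sum.cong)
qed

text \<open>The coefficient of \<open>x^m y^j\<close> in \<open>F^3\<close>: two marked points cut
  the chain into three segments.\<close>

definition conv3 :: "nat \<Rightarrow> nat \<Rightarrow> nat" where
  "conv3 m j = (\<Sum>i\<le>m. \<Sum>l\<le>m - i. \<Sum>r\<le>j. \<Sum>s\<le>j - r.
     ((i choose r) * (l choose s) * ((m - i - l) choose (j - r - s)))\<^sup>2)"

text \<open>The factor 2 stands for the two orders of \<open>a\<close> and \<open>b\<close>. Apart
  from the marked points, \<open>n - 2\<close> points and \<open>k - 2\<close> chosen ones are
  distributed over the three segments.\<close>

lemma sum_rank_pairs2: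
  "(\<Sum>a\<in>{1..n}. \<Sum>b\<in>{1..n} - {a}. card (rank_pairs2 {1..n} k a b a b))
    = (if n \<ge> 2 \<and> k \<ge> 2 then 2 * conv3 (n - 2) (k - 2) else 0)"
proof (cases "n \<ge> 2 \<and> k \<ge> 2")
  case True
  then obtain m j where m: "n = m + 2" and j: "k = j + 2"
    by (metis le_add_diff_inverse2)
  let ?P = "\<lambda>R. {(a, b). a \<in> {1..n} \<and> b \<in> {1..n} \<and> R a b}"
  let ?c = "\<lambda>(a, b). card (rank_pairs2 {1..n} k a b a b)"
  have fin: "finite (?P R)" for R
    by (rule finite_subset[of _ "{1..n} \<times> {1..n}"]) auto
  have "(\<Sum>a\<in>{1..n}. \<Sum>b\<in>{1..n} - {a}. card (rank_pairs2 {1..n} k a b a b)) = sum ?c (?P (<) \<union> ?P (>))"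
    by (subst sum.Sigma) (auto intro!: sum.cong)
  also have "\<dots> = sum ?c (?P (<)) + sum ?c (?P (>))"
    by (intro sum.union_disjoint fin) auto
  also have "sum ?c (?P (>)) = sum ?c (?P (<))"
    by (rule sum.reindex_bij_witness[where i = prod.swap and j = prod.swap])
      (auto simp: rank_pairs2_commute)
  also have "sum ?c (?P (<)) = (\<Sum>(a, b) \<in> ?P (<). \<Sum>(r, s) | r + s + 1 < k.
     ((a - 1 choose r) * (b - 1 - (a - 1) - 1 choose s) * (n - 1 - (b - 1) choose (k - 2 - r - s)))\<^sup>2)"
    by (rule sum.cong[OF refl]) (clarify, subst card_rank_pairs2, auto simp: rank_interval simp del: One_nat_def)
  also have "\<dots> = (\<Sum>(i, l) \<in> Sigma {..m} (\<lambda>i. {..m - i}). \<Sum>(r, s) | r + s + 1 < k.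
     ((i choose r) * (l choose s) * (m - i - l choose (j - r - s)))\<^sup>2)"
  \<comment> \<open>\<open>i\<close> points lie below \<open>a\<close> and \<open>l\<close> points
    strictly between \<open>a\<close> and \<open>b\<close>.\<close>
  proof (rule sum.reindex_bij_witness[where i = "\<lambda>(i, l). (i + 1, i + l + 2)" and j = "\<lambda>(a, b). (a - 1, b - a - 1)"], goal_cases)
    case (5 z)
    obtain a b where z: "z = (a, b)" "1 \<le> a" "a < b" "b \<le> m + 2"
      using 5 m by auto
    then have "b - 1 - (a - 1) - 1 = b - a - 1" "n - 1 - (b - 1) = m - (a - 1) - (b - a - 1)" "k - 2 = j"
      using m j by auto
    then show ?case unfolding z by simp
  qed (auto simp: m)
  also have "\<dots> = (\<Sum>i\<le>m. \<Sum>l\<le>m - i. \<Sum>(r, s) | r + s + 1 < k.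
     ((i choose r) * (l choose s) * (m - i - l choose (j - r - s)))\<^sup>2)"
    by (simp add: sum.Sigma)
  also have "{(r, s). r + s + 1 < k} = Sigma {..j} (\<lambda>r. {..j - r})"
    using j by auto
  also have "(\<Sum>i\<le>m. \<Sum>l\<le>m - i. \<Sum>(r, s)\<in>Sigma {..j} (\<lambda>r. {..j - r}).
     ((i choose r) * (l choose s) * (m - i - l choose (j - r - s)))\<^sup>2) = conv3 m j"
    by (simp add: sum.Sigma conv3_def)
  finally show ?thesis
    using m j by simp
next
  case False
  have "rank_pairs2 {1..n} k a b a b = {}" if "a \<in> {1..n}" "b \<in> {1..n} - {a}" for a b
  proof -
    have "False" if IJ: "(I, J) \<in> rank_pairs2 {1..n} k a b a b" for I J
    proof -
      have I: "{a, b} \<subseteq> I" "I \<subseteq> {1..n}" "card I = k"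
        using IJ by (auto simp: rank_pairs2_def ksubsets_def)
      then have "card {a, b} \<le> card I" "card I \<le> card {1..n}"
        by (intro card_mono; auto intro: finite_subset)+
      then show False
        using False that I \<open>b \<in> {1..n} - {a}\<close> by simp
    qed
    then show ?thesis by auto
  qed
  then have "(\<Sum>a\<in>{1..n}. \<Sum>b\<in>{1..n} - {a}. card (rank_pairs2 {1..n} k a b a b)) = 0"
    by simp
  then show ?thesis using False by (simp only: if_False)
qed

section \<open>Sums of \<open>N_id\<close> over permutations with prescribed values\<close>

lemma sum_N_id: "(\<Sum>p | p permutes {1..n}. N_id k n p) = (n choose k)\<^sup>2 * fact (n - k)"
proof -
  have "(\<Sum>p | p permutes {1..n}. N_id k n p) = (\<Sum>p | p permutes {1..n} \<and> True. N_id k n p)"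
    by simp
  also have "\<dots> = (\<Sum>(I, J) \<in> ksubsets {1..n} k \<times> ksubsets {1..n} k. fact (n - k))"
    unfolding sum_N_id_conditional ksubsets_def
  proof (intro sum.cong refl, goal_cases)
    case (1 z)
    obtain I J where z: "z = (I, J)" and IJ: "I \<subseteq> {1..n}" "card I = k" "J \<subseteq> {1..n}" "card J = k"
      using 1 by blast
    show ?case
      unfolding z prod.case using card_permutes_strict_mono[of I n k J "{}" id] IJ by simp
  qed
  also have "\<dots> = card (ksubsets {1..n} k \<times> ksubsets {1..n} k) * fact (n - k)"
    by simp
  finally show ?thesis
    by (simp add: card_cartesian_product card_ksubsets power2_eq_square)
qed

lemma sum_if_const: "finite A \<Longrightarrow> (\<Sum>x\<in>A. if P x then c else 0) = card {x \<in> A. P x} * (c :: nat)"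
  by (simp add: sum.inter_filter[symmetric])

text \<open>The point \<open>a\<close> lies either outside both \<open>I\<close> and
  \<open>J\<close>, leaving \<open>n - k - 1\<close> free points, or inside both at equal rank,
  leaving \<open>n - k\<close>.\<close>

lemma sum_N_id_fix1:
  assumes a: "a \<in> {1..n}"
  shows "(\<Sum>p | p permutes {1..n} \<and> p a = a. N_id k n p)
    = ((n - 1) choose k)\<^sup>2 * fact (n - k - 1) + card (rank_pairs {1..n} {1..n} k a a) * fact (n - k)"
proof -
  let ?K = "ksubsets {1..n} k"
  have "(\<Sum>p | p permutes {1..n} \<and> p a = a. N_id k n p) = (\<Sum>(I, J) \<in> ?K \<times> ?K.
      (if a \<notin> I \<and> a \<notin> J then fact (n - k - 1) else 0)
      + (if a \<in> I \<and> a \<in> J \<and> rank I a = rank J a then fact (n - k) else 0))"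
    unfolding sum_N_id_conditional ksubsets_def
  proof (intro sum.cong refl, goal_cases)
    case (1 z)
    obtain I J where z: "z = (I, J)" and IJ: "I \<subseteq> {1..n}" "card I = k" "J \<subseteq> {1..n}" "card J = k"
      using 1 by blast
    show ?case
      unfolding z prod.case using card_permutes_strict_mono[of I n k J "{a}" id] IJ a by (cases "a \<in> I") (auto simp: insert_Diff_if)
  qed
  also have "\<dots> = card {z \<in> ?K \<times> ?K. a \<notin> fst z \<and> a \<notin> snd z} * fact (n - k - 1)
      + card {z \<in> ?K \<times> ?K. a \<in> fst z \<and> a \<in> snd z \<and> rank (fst z) a = rank (snd z) a} * fact (n - k)"
    unfolding case_prod_unfold sum.distrib by (simp only: sum_if_const finite_cartesian_product finite_ksubsets finite_atLeastAtMost)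
  also have "{z \<in> ?K \<times> ?K. a \<notin> fst z \<and> a \<notin> snd z} = ksubsets ({1..n} - {a}) k \<times> ksubsets ({1..n} - {a}) k"
    by (auto simp: ksubsets_def)
  also have "{z \<in> ?K \<times> ?K. a \<in> fst z \<and> a \<in> snd z \<and> rank (fst z) a = rank (snd z) a} = rank_pairs {1..n} {1..n} k a a"
    by (auto simp: rank_pairs_def)
  finally show ?thesis
    using a by (simp add: card_cartesian_product card_ksubsets power2_eq_square)
qed

text \<open>There are four cases, by which of \<open>a\<close>, \<open>b\<close> lie in
  \<open>I\<close>; each of them outside \<open>I\<close> costs one free point. General targets
  \<open>c\<close>, \<open>d\<close> serve fixed pairs and two-cycles alike.\<close>

lemma sum_N_id_fix2:
  assumes ab: "a \<in> {1..n}" "b \<in> {1..n}" "a \<noteq> b" and cd: "c \<in> {1..n}" "d \<in> {1..n}" "c \<noteq> d"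
  shows "(\<Sum>p | p permutes {1..n} \<and> p a = c \<and> p b = d. N_id k n p)
    = ((n - 2) choose k)\<^sup>2 * fact (n - k - 2)
      + card (rank_pairs ({1..n} - {b}) ({1..n} - {d}) k a c) * fact (n - k - 1)
      + card (rank_pairs ({1..n} - {a}) ({1..n} - {c}) k b d) * fact (n - k - 1)
      + card (rank_pairs2 {1..n} k a b c d) * fact (n - k)"
proof -
  let ?K = "ksubsets {1..n} k"
  have "(\<Sum>p | p permutes {1..n} \<and> p a = c \<and> p b = d. N_id k n p) = (\<Sum>(I, J) \<in> ?K \<times> ?K.
      (if a \<notin> I \<and> b \<notin> I \<and> c \<notin> J \<and> d \<notin> J then fact (n - k - 2) else 0)
      + (if a \<in> I \<and> b \<notin> I \<and> c \<in> J \<and> d \<notin> J \<and> rank I a = rank J c then fact (n - k - 1) else 0)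
      + (if a \<notin> I \<and> b \<in> I \<and> c \<notin> J \<and> d \<in> J \<and> rank I b = rank J d then fact (n - k - 1) else 0)
      + (if a \<in> I \<and> b \<in> I \<and> c \<in> J \<and> d \<in> J \<and> rank I a = rank J c \<and> rank I b = rank J d then fact (n - k) else 0))"
    unfolding sum_N_id_conditional ksubsets_def
  proof (intro sum.cong refl, goal_cases)
    case (1 z)
    obtain I J where z: "z = (I, J)" and IJ: "I \<subseteq> {1..n}" "card I = k" "J \<subseteq> {1..n}" "card J = k"
      using 1 by blast
    define h where "h x = (if x = a then c else d)" for x
    have h: "h a = c" "h b = d"
      using ab by (auto simp: h_def)
    have "inj_on h {a, b}"
      using ab cd by (auto simp: inj_on_def h_def)
    moreover have "{a, b} - I = (if a \<in> I then {} else {a}) \<union> (if b \<in> I then {} else {b})"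
      by auto
    ultimately show ?case
      unfolding z prod.case using card_permutes_strict_mono[of I n k J "{a, b}" h] IJ ab cd
      by (cases "a \<in> I"; cases "b \<in> I") (auto simp: h numeral_2_eq_2)
  qed
  also have "\<dots> = card {z \<in> ?K \<times> ?K. a \<notin> fst z \<and> b \<notin> fst z \<and> c \<notin> snd z \<and> d \<notin> snd z} * fact (n - k - 2)
      + card {z \<in> ?K \<times> ?K. a \<in> fst z \<and> b \<notin> fst z \<and> c \<in> snd z \<and> d \<notin> snd z \<and> rank (fst z) a = rank (snd z) c} * fact (n - k - 1)
      + card {z \<in> ?K \<times> ?K. a \<notin> fst z \<and> b \<in> fst z \<and> c \<notin> snd z \<and> d \<in> snd z \<and> rank (fst z) b = rank (snd z) d} * fact (n - k - 1)
      + card {z \<in> ?K \<times> ?K. a \<in> fst z \<and> b \<in> fst z \<and> c \<in> snd z \<and> d \<in> snd z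
          \<and> rank (fst z) a = rank (snd z) c \<and> rank (fst z) b = rank (snd z) d} * fact (n - k)"
    unfolding case_prod_unfold sum.distrib by (simp only: sum_if_const finite_cartesian_product finite_ksubsets finite_atLeastAtMost)
  also have "{z \<in> ?K \<times> ?K. a \<notin> fst z \<and> b \<notin> fst z \<and> c \<notin> snd z \<and> d \<notin> snd z}
      = ksubsets ({1..n} - {a, b}) k \<times> ksubsets ({1..n} - {c, d}) k"
    by (auto simp: ksubsets_def)
  also have "{z \<in> ?K \<times> ?K. a \<in> fst z \<and> b \<notin> fst z \<and> c \<in> snd z \<and> d \<notin> snd z \<and> rank (fst z) a = rank (snd z) c}
      = rank_pairs ({1..n} - {b}) ({1..n} - {d}) k a c"
    by (auto simp: rank_pairs_def ksubsets_def)
  also have "{z \<in> ?K \<times> ?K. a \<notin> fst z \<and> b \<in> fst z \<and> c \<notin> snd z \<and> d \<in> snd z \<and> rank (fst z) b = rank (snd z) d}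
      = rank_pairs ({1..n} - {a}) ({1..n} - {c}) k b d"
    by (auto simp: rank_pairs_def ksubsets_def)
  also have "{z \<in> ?K \<times> ?K. a \<in> fst z \<and> b \<in> fst z \<and> c \<in> snd z \<and> d \<in> snd z
          \<and> rank (fst z) a = rank (snd z) c \<and> rank (fst z) b = rank (snd z) d} = rank_pairs2 {1..n} k a b c d"
    by (auto simp: rank_pairs2_def)
  finally show ?thesis
    using ab cd by (simp add: card_cartesian_product card_ksubsets card_Diff_subset power2_eq_square numeral_2_eq_2)
qed

lemma sum_fixed_points_N_id:
  "(\<Sum>a\<in>{1..n}. \<Sum>p | p permutes {1..n} \<and> p a = a. N_id k n p)
    = n * ((n - 1) choose k)\<^sup>2 * fact (n - k - 1) + conv2 n k * fact (n - k)"
  using sum_rank_pairs_diag[of "{1..n}" k]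
  by (simp add: sum_N_id_fix1 sum.distrib sum_distrib_right[symmetric] del: One_nat_def)

lemma sum_off_diagonal_swap:
  fixes f :: "'a \<Rightarrow> 'a \<Rightarrow> 'b :: comm_monoid_add"
  assumes "finite A"
  shows "(\<Sum>a\<in>A. \<Sum>b\<in>A - {a}. f a b) = (\<Sum>a\<in>A. \<Sum>b\<in>A - {a}. f b a)"
proof -
  have "(\<Sum>a\<in>A. \<Sum>b\<in>A - {a}. f a b) = (\<Sum>b\<in>A. \<Sum>a\<in>{a \<in> A. b \<in> A - {a}}. f a b)"
    using sum.swap_restrict[OF assms assms, of f "\<lambda>a b. b \<noteq> a"]
    by (simp add: set_diff_eq conj_commute)
  also have "\<dots> = (\<Sum>a\<in>A. \<Sum>b\<in>A - {a}. f b a)"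
    by (intro sum.cong) auto
  finally show ?thesis .
qed

lemma sum_fixed_pairs_N_id:
  "(\<Sum>a\<in>{1..n}. \<Sum>b\<in>{1..n} - {a}. \<Sum>p | p permutes {1..n} \<and> p a = a \<and> p b = b. N_id k n p)
    = n * (n - 1) * ((n - 2) choose k)\<^sup>2 * fact (n - k - 2) + 2 * n * conv2 (n - 1) k * fact (n - k - 1)
      + (if n \<ge> 2 \<and> k \<ge> 2 then 2 * conv3 (n - 2) (k - 2) else 0) * fact (n - k)"
proof -
  let ?R = "\<lambda>a b. card (rank_pairs ({1..n} - {a}) ({1..n} - {a}) k b b)"
  have R: "(\<Sum>a\<in>{1..n}. \<Sum>b\<in>{1..n} - {a}. ?R a b) = n * conv2 (n - 1) k"
    by (simp add: sum_rank_pairs_diag)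
  have R': "(\<Sum>a\<in>{1..n}. \<Sum>b\<in>{1..n} - {a}. ?R b a) = n * conv2 (n - 1) k"
    using R sum_off_diagonal_swap[of "{1..n}" ?R] by (simp only: finite_atLeastAtMost)
  have "(\<Sum>a\<in>{1..n}. \<Sum>b\<in>{1..n} - {a}. \<Sum>p | p permutes {1..n} \<and> p a = a \<and> p b = b. N_id k n p)
     = (\<Sum>a\<in>{1..n}. \<Sum>b\<in>{1..n} - {a}. ((n - 2) choose k)\<^sup>2 * fact (n - k - 2)
       + ?R b a * fact (n - k - 1) + ?R a b * fact (n - k - 1) + card (rank_pairs2 {1..n} k a b a b) * fact (n - k))"
    by (intro sum.cong refl sum_N_id_fix2) auto
  also have "\<dots> = n * (n - 1) * ((n - 2) choose k)\<^sup>2 * fact (n - k - 2) + n * conv2 (n - 1) k * fact (n - k - 1)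
      + n * conv2 (n - 1) k * fact (n - k - 1)
      + (if n \<ge> 2 \<and> k \<ge> 2 then 2 * conv3 (n - 2) (k - 2) else 0) * fact (n - k)"
    unfolding sum.distrib sum_distrib_right[symmetric] R R' sum_rank_pairs2 by simp
  finally show ?thesis by simp
qed

text \<open>The case of both points in \<open>I\<close> is empty, so no threefold convolution
  appears; the two cases with one point in \<open>I\<close> are mirror images of each other.\<close>

lemma sum_two_cycles_N_id:
  "(\<Sum>a\<in>{1..n}. \<Sum>b\<in>{1..n} - {a}. \<Sum>p | p permutes {1..n} \<and> p a = b \<and> p b = a. N_id k n p)
    = n * (n - 1) * ((n - 2) choose k)\<^sup>2 * fact (n - k - 2)
      + 2 * (k * ((n - 1) choose k)\<^sup>2 + conv2 (n - 1) k) * fact (n - k - 1)"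
proof -
  let ?R = "\<lambda>a b. card (rank_pairs ({1..n} - {b}) ({1..n} - {a}) k a b)"
  have R: "(\<Sum>a\<in>{1..n}. \<Sum>b\<in>{1..n} - {a}. ?R b a) = k * ((n - 1) choose k)\<^sup>2 + conv2 (n - 1) k"
    using sum_rank_pairs_swap[of n k] sum_off_diagonal_swap[of "{1..n}" ?R] by (simp only: finite_atLeastAtMost)
  have "(\<Sum>a\<in>{1..n}. \<Sum>b\<in>{1..n} - {a}. \<Sum>p | p permutes {1..n} \<and> p a = b \<and> p b = a. N_id k n p)
     = (\<Sum>a\<in>{1..n}. \<Sum>b\<in>{1..n} - {a}. ((n - 2) choose k)\<^sup>2 * fact (n - k - 2)
       + ?R a b * fact (n - k - 1) + ?R b a * fact (n - k - 1) + card (rank_pairs2 {1..n} k a b b a) * fact (n - k))"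
    by (intro sum.cong refl sum_N_id_fix2) auto
  also have "\<dots> = (\<Sum>a\<in>{1..n}. \<Sum>b\<in>{1..n} - {a}. ((n - 2) choose k)\<^sup>2 * fact (n - k - 2)
       + ?R a b * fact (n - k - 1) + ?R b a * fact (n - k - 1))"
    by (intro sum.cong refl) (subst rank_pairs2_swap, auto)
  also have "\<dots> = n * (n - 1) * ((n - 2) choose k)\<^sup>2 * fact (n - k - 2)
      + (k * ((n - 1) choose k)\<^sup>2 + conv2 (n - 1) k) * fact (n - k - 1)
      + (k * ((n - 1) choose k)\<^sup>2 + conv2 (n - 1) k) * fact (n - k - 1)"
    unfolding sum.distrib sum_distrib_right[symmetric] R sum_rank_pairs_swap by simp
  finally show ?thesis
    by (simp only: mult_2 add_mult_distrib add.assoc)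
qed

subsection \<open>Traces on Specht modules\<close>

lemma sum_fun_apply: "(\<Sum>i\<in>I. f i) x = (\<Sum>i\<in>I. f i x)"
  by (induction I rule: infinite_finite_induct) auto

text \<open>The frame condition writes the identity of \<open>V\<close> as the sum of the rank-one
  maps sending \<open>v\<close> to \<open>v (T i)\<close> times \<open>w i\<close>; hence the trace
  of an endomorphism \<open>f\<close> is the sum of the values of \<open>f (w i)\<close> at
  \<open>T i\<close>. This yields traces without exhibiting a basis of \<open>V\<close>, and the
  \<open>w i\<close> may be linearly dependent.\<close>

lemma trace_on_comp:
  fixes V :: "('a \<Rightarrow> complex) set" and g :: "'a \<Rightarrow> 'a"
  assumes I: "finite I" and w: "\<And>i. i \<in> I \<Longrightarrow> w i \<in> V" and V: "cfun.subspace V"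
    and frame: "\<And>v. v \<in> V \<Longrightarrow> v = (\<lambda>x. \<Sum>i\<in>I. v (T i) * w i x)"
    and closed: "\<And>v. v \<in> V \<Longrightarrow> (\<lambda>x. v (g x)) \<in> V"
  shows "trace_on V (\<lambda>v x. v (g x)) = (\<Sum>i\<in>I. w i (g (T i)))"
proof -
  have frame': "v = (\<Sum>i\<in>I. (\<lambda>x. v (T i) * w i x))" if "v \<in> V" for v
    by (subst frame[OF that]) (simp add: sum_fun_apply fun_eq_iff)
  define B where "B = (SOME B. cfun.independent B \<and> cfun.span B = V)"
  have "\<exists>B. cfun.independent B \<and> cfun.span B = V"
    by (metis V cfun.basis_exists cfun.span_subspace)
  then have B: "cfun.independent B" "cfun.span B = V"
    unfolding B_def by (metis (mono_tags, lifting) someI_ex)+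
  have "V \<subseteq> cfun.span (w ` I)"
  proof
    fix v assume "v \<in> V"
    show "v \<in> cfun.span (w ` I)"
      by (subst frame'[OF \<open>v \<in> V\<close>]) (intro cfun.span_sum cfun.span_scale cfun.span_base imageI)
  qed
  then have fin: "finite B"
    using cfun.independent_span_bound[of "w ` I" B] B I cfun.span_superset[of B] by blast
  let ?r = "cfun.representation B"
  have rep: "?r v b = (\<Sum>i\<in>I. v (T i) * ?r (w i) b)" if "v \<in> V" for v b
  proof -
    have "?r v = ?r (\<Sum>i\<in>I. (\<lambda>x. v (T i) * w i x))"
      using frame'[OF that] by simp
    also have "\<dots> = (\<lambda>b. \<Sum>i\<in>I. ?r (\<lambda>x. v (T i) * w i x) b)"
      using B w by (intro cfun.representation_sum) (auto intro: cfun.span_scale)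
    also have "\<dots> = (\<lambda>b. \<Sum>i\<in>I. v (T i) * ?r (w i) b)"
      using B w by (intro ext sum.cong refl) (simp add: cfun.representation_scale)
    finally show ?thesis by simp
  qed
  have "trace_on V (\<lambda>v x. v (g x)) = (\<Sum>b\<in>B. ?r (\<lambda>x. b (g x)) b)"
    by (simp add: trace_on_def B_def Let_def)
  also have "\<dots> = (\<Sum>b\<in>B. \<Sum>i\<in>I. b (g (T i)) * ?r (w i) b)"
    using B cfun.span_superset[of B] by (intro sum.cong refl rep closed) blast
  \<comment> \<open>With the sums exchanged, the inner one is the expansion of \<open>w i\<close> in
    the basis \<open>B\<close>, evaluated at \<open>g (T i)\<close>.\<close>
  also have "\<dots> = (\<Sum>i\<in>I. \<Sum>b\<in>B. ?r (w i) b * b (g (T i)))"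
    by (subst sum.swap) (simp add: mult.commute)
  also have "\<dots> = (\<Sum>i\<in>I. w i (g (T i)))"
  proof (rule sum.cong[OF refl])
    fix i assume "i \<in> I"
    have "(\<Sum>b\<in>B. (\<lambda>x. ?r (w i) b * b x)) = w i"
      using B fin w[OF \<open>i \<in> I\<close>] by (intro cfun.sum_representation_eq) auto
    then have "(\<Sum>b\<in>B. (\<lambda>x. ?r (w i) b * b x)) (g (T i)) = w i (g (T i))"
      by simp
    then show "(\<Sum>b\<in>B. ?r (w i) b * b (g (T i))) = w i (g (T i))"
      by (simp add: sum_fun_apply)
  qed
  finally show ?thesis .
qed

text \<open>The frame identity and the invariance are preserved by linear combinations, so testing
  them on generators is enough; in the applications these are the polytabloids.\<close>

lemma trace_on_span_comp:
  fixes G :: "('a \<Rightarrow> complex) set" and g :: "'a \<Rightarrow> 'a"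
  assumes I: "finite I" and w: "\<And>i. i \<in> I \<Longrightarrow> w i \<in> cfun.span G"
    and frame: "\<And>v x. v \<in> G \<Longrightarrow> (\<Sum>i\<in>I. v (T i) * w i x) = v x"
    and closed: "\<And>v. v \<in> G \<Longrightarrow> (\<lambda>x. v (g x)) \<in> G"
  shows "trace_on (cfun.span G) (\<lambda>v x. v (g x)) = (\<Sum>i\<in>I. w i (g (T i)))"
proof -
  define F where "F = {v. \<forall>x. (\<Sum>i\<in>I. v (T i) * w i x) = v x}"
  define H where "H = {v. (\<lambda>x. v (g x)) \<in> cfun.span G}"
  have "cfun.subspace F"
    by (simp add: cfun.subspace_def F_def distrib_right sum.distrib mult.assoc sum_distrib_left[symmetric])
  then have "cfun.span G \<subseteq> F"
    using frame by (intro cfun.span_minimal) (auto simp: F_def)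
  moreover have "cfun.subspace H"
    unfolding cfun.subspace_def
  proof (intro conjI ballI allI)
    show "0 \<in> H"
      using cfun.span_zero[of G] by (simp add: H_def zero_fun_def)
    show "u + v \<in> H" if "u \<in> H" "v \<in> H" for u v
      using that cfun.span_add[of "\<lambda>x. u (g x)" G "\<lambda>x. v (g x)"] by (simp add: H_def plus_fun_def)
    show "(\<lambda>x. c * u x) \<in> H" if "u \<in> H" for c u
      using that cfun.span_scale[of "\<lambda>x. u (g x)" G c] by (simp add: H_def)
  qed
  then have "cfun.span G \<subseteq> H"
    using closed cfun.span_base by (intro cfun.span_minimal) (auto simp: H_def)
  ultimately show ?thesis
    by (intro trace_on_comp I w cfun.subspace_span) (auto simp: F_def H_def fun_eq_iff)
qed

lemma sum_permutes_doubleton: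
  assumes "a \<noteq> b"
  shows "(\<Sum>q | q permutes {a, b}. f q) = f id + f (Transposition.transpose a b)"
proof -
  have "{q. q permutes {a, b}} = {id, Transposition.transpose a b}"
    by (auto simp: permutes_doubleton_iff)
  moreover have "id \<noteq> Transposition.transpose a b"
    using assms by (metis transpose_eq_id_iff)
  ultimately show ?thesis by simp
qed

lemma sum_permutes_tripleton:
  assumes "a \<noteq> b" "a \<noteq> c" "b \<noteq> c"
  shows "(\<Sum>q | q permutes {a, b, c}. f q)
    = f id + f (Transposition.transpose b c)
      + f (Transposition.transpose a b) + f (Transposition.transpose a b \<circ> Transposition.transpose b c)
      + f (Transposition.transpose a c) + f (Transposition.transpose a c \<circ> Transposition.transpose b c)"
proof -
  have "(\<Sum>q | q permutes {a, b, c}. f q)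
     = (\<Sum>x\<in>{a, b, c}. \<Sum>q | q permutes {b, c}. f (Transposition.transpose a x \<circ> q))"
    using assms by (intro sum_over_permutations_insert) auto
  then show ?thesis
    using assms by (simp add: sum_permutes_doubleton add.assoc)
qed

section \<open>Tabloids, column stabilizers and the four characters\<close>

definition unit_vec :: "'a \<Rightarrow> 'a \<Rightarrow> complex" where
  "unit_vec T = (\<lambda>T'. of_bool (T' = T))"

lemma polytabloid_unit_vec:
  "polytabloid \<mu> t = (\<lambda>T. \<Sum>p\<in>column_stabilizer \<mu> t. of_int (sign p) * unit_vec (tabloid_act p (tabloid \<mu> t)) T)"
  unfolding polytabloid_def unit_vec_def by (intro ext sum.cong refl) simp

lemma unit_vec_tabloid_act:
  assumes "p permutes S"
  shows "unit_vec T (tabloid_act (inv p) T') = unit_vec (tabloid_act p T) T'"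
proof -
  have 1: "tabloid_act p (tabloid_act (inv p) T) = T" "tabloid_act (inv p) (tabloid_act p T) = T" for T
    using permutes_inverses[OF assms] by (simp_all add: tabloid_act_def image_comp o_def map_idI)
  have "tabloid_act (inv p) T' = T \<longleftrightarrow> T' = tabloid_act p T"
    using 1(1)[of T'] 1(2)[of T] by auto
  then show ?thesis
    by (simp add: unit_vec_def)
qed

lemma cells_Cons:
  "cells (m # \<nu>) = {0} \<times> {..<m} \<union> (\<lambda>(i, j). (Suc i, j)) ` cells \<nu>"
  unfolding cells_def by (auto simp: image_iff less_Suc_eq_0_disj)

lemma cells_Nil: "cells [] = {}"
  by (simp add: cells_def)

lemma finite_cells [simp]: "finite (cells \<mu>)" and card_cells: "card (cells \<mu>) = sum_list \<mu>"
proof -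
  have "finite (cells \<mu>) \<and> card (cells \<mu>) = sum_list \<mu>"
  proof (induction \<mu>)
    case (Cons m \<nu>)
    have "card ({0::nat} \<times> {..<m} \<union> (\<lambda>(i, j). (Suc i, j)) ` cells \<nu>) = m + card (cells \<nu>)"
    proof -
      have "inj (\<lambda>(i::nat, j::nat). (Suc i, j))"
        by (auto simp: inj_def)
      then have "card ((\<lambda>(i, j). (Suc i, j)) ` cells \<nu>) = card (cells \<nu>)"
        by (intro card_image) (rule inj_on_subset, auto)
      then show ?thesis
        using Cons by (subst card_Un_disjoint) auto
    qed
    then show ?case using Cons by (simp add: cells_Cons)
  qed (simp add: cells_Nil)
  then show "finite (cells \<mu>)" "card (cells \<mu>) = sum_list \<mu>" by auto
qed

lemma ex_tableau:
  assumes "C \<subseteq> cells \<mu>" "inj_on g C" "g ` C \<subseteq> {1..sum_list \<mu>}"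
  obtains t where "tableau \<mu> t" "\<And>c. c \<in> C \<Longrightarrow> t c = g c"
proof -
  have "card (cells \<mu>) = card {1..sum_list \<mu>}"
    by (simp add: card_cells)
  from ex_bij_betw_extending[OF finite_cells _ this assms]
  obtain t where "bij_betw t (cells \<mu>) {1..sum_list \<mu>}" "\<forall>c\<in>C. t c = g c"
    by auto
  then show thesis
    using that[of t] by (simp add: tableau_def)
qed

text \<open>Every column but the first has at most one cell, in row 0, and a permutation preserving
  a singleton fixes its element.\<close>

lemma column_stabilizer_one_column:
  assumes t: "tableau \<mu> t" and \<mu>: "\<And>c. c \<in> cells \<mu> \<Longrightarrow> snd c \<noteq> 0 \<Longrightarrow> fst c = 0"
  shows "column_stabilizer \<mu> t = {p. p permutes t ` {c \<in> cells \<mu>. snd c = 0}}"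
proof -
  let ?C = "\<lambda>j. t ` {c \<in> cells \<mu>. snd c = j}"
  have t': "t ` cells \<mu> = {1..sum_list \<mu>}" "inj_on t (cells \<mu>)"
    using t by (auto simp: tableau_def bij_betw_def)
  have C: "?C 0 \<subseteq> {1..sum_list \<mu>}"
    using t' by auto
  have "p permutes ?C 0" if "p permutes {1..sum_list \<mu>}" "\<And>j. p ` ?C j = ?C j" for p
  proof (rule permutes_superset[OF that(1)])
    fix x assume "x \<in> {1..sum_list \<mu>} - ?C 0"
    then have x: "x \<in> t ` cells \<mu>" "x \<notin> ?C 0"
      using t'(1) by simp_all
    from x(1) obtain c where c: "c \<in> cells \<mu>" "x = t c"
      by (auto elim: imageE)
    have "snd c \<noteq> 0"
    proof
      assume "snd c = 0"
      then have "t c \<in> ?C 0"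
        using c(1) by (intro imageI) simp
      with x(2) c(2) show False by simp
    qed
    then have "c' = c" if "c' \<in> cells \<mu>" "snd c' = snd c" for c'
      using \<mu>[of c] \<mu>[of c'] c that by (intro prod_eqI) simp_all
    then have "{c' \<in> cells \<mu>. snd c' = snd c} = {c}"
      using c by blast
    with that(2)[of "snd c"] have "p ` t ` {c} = t ` {c}"
      by (simp only:)
    then show "p x = x"
      using c by simp
  qed
  moreover have "p ` ?C j = ?C j" if p: "p permutes ?C 0" for p j
  proof (cases "j = 0")
    case False
    have "p (t c) = t c" if "c \<in> cells \<mu>" "snd c = j" for c
    proof (rule permutes_not_in[OF p])
      show "t c \<notin> ?C 0"
        using that False t'(2) by (auto simp: inj_on_def)
    qed
    then show ?thesis by force
  qed (use p in \<open>simp add: permutes_image\<close>)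
  ultimately have "p permutes {1..sum_list \<mu>} \<and> (\<forall>j. p ` ?C j = ?C j) \<longleftrightarrow> p permutes ?C 0" for p
    using permutes_subset[OF _ C, of p] by blast
  then show ?thesis
    unfolding column_stabilizer_def by (simp only:)
qed

lemma tabloid_first_row:
  assumes "tableau \<mu> t"
  shows "t ` {c \<in> cells \<mu>. fst c = 0} = {1..sum_list \<mu>} - t ` {c \<in> cells \<mu>. fst c \<noteq> 0}"
proof -
  have t: "inj_on t (cells \<mu>)" "t ` cells \<mu> = {1..sum_list \<mu>}"
    using assms by (auto simp: tableau_def bij_betw_def)
  have "{c \<in> cells \<mu>. fst c = 0} = cells \<mu> - {c \<in> cells \<mu>. fst c \<noteq> 0}"
    by auto
  then show ?thesis
    using t(2) by (simp only:) (subst inj_on_image_set_diff[OF t(1)], auto)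
qed

lemma perm_act_eq: "perm_act p = (\<lambda>v T. v (tabloid_act (inv p) T))"
  by (simp add: perm_act_def fun_eq_iff)

lemma irr_char_trivial:
  assumes p: "p permutes {1..n}"
  shows "irr_char (pad [] n) p = 1"
proof -
  let ?T = "[{1..n}]"
  have pad: "pad [] n = [n]" by (simp add: pad_def)
  have cells: "cells [n] = {0} \<times> {..<n}" by (simp add: cells_Cons cells_Nil)
  have poly: "polytabloid [n] t = unit_vec ?T" if t: "tableau [n] t" for t
  proof -
    \<comment> \<open>An inclusion rather than an equality, because the column is empty for
      \<open>n = 0\<close>.\<close>
    have "t ` {c \<in> cells [n]. snd c = 0} \<subseteq> {t (0, 0)}"
      by (auto simp: cells)
    moreover have "column_stabilizer [n] t = {p. p permutes t ` {c \<in> cells [n]. snd c = 0}}"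
      using t by (rule column_stabilizer_one_column) (auto simp: cells)
    ultimately have "column_stabilizer [n] t \<subseteq> {p. p permutes {t (0, 0)}}"
      using permutes_subset by blast
    then have "column_stabilizer [n] t = {id}"
      by (auto simp: column_stabilizer_def permutes_sing permutes_id)
    moreover have "t ` {c \<in> cells [n]. fst c = 0} = {1..n}"
      using tabloid_first_row[OF t] by (auto simp: cells)
    then have "tabloid [n] t = ?T"
      by (simp add: tabloid_def)
    ultimately show ?thesis
      by (simp add: polytabloid_unit_vec tabloid_act_def)
  qed
  obtain t where "tableau [n] t"
    by (rule ex_tableau[of "{}" "[n]" "\<lambda>_. 0"]) auto
  then have "{polytabloid [n] t | t. tableau [n] t} = {unit_vec ?T}"
    using poly by (intro equalityI subsetI) (blast, metis (mono_tags, lifting) mem_Collect_eq singletonD)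
  then have "specht [n] = cfun.span {unit_vec ?T}"
    by (simp only: specht_def)
  moreover have "trace_on (cfun.span {unit_vec ?T}) (\<lambda>v T. v (tabloid_act (inv p) T))
      = (\<Sum>i\<in>{()}. unit_vec ?T (tabloid_act (inv p) ?T))"
  proof (rule trace_on_span_comp)
    fix v assume "v \<in> {unit_vec ?T}"
    then show "(\<lambda>T. v (tabloid_act (inv p) T)) \<in> {unit_vec ?T}"
      using permutes_image[OF p] by (simp add: unit_vec_tabloid_act[OF p]) (simp add: tabloid_act_def)
  qed (auto simp: unit_vec_def intro: cfun.span_base)
  moreover have "unit_vec ?T (tabloid_act (inv p) ?T) = 1"
    unfolding unit_vec_tabloid_act[OF p] using permutes_image[OF p] by (simp add: tabloid_act_def unit_vec_def)
  ultimately show ?thesis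
    by (simp add: irr_char_def pad perm_act_eq)
qed

definition fixed_points :: "nat \<Rightarrow> (nat \<Rightarrow> nat) \<Rightarrow> complex" where
  "fixed_points n p = (\<Sum>a\<in>{1..n}. of_bool (p a = a))"

definition fixed_pairs :: "nat \<Rightarrow> (nat \<Rightarrow> nat) \<Rightarrow> complex" where
  "fixed_pairs n p = (\<Sum>a\<in>{1..n}. \<Sum>b\<in>{1..n} - {a}. of_bool (p a = a \<and> p b = b))"

text \<open>The pairs are ordered, so each two-cycle counts twice.\<close>

definition swapped_pairs :: "nat \<Rightarrow> (nat \<Rightarrow> nat) \<Rightarrow> complex" where
  "swapped_pairs n p = (\<Sum>a\<in>{1..n}. \<Sum>b\<in>{1..n} - {a}. of_bool (p a = b \<and> p b = a))"

locale permuted_tabloids =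
  fixes n :: nat and p :: "nat \<Rightarrow> nat"
  assumes p: "p permutes {1..n}"
begin

lemma image_p: "p ` ({1..n} - A) = {1..n} - p ` A"
  using permutes_inj[OF p] permutes_image[OF p] by (simp only: image_set_diff)

lemma p_in: "a \<in> {1..n} \<Longrightarrow> p a \<in> {1..n}"
  using p by (simp only: permutes_in_image)

lemma p_eq: "p a = p b \<longleftrightarrow> a = b"
  using permutes_inj[OF p] by (simp only: inj_eq)

lemma sum_p: "(\<Sum>b\<in>{1..n}. f (p b)) = (\<Sum>b\<in>{1..n}. f b :: 'a :: comm_monoid_add)"
  using sum.permute[OF p, of f] by (simp add: o_def)

end

text \<open>A tabloid of this shape is determined by the entry of its second row, and the
  polytabloids are the differences of basis vectors. They span the vectors of coordinate sum zero,
  so the trace is that of the permutation module less 1 for the invariant line.\<close>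

lemma irr_char_standard:
  assumes p: "p permutes {1..n}" and n: "n \<ge> 2"
  shows "irr_char (pad [1] n) p = fixed_points n p - 1"
proof -
  interpret permuted_tabloids n p by unfold_locales (rule p)
  define \<mu> where "\<mu> = [n - 1, 1]"
  define T where "T a = [{1..n} - {a}, {a}]" for a :: nat
  define E where "E a = unit_vec (T a)" for a
  have pad: "pad [1] n = \<mu>" by (simp add: pad_def \<mu>_def)
  have size: "sum_list \<mu> = n" using n by (simp add: \<mu>_def)
  have cells: "cells \<mu> = {0} \<times> {..<n - 1} \<union> {(1, 0)}"
    by (auto simp: \<mu>_def cells_Cons cells_Nil)
  have in_cells: "{(0, 0), (1, 0)} \<subseteq> cells \<mu>"
    using n by (auto simp: cells)
  have act: "tabloid_act q (T a) = T (q a)" if "q permutes {1..n}" for q a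
    using permuted_tabloids.image_p[OF permuted_tabloids.intro[OF that]] by (simp add: T_def tabloid_act_def)
  have E_act: "E a (tabloid_act (inv p) T') = E (p a) T'" for a T'
    using unit_vec_tabloid_act[OF p, of "T a" T'] act[OF p, of a] by (simp add: E_def)
  let ?G = "{\<lambda>T. E b T - E a T | a b. a \<in> {1..n} \<and> b \<in> {1..n} \<and> a \<noteq> b}"
  have poly: "polytabloid \<mu> t = (\<lambda>T. E (t (1, 0)) T - E (t (0, 0)) T)"
    and in01: "t (0, 0) \<in> {1..n} \<and> t (1, 0) \<in> {1..n} \<and> t (0, 0) \<noteq> t (1, 0)" if t: "tableau \<mu> t" for t
  proof -
    have bij: "t ` cells \<mu> = {1..n}" "inj_on t (cells \<mu>)"
      using t size by (simp_all add: tableau_def bij_betw_def)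
    show in01: "t (0, 0) \<in> {1..n} \<and> t (1, 0) \<in> {1..n} \<and> t (0, 0) \<noteq> t (1, 0)"
      using in_cells inj_onD[OF bij(2), of "(0, 0)" "(1, 0)"] unfolding bij(1)[symmetric] by auto
    have "{c \<in> cells \<mu>. snd c = 0} = {(0, 0), (1, 0)}"
      using n by (auto simp: cells)
    then have "t ` {c \<in> cells \<mu>. snd c = 0} = {t (0, 0), t (1, 0)}"
      by (simp only: image_insert image_empty)
    moreover have "column_stabilizer \<mu> t = {p. p permutes t ` {c \<in> cells \<mu>. snd c = 0}}"
      using t by (rule column_stabilizer_one_column) (auto simp: cells)
    ultimately have col: "column_stabilizer \<mu> t = {q. q permutes {t (0, 0), t (1, 0)}}"
      by (simp only:)
    have "{c \<in> cells \<mu>. fst c \<noteq> 0} = {(1, 0)}" "{c \<in> cells \<mu>. fst c = 1} = {(1, 0)}"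
      by (auto simp: cells)
    moreover have "length \<mu> = 2"
      by (simp add: \<mu>_def)
    ultimately have tab: "tabloid \<mu> t = T (t (1, 0))"
      using tabloid_first_row[OF t] size by (simp add: tabloid_def T_def numeral_2_eq_2)
    have sub: "q permutes {1..n}" if "q permutes {t (0, 0), t (1, 0)}" for q
      by (rule permutes_subset[OF that]) (use in01 in auto)
    have "polytabloid \<mu> t = (\<lambda>T'. \<Sum>q | q permutes {t (0, 0), t (1, 0)}. of_int (sign q) * E (q (t (1, 0))) T')"
      unfolding polytabloid_unit_vec col tab E_def using sub by (intro ext sum.cong refl) (simp add: act)
    then show "polytabloid \<mu> t = (\<lambda>T. E (t (1, 0)) T - E (t (0, 0)) T)"
      using in01 by (simp add: sum_permutes_doubleton sign_swap_id)
  qed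
  have "{polytabloid \<mu> t | t. tableau \<mu> t} = ?G"
  proof (intro equalityI subsetI)
    fix v assume "v \<in> {polytabloid \<mu> t | t. tableau \<mu> t}"
    then show "v \<in> ?G" using poly in01 by blast
  next
    fix v assume "v \<in> ?G"
    then obtain a b where ab: "a \<in> {1..n}" "b \<in> {1..n}" "a \<noteq> b" and v: "v = (\<lambda>T. E b T - E a T)"
      by blast
    define g where "g c = (if fst c = 0 then a else b)" for c :: "nat \<times> nat"
    obtain t where t: "tableau \<mu> t" "\<And>c. c \<in> {(0, 0), (1, 0)} \<Longrightarrow> t c = g c"
      by (rule ex_tableau[OF in_cells, of g]) (use ab size in \<open>auto simp: g_def inj_on_def\<close>)
    have "v = polytabloid \<mu> t"
      unfolding poly[OF t(1)] v using t(2)[of "(0, 0)"] t(2)[of "(1, 0)"] by (simp add: g_def)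
    then show "v \<in> {polytabloid \<mu> t | t. tableau \<mu> t}"
      using t(1) by blast
  qed
  then have specht: "specht \<mu> = cfun.span ?G"
    by (simp only: specht_def)
  \<comment> \<open>The orthogonal projection of \<open>E a\<close> onto coordinate sum zero; it is
    \<open>1 / n\<close> times the sum of all differences \<open>E a - E b\<close>.\<close>
  define w where "w a = (\<lambda>T'. E a T' - (\<Sum>b\<in>{1..n}. E b T') / of_nat n)" for a
  have ET: "E a (T b) = of_bool (a = b)" for a b
    by (auto simp: E_def unit_vec_def T_def)
  have "trace_on (cfun.span ?G) (\<lambda>v T. v (tabloid_act (inv p) T))
      = (\<Sum>a\<in>{1..n}. w a (tabloid_act (inv p) (T a)))"
  proof (rule trace_on_span_comp)
    fix a assume a: "a \<in> {1..n}"
    have "w a = (\<lambda>x. (1 / of_nat n) * (\<Sum>b\<in>{1..n} - {a}. (\<lambda>T. E a T - E b T)) x)"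
    proof
      fix x
      have "(\<Sum>b\<in>{1..n} - {a}. E a x - E b x) = of_nat n * E a x - (\<Sum>b\<in>{1..n}. E b x)"
        using a by (simp add: sum_diff1 sum_subtractf algebra_simps)
      then show "w a x = (1 / of_nat n) * (\<Sum>b\<in>{1..n} - {a}. (\<lambda>T. E a T - E b T)) x"
        using n by (simp add: w_def sum_fun_apply field_simps)
    qed
    also have "\<dots> \<in> cfun.span ?G"
      using a by (intro cfun.span_scale cfun.span_sum cfun.span_base) blast
    finally show "w a \<in> cfun.span ?G" .
  next
    fix v x assume "v \<in> ?G"
    then obtain a b where ab: "a \<in> {1..n}" "b \<in> {1..n}" and v: "v = (\<lambda>T. E b T - E a T)"
      by blast
    have "(\<Sum>i\<in>{1..n}. v (T i) * w i x) = w b x - w a x"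
      using ab by (simp add: v ET left_diff_distrib sum_subtractf of_bool_def if_distrib[of "\<lambda>x. x * _"] cong: if_cong)
    then show "(\<Sum>i\<in>{1..n}. v (T i) * w i x) = v x"
      by (simp add: w_def v)
  next
    fix v assume "v \<in> ?G"
    then obtain a b where ab: "a \<in> {1..n}" "b \<in> {1..n}" "a \<noteq> b" and v: "v = (\<lambda>T. E b T - E a T)"
      by blast
    have "(\<lambda>T. v (tabloid_act (inv p) T)) = (\<lambda>T. E (p b) T - E (p a) T)"
      by (simp add: v E_act)
    moreover have "p a \<in> {1..n}" "p b \<in> {1..n}" "p a \<noteq> p b"
      using ab p_in p_eq by blast+
    ultimately show "(\<lambda>T. v (tabloid_act (inv p) T)) \<in> ?G"
      by blast
  qed simp
  also have "\<dots> = fixed_points n p - 1"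
  proof -
    have "(\<Sum>b\<in>{1..n}. E b (tabloid_act (inv p) (T a))) = 1" if "a \<in> {1..n}" for a
      using that sum_p[of "\<lambda>b. of_bool (b = a) :: complex"] by (simp add: E_act ET of_bool_def)
    then show ?thesis
      using n by (simp add: w_def sum_subtractf E_act ET fixed_points_def)
  qed
  finally show ?thesis
    unfolding irr_char_def pad perm_act_eq specht .
qed

lemma sum_remove_points:
  fixes f :: "'a \<Rightarrow> 'b :: ab_group_add"
  assumes "finite S" "distinct xs" "set xs \<subseteq> S"
  shows "sum f (S - set xs) = sum f S - sum_list (map f xs)"
  using assms by (simp add: sum_diff sum_list_distinct_conv_sum_set)

lemma (in permuted_tabloids) sum_off_diagonal:
  "(\<Sum>x\<in>{1..n}. \<Sum>y\<in>{1..n} - {x}. of_bool (p x = x)) = (of_nat n - 1) * fixed_points n p"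
  "(\<Sum>x\<in>{1..n}. \<Sum>y\<in>{1..n} - {x}. of_bool (p y = y)) = (of_nat n - 1) * fixed_points n p"
  "(\<Sum>x\<in>{1..n}. \<Sum>y\<in>{1..n} - {x}. of_bool (p x = y)) = of_nat n - fixed_points n p"
  "(\<Sum>x\<in>{1..n}. \<Sum>y\<in>{1..n} - {x}. of_bool (p y = x)) = of_nat n - fixed_points n p"
proof -
  show "(\<Sum>x\<in>{1..n}. \<Sum>y\<in>{1..n} - {x}. of_bool (p x = x)) = (of_nat n - 1) * fixed_points n p"
  proof (cases "n = 0")
    case False
    then show ?thesis
      by (simp add: fixed_points_def sum_distrib_left of_nat_diff)
  qed (simp add: fixed_points_def)
  have "(\<Sum>x\<in>{1..n}. \<Sum>y\<in>{1..n} - {x}. of_bool (p y = y)) = (\<Sum>x\<in>{1..n}. fixed_points n p - of_bool (p x = x))"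
    by (intro sum.cong refl) (simp add: sum_diff1 fixed_points_def del: sum_of_bool_eq)
  then show "(\<Sum>x\<in>{1..n}. \<Sum>y\<in>{1..n} - {x}. of_bool (p y = y)) = (of_nat n - 1) * fixed_points n p"
    by (simp add: sum_subtractf fixed_points_def algebra_simps)
  have "(\<Sum>y\<in>{1..n} - {x}. of_bool (p x = y)) = (1 - of_bool (p x = x) :: complex)" if "x \<in> {1..n}" for x
    using that p_in[OF that] by (simp add: sum_diff1 of_bool_def)
  then show "(\<Sum>x\<in>{1..n}. \<Sum>y\<in>{1..n} - {x}. of_bool (p x = y)) = of_nat n - fixed_points n p"
    by (simp add: sum_subtractf fixed_points_def)
  have "(\<Sum>y\<in>{1..n} - {x}. of_bool (p y = x)) = (1 - of_bool (p x = x) :: complex)" if "x \<in> {1..n}" for x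
    using that sum_p[of "\<lambda>y. of_bool (y = x) :: complex"] by (simp add: sum_diff1 of_bool_def)
  then show "(\<Sum>x\<in>{1..n}. \<Sum>y\<in>{1..n} - {x}. of_bool (p y = x)) = of_nat n - fixed_points n p"
    by (simp add: sum_subtractf fixed_points_def)
qed

text \<open>With \<open>e b c = E b c - E c b\<close>, the polytabloid is
  \<open>e b c - e a c + e a b\<close>, the boundary of the oriented triangle \<open>a b c\<close>.
  The Specht module is thus the space of boundaries on the complete graph, and the frame comes from
  averaging the triangles over a given edge.\<close>

lemma irr_char_hook:
  assumes p: "p permutes {1..n}" and n: "n \<ge> 3"
  shows "irr_char (pad [1, 1] n) p = (fixed_pairs n p - swapped_pairs n p) / 2 - fixed_points n p + 1"
proof -
  interpret permuted_tabloids n p by unfold_locales (rule p)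
  define \<mu> where "\<mu> = [n - 2, 1, 1]"
  define T where "T a b = [{1..n} - {a, b}, {a}, {b}]" for a b :: nat
  define E where "E a b = unit_vec (T a b)" for a b
  have pad: "pad [1, 1] n = \<mu>" by (simp add: pad_def \<mu>_def numeral_2_eq_2)
  have size: "sum_list \<mu> = n" using n by (simp add: \<mu>_def)
  have cells: "cells \<mu> = {0} \<times> {..<n - 2} \<union> {(1, 0), (2, 0)}"
    by (auto simp: \<mu>_def cells_Cons cells_Nil image_Un image_iff numeral_2_eq_2)
  have in_cells: "{(0, 0), (1, 0), (2, 0)} \<subseteq> cells \<mu>"
    using n by (auto simp: cells)
  have act: "tabloid_act q (T a b) = T (q a) (q b)" if "q permutes {1..n}" for q a b
    using permuted_tabloids.image_p[OF permuted_tabloids.intro[OF that]] by (simp add: T_def tabloid_act_def)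
  have E_act: "E a b (tabloid_act (inv p) T') = E (p a) (p b) T'" for a b T'
    using unit_vec_tabloid_act[OF p, of "T a b" T'] act[OF p, of a b] by (simp add: E_def)
  define g where "g a b c = (\<lambda>T. E b c T - E c b T - E a c T + E c a T - E b a T + E a b T)" for a b c
  let ?D = "\<lambda>a b c. a \<in> {1..n} \<and> b \<in> {1..n} \<and> c \<in> {1..n} \<and> a \<noteq> b \<and> a \<noteq> c \<and> b \<noteq> c"
  let ?G = "{g a b c | a b c. ?D a b c}"
  have poly: "polytabloid \<mu> t = g (t (0, 0)) (t (1, 0)) (t (2, 0))"
    and in01: "?D (t (0, 0)) (t (1, 0)) (t (2, 0))" if t: "tableau \<mu> t" for t
  proof -
    let ?a = "t (0, 0)" and ?b = "t (1, 0)" and ?c = "t (2, 0)"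
    have bij: "t ` cells \<mu> = {1..n}" "inj_on t (cells \<mu>)"
      using t size by (simp_all add: tableau_def bij_betw_def)
    show in01: "?D ?a ?b ?c"
      using in_cells inj_onD[OF bij(2), of "(0, 0)" "(1, 0)"] inj_onD[OF bij(2), of "(0, 0)" "(2, 0)"]
        inj_onD[OF bij(2), of "(1, 0)" "(2, 0)"] unfolding bij(1)[symmetric] by auto
    have "{c \<in> cells \<mu>. snd c = 0} = {(0, 0), (1, 0), (2, 0)}"
      using n by (auto simp: cells)
    then have "t ` {c \<in> cells \<mu>. snd c = 0} = {?a, ?b, ?c}"
      by (simp only: image_insert image_empty)
    moreover have "column_stabilizer \<mu> t = {p. p permutes t ` {c \<in> cells \<mu>. snd c = 0}}"
      using t by (rule column_stabilizer_one_column) (auto simp: cells)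
    ultimately have col: "column_stabilizer \<mu> t = {q. q permutes {?a, ?b, ?c}}"
      by (simp only:)
    have "{c \<in> cells \<mu>. fst c \<noteq> 0} = {(1, 0), (2, 0)}" "{c \<in> cells \<mu>. fst c = 1} = {(1, 0)}"
      "{c \<in> cells \<mu>. fst c = 2} = {(2, 0)}"
      by (auto simp: cells)
    moreover have "length \<mu> = 3"
      by (simp add: \<mu>_def)
    moreover have "[0..<3] = [0, 1, 2]"
      by (simp add: numeral_3_eq_3)
    ultimately have tab: "tabloid \<mu> t = T ?b ?c"
      using tabloid_first_row[OF t] size by (simp add: tabloid_def T_def)
    have sub: "q permutes {1..n}" if "q permutes {?a, ?b, ?c}" for q
      by (rule permutes_subset[OF that]) (use in01 in auto)
    have "polytabloid \<mu> t = (\<lambda>T'. \<Sum>q | q permutes {?a, ?b, ?c}. of_int (sign q) * E (q ?b) (q ?c) T')"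
      unfolding polytabloid_unit_vec col tab E_def using sub by (intro ext sum.cong refl) (simp add: act)
    then show "polytabloid \<mu> t = g ?a ?b ?c"
      using in01 by (simp add: sum_permutes_tripleton sign_swap_id sign_compose permutation_swap_id g_def)
  qed
  have "{polytabloid \<mu> t | t. tableau \<mu> t} = ?G"
  proof (intro equalityI subsetI)
    fix v assume "v \<in> {polytabloid \<mu> t | t. tableau \<mu> t}"
    then show "v \<in> ?G" using poly in01 by blast
  next
    fix v assume "v \<in> ?G"
    then obtain a b c where abc: "?D a b c" and v: "v = g a b c"
      by blast
    define h where "h x = (if fst x = 0 then a else if fst x = 1 then b else c)" for x :: "nat \<times> nat"
    obtain t where t: "tableau \<mu> t" "\<And>x. x \<in> {(0, 0), (1, 0), (2, 0)} \<Longrightarrow> t x = h x"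
      by (rule ex_tableau[OF in_cells, of h]) (use abc size in \<open>auto simp: h_def inj_on_def\<close>)
    have "v = polytabloid \<mu> t"
      unfolding poly[OF t(1)] v using t(2)[of "(0, 0)"] t(2)[of "(1, 0)"] t(2)[of "(2, 0)"] by (simp add: h_def)
    then show "v \<in> {polytabloid \<mu> t | t. tableau \<mu> t}"
      using t(1) by blast
  qed
  then have specht: "specht \<mu> = cfun.span ?G"
    by (simp only: specht_def)
  define S where "S c = (\<lambda>T'. \<Sum>a\<in>{1..n}. E a c T' - E c a T')" for c
  \<comment> \<open>\<open>1 / n\<close> times the sum of the triangles \<open>g a b c\<close> over
    all \<open>a\<close>, with a further 1/2 because an edge and its reverse both occur in the index
    set.\<close>
  define w where "w b c = (\<lambda>T'. (of_nat n * (E b c T' - E c b T') - S c T' + S b T') / (2 * of_nat n))" for b c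
  have n0: "of_nat n \<noteq> (0 :: complex)"
    using n by simp
  have ET: "E a b (T c d) = of_bool (a = c \<and> b = d)" for a b c d
    by (auto simp: E_def unit_vec_def T_def)
  have ST: "S c (T x y) = of_bool (c = y) - of_bool (c = x)" if "x \<in> {1..n}" "y \<in> {1..n}" for c x y
    using that by (simp add: S_def ET sum_subtractf of_bool_conj if_distrib[of "\<lambda>x. x * _"] cong: if_cong)
  let ?I = "Sigma {1..n} (\<lambda>b. {1..n} - {b})"
  have "trace_on (cfun.span ?G) (\<lambda>v T. v (tabloid_act (inv p) T))
      = (\<Sum>i\<in>?I. w (fst i) (snd i) (tabloid_act (inv p) (T (fst i) (snd i))))"
  proof (rule trace_on_span_comp[where T = "\<lambda>i. T (fst i) (snd i)" and w = "\<lambda>i. w (fst i) (snd i)"])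
    fix i assume "i \<in> ?I"
    moreover obtain b c where i: "i = (b, c)"
      by (cases i)
    ultimately have bc: "b \<in> {1..n}" "c \<in> {1..n}" "b \<noteq> c"
      by auto
    have "w b c = (\<lambda>x. (1 / (2 * of_nat n)) * (\<Sum>a\<in>{1..n} - set [b, c]. g a b c) x)"
    proof
      fix x
      \<comment> \<open>The omitted triangles \<open>a = b\<close> and \<open>a = c\<close> are
        degenerate and have zero boundary, so the sum over all \<open>a\<close> is the same.\<close>
      have "(\<Sum>a\<in>{1..n} - set [b, c]. g a b c x) = of_nat n * (E b c x - E c b x) - S c x + S b x"
        using bc unfolding g_def
        by (subst sum_remove_points)
          (auto simp: S_def sum.distrib sum_subtractf algebra_simps)
      then show "w b c x = (1 / (2 * of_nat n)) * (\<Sum>a\<in>{1..n} - set [b, c]. g a b c) x"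
        using n0 by (simp add: w_def sum_fun_apply)
    qed
    also have "\<dots> \<in> cfun.span ?G"
      using bc by (intro cfun.span_scale cfun.span_sum cfun.span_base) fastforce
    finally show "w (fst i) (snd i) \<in> cfun.span ?G"
      by (simp add: i)
  next
    fix v x assume "v \<in> ?G"
    then obtain a b c where abc: "?D a b c" and v: "v = g a b c"
      by blast
    have pick: "(\<Sum>i\<in>?I. E b c (T (fst i) (snd i)) * w (fst i) (snd i) x) = w b c x"
      if "b \<in> {1..n}" "c \<in> {1..n}" "b \<noteq> c" for b c
    proof -
      have "(\<Sum>i\<in>?I. E b c (T (fst i) (snd i)) * w (fst i) (snd i) x) = (\<Sum>i\<in>?I. if i = (b, c) then w b c x else 0)"
        by (intro sum.cong refl) (auto simp: ET)
      also have "\<dots> = w b c x"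
        using that by (subst sum.delta) auto
      finally show ?thesis .
    qed
    have "(\<Sum>i\<in>?I. v (T (fst i) (snd i)) * w (fst i) (snd i) x)
       = w b c x - w c b x - w a c x + w c a x - w b a x + w a b x"
      unfolding v g_def distrib_right left_diff_distrib sum.distrib sum_subtractf
      using abc by (simp only: pick not_sym simp_thms)
    \<comment> \<open>The \<open>S\<close> terms are differences over the endpoints of an edge and
      cancel around the triangle.\<close>
    also have "\<dots> = v x"
      using n0 unfolding v g_def w_def by (simp add: field_simps)
    finally show "(\<Sum>i\<in>?I. v (T (fst i) (snd i)) * w (fst i) (snd i) x) = v x" .
  next
    fix v assume "v \<in> ?G"
    then obtain a b c where abc: "?D a b c" and v: "v = g a b c"
      by blast
    have "(\<lambda>T. v (tabloid_act (inv p) T)) = g (p a) (p b) (p c)"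
      by (simp add: v g_def E_act)
    moreover have "?D (p a) (p b) (p c)"
      using abc p_in p_eq by blast
    ultimately show "(\<lambda>T. v (tabloid_act (inv p) T)) \<in> ?G"
      by blast
  qed simp
  also have "\<dots> = (\<Sum>x\<in>{1..n}. \<Sum>y\<in>{1..n} - {x}. w x y (tabloid_act (inv p) (T x y)))"
    by (subst sum.Sigma) (auto simp: case_prod_unfold)
  also have "\<dots> = (\<Sum>x\<in>{1..n}. \<Sum>y\<in>{1..n} - {x}.
      (of_bool (p x = x \<and> p y = y) - of_bool (p x = y \<and> p y = x)) / 2
      + (of_bool (p y = x) - of_bool (p y = y) + of_bool (p x = y) - of_bool (p x = x)) / (2 * of_nat n))"
  proof (intro sum.cong refl)
    fix x y assume xy: "x \<in> {1..n}" "y \<in> {1..n} - {x}"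
    have S_act: "S c (tabloid_act (inv p) T') = S (p c) T'" for c T'
      unfolding S_def E_act by (rule sum_p)
    have "w x y (tabloid_act (inv p) (T x y)) = (of_nat n * (of_bool (p x = x \<and> p y = y) - of_bool (p y = x \<and> p x = y))
       - (of_bool (p y = y) - of_bool (p y = x)) + (of_bool (p x = y) - of_bool (p x = x))) / (2 * of_nat n)"
      using xy unfolding w_def E_act S_act ET by (simp only: ST Diff_iff)
    also have "\<dots> = (of_bool (p x = x \<and> p y = y) - of_bool (p x = y \<and> p y = x)) / 2
      + (of_bool (p y = x) - of_bool (p y = y) + of_bool (p x = y) - of_bool (p x = x)) / (2 * of_nat n)"
      using n0 by (simp add: field_simps conj_commute)
    finally show "w x y (tabloid_act (inv p) (T x y)) =
      (of_bool (p x = x \<and> p y = y) - of_bool (p x = y \<and> p y = x)) / 2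
      + (of_bool (p y = x) - of_bool (p y = y) + of_bool (p x = y) - of_bool (p x = x)) / (2 * of_nat n)" .
  qed
  also have "\<dots> = (fixed_pairs n p - swapped_pairs n p) / 2
      + ((of_nat n - fixed_points n p) - (of_nat n - 1) * fixed_points n p
        + (of_nat n - fixed_points n p) - (of_nat n - 1) * fixed_points n p) / (2 * of_nat n)"
    unfolding sum.distrib sum_subtractf sum_divide_distrib[symmetric] sum_off_diagonal
      fixed_pairs_def[symmetric] swapped_pairs_def[symmetric] ..
  also have "\<dots> = (fixed_pairs n p - swapped_pairs n p) / 2 - fixed_points n p + 1"
    using n0 by (simp add: field_simps)
  finally show ?thesis
    unfolding irr_char_def pad perm_act_eq specht .
qed

text \<open>All columns but the first two have at most one cell, so the stabilizer is the Klein
  four-group generated by the exchanges in the two columns of height 2.\<close>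

lemma column_stabilizer_two_columns:
  assumes t: "tableau \<mu> t" and \<mu>: "\<And>c. c \<in> cells \<mu> \<Longrightarrow> snd c \<noteq> 0 \<Longrightarrow> snd c \<noteq> 1 \<Longrightarrow> fst c = 0"
    and col: "t ` {c \<in> cells \<mu>. snd c = 0} = {a, b}" "t ` {c \<in> cells \<mu>. snd c = 1} = {c, d}"
    and ne: "a \<noteq> b" "c \<noteq> d" "{a, b} \<inter> {c, d} = {}"
  shows "column_stabilizer \<mu> t = {id, Transposition.transpose a b, Transposition.transpose c d,
    Transposition.transpose a b \<circ> Transposition.transpose c d}"
proof -
  let ?C = "\<lambda>j. t ` {c \<in> cells \<mu>. snd c = j}"
  have t': "t ` cells \<mu> = {1..sum_list \<mu>}" "inj_on t (cells \<mu>)"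
    using t by (auto simp: tableau_def bij_betw_def)
  have "?C j \<subseteq> {1..sum_list \<mu>}" for j
    unfolding t'(1)[symmetric] by (rule image_mono) simp
  from this[of 0] this[of 1] have sub: "{a, b, c, d} \<subseteq> {1..sum_list \<mu>}"
    unfolding col by simp
  have col0: "t y \<in> {a, b}" if "y \<in> cells \<mu>" "snd y = 0" for y
    unfolding col(1)[symmetric] using that by (intro imageI) simp
  have col1: "t y \<in> {c, d}" if "y \<in> cells \<mu>" "snd y = 1" for y
    unfolding col(2)[symmetric] using that by (intro imageI) simp
  have fwd: "p \<in> {id, Transposition.transpose a b, Transposition.transpose c d,
      Transposition.transpose a b \<circ> Transposition.transpose c d}"
    if p: "p permutes {1..sum_list \<mu>}" "\<And>j. p ` ?C j = ?C j" for p
  proof -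
    have fix_out: "p x = x" if x: "x \<notin> {a, b, c, d}" for x
    proof (cases "x \<in> {1..sum_list \<mu>}")
      case True
      then have "x \<in> t ` cells \<mu>"
        using t'(1) by simp
      then obtain y where y: "y \<in> cells \<mu>" "x = t y"
        by (auto elim: imageE)
      have "snd y \<noteq> 0" "snd y \<noteq> 1"
        using x y col0[of y] col1[of y] by auto
      then have "y' = y" if "y' \<in> cells \<mu>" "snd y' = snd y" for y'
        using \<mu>[of y] \<mu>[of y'] y that by (intro prod_eqI) simp_all
      then have "{y' \<in> cells \<mu>. snd y' = snd y} = {y}"
        using y by blast
      with p(2)[of "snd y"] have "p ` t ` {y} = t ` {y}"
        by (simp only:)
      then show ?thesis
        using y by simp
    qed (use p(1) permutes_not_in in metis)
    have ab: "p ` {a, b} = {a, b}" and cd: "p ` {c, d} = {c, d}"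
      using p(2)[of 0] p(2)[of 1] unfolding col by simp_all
    have inj: "p x = p y \<longleftrightarrow> x = y" for x y
      using permutes_inj[OF p(1)] by (simp only: inj_eq)
    have A: "(p a = a \<and> p b = b) \<or> (p a = b \<and> p b = a)"
      using ab inj[of a b] ne(1) by auto
    have C: "(p c = c \<and> p d = d) \<or> (p c = d \<and> p d = c)"
      using cd inj[of c d] ne(2) by auto
    have eqI: "p = q" if "p a = q a" "p b = q b" "p c = q c" "p d = q d" "\<And>x. x \<notin> {a, b, c, d} \<Longrightarrow> q x = x" for q
    proof
      fix x show "p x = q x"
        using that fix_out[of x] by (cases "x \<in> {a, b, c, d}") auto
    qed
    have ne': "a \<noteq> c" "a \<noteq> d" "b \<noteq> c" "b \<noteq> d"
      using ne by auto
    show ?thesis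
      using A
    proof
      assume a: "p a = a \<and> p b = b"
      show ?thesis
        using C
      proof
        assume c: "p c = c \<and> p d = d"
        have "p = id"
          by (rule eqI) (simp_all add: a c)
        then show ?thesis by simp
      next
        assume c: "p c = d \<and> p d = c"
        have "p = Transposition.transpose c d"
          by (rule eqI) (simp_all add: a c ne')
        then show ?thesis by simp
      qed
    next
      assume a: "p a = b \<and> p b = a"
      show ?thesis
        using C
      proof
        assume c: "p c = c \<and> p d = d"
        have "p = Transposition.transpose a b"
          by (rule eqI) (simp_all add: a c ne'[symmetric])
        then show ?thesis by simp
      next
        assume c: "p c = d \<and> p d = c"
        have "p = Transposition.transpose a b \<circ> Transposition.transpose c d"
          by (rule eqI) (simp_all add: a c ne' ne'[symmetric])
        then show ?thesis by simp
      qed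
    qed
  qed
  have bwd: "q permutes {1..sum_list \<mu>} \<and> (\<forall>j. q ` ?C j = ?C j)"
    if q: "q \<in> {id, Transposition.transpose a b, Transposition.transpose c d,
      Transposition.transpose a b \<circ> Transposition.transpose c d}" for q
  proof (intro conjI allI)
    show "q permutes {1..sum_list \<mu>}"
      using q sub by (auto intro!: permutes_id permutes_compose permutes_swap_id)
    have out: "q x = x" if "x \<notin> {a, b, c, d}" for x
      using q that by auto
    have ab: "q ` {a, b} = {a, b}" and cd: "q ` {c, d} = {c, d}"
      using q ne by auto
    fix j :: nat
    consider "j = 0" | "j = 1" | "j \<noteq> 0" "j \<noteq> 1" by blast
    then show "q ` ?C j = ?C j"
    proof cases
      case 3
      have "q (t y) = t y" if "y \<in> cells \<mu>" "snd y = j" for y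
      proof (rule out)
        have "t y \<notin> ?C i" if "i \<noteq> j" for i
          using that \<open>y \<in> cells \<mu>\<close> \<open>snd y = j\<close> by (auto simp: inj_on_eq_iff[OF t'(2)])
        from this[of 0] this[of 1] show "t y \<notin> {a, b, c, d}"
          using 3 unfolding col by simp
      qed
      then show ?thesis by force
    qed (use col ab cd in \<open>simp_all only:\<close>)
  qed
  show ?thesis
    unfolding column_stabilizer_def
  proof (intro equalityI subsetI CollectI)
    fix p assume "p \<in> {p. p permutes {1..sum_list \<mu>} \<and> (\<forall>j. p ` ?C j = ?C j)}"
    then have "p permutes {1..sum_list \<mu>}" "p ` ?C j = ?C j" for j
      by simp_all
    then show "p \<in> {id, Transposition.transpose a b, Transposition.transpose c d,
        Transposition.transpose a b \<circ> Transposition.transpose c d}"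
      by (rule fwd)
  qed (rule bwd)
qed

text \<open>Tabloids are the edges \<open>{a, b}\<close> of the complete graph. The polytabloids are
  alternating 4-cycles, which span the edge weightings with sum zero at every vertex, and the frame
  is the orthogonal projection of single edges onto this space.\<close>

lemma irr_char_two_row:
  assumes p: "p permutes {1..n}" and n: "n \<ge> 4"
  shows "irr_char (pad [2] n) p = (fixed_pairs n p + swapped_pairs n p) / 2 - fixed_points n p"
proof -
  interpret permuted_tabloids n p by unfold_locales (rule p)
  define \<mu> where "\<mu> = [n - 2, 2]"
  define T where "T a b = [{1..n} - {a, b}, {a, b}]" for a b :: nat
  define E where "E a b = unit_vec (T a b)" for a b
  have pad: "pad [2] n = \<mu>" by (simp add: pad_def \<mu>_def)
  have size: "sum_list \<mu> = n" using n by (simp add: \<mu>_def)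
  have cells: "cells \<mu> = {0} \<times> {..<n - 2} \<union> {(1, 0), (1, 1)}"
    by (auto simp: \<mu>_def cells_Cons cells_Nil image_iff)
  let ?K = "{(0, 0), (1, 0), (0, 1), (1, 1)}"
  have in_cells: "?K \<subseteq> cells \<mu>"
    using n by (auto simp: cells)
  have act: "tabloid_act q (T a b) = T (q a) (q b)" if "q permutes {1..n}" for q a b
    using permuted_tabloids.image_p[OF permuted_tabloids.intro[OF that]] by (simp add: T_def tabloid_act_def)
  have E_act: "E a b (tabloid_act (inv p) T') = E (p a) (p b) T'" for a b T'
    using unit_vec_tabloid_act[OF p, of "T a b" T'] act[OF p, of a b] by (simp add: E_def)
  have E_commute: "E a b = E b a" for a b
    by (simp add: E_def T_def insert_commute)
  define g where "g a b c d = (\<lambda>T. E b d T - E a d T - E b c T + E a c T)" for a b c d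
  let ?D = "\<lambda>a b c d. a \<in> {1..n} \<and> b \<in> {1..n} \<and> c \<in> {1..n} \<and> d \<in> {1..n}
    \<and> a \<noteq> b \<and> a \<noteq> c \<and> a \<noteq> d \<and> b \<noteq> c \<and> b \<noteq> d \<and> c \<noteq> d"
  let ?G = "{g a b c d | a b c d. ?D a b c d}"
  have poly: "polytabloid \<mu> t = g (t (0, 0)) (t (1, 0)) (t (0, 1)) (t (1, 1))"
    and in01: "?D (t (0, 0)) (t (1, 0)) (t (0, 1)) (t (1, 1))" if t: "tableau \<mu> t" for t
  proof -
    let ?a = "t (0, 0)" and ?b = "t (1, 0)" and ?c = "t (0, 1)" and ?d = "t (1, 1)"
    have bij: "t ` cells \<mu> = {1..n}" "inj_on t (cells \<mu>)"
      using t size by (simp_all add: tableau_def bij_betw_def)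
    show in01: "?D ?a ?b ?c ?d"
      using in_cells inj_on_eq_iff[OF bij(2)] unfolding bij(1)[symmetric] by auto
    have "{c \<in> cells \<mu>. snd c = 0} = {(0, 0), (1, 0)}" "{c \<in> cells \<mu>. snd c = 1} = {(0, 1), (1, 1)}"
      using n by (auto simp: cells)
    then have cols: "t ` {c \<in> cells \<mu>. snd c = 0} = {?a, ?b}" "t ` {c \<in> cells \<mu>. snd c = 1} = {?c, ?d}"
      by (simp_all only: image_insert image_empty)
    have col: "column_stabilizer \<mu> t = {id, Transposition.transpose ?a ?b, Transposition.transpose ?c ?d,
        Transposition.transpose ?a ?b \<circ> Transposition.transpose ?c ?d}"
    proof (rule column_stabilizer_two_columns[OF t _ cols])
      show "fst c = 0" if "c \<in> cells \<mu>" "snd c \<noteq> 0" "snd c \<noteq> 1" for c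
        using that by (auto simp: cells)
    qed (use in01 in auto)
    have "{c \<in> cells \<mu>. fst c \<noteq> 0} = {(1, 0), (1, 1)}" "{c \<in> cells \<mu>. fst c = 1} = {(1, 0), (1, 1)}"
      by (auto simp: cells)
    moreover have "length \<mu> = 2"
      by (simp add: \<mu>_def)
    ultimately have tab: "tabloid \<mu> t = T ?b ?d"
      using tabloid_first_row[OF t] size by (simp add: tabloid_def T_def numeral_2_eq_2)
    have sub: "q permutes {1..n}" if "q \<in> column_stabilizer \<mu> t" for q
      using that size by (simp add: column_stabilizer_def)
    have "polytabloid \<mu> t = (\<lambda>T'. \<Sum>q\<in>column_stabilizer \<mu> t. of_int (sign q) * E (q ?b) (q ?d) T')"
      unfolding polytabloid_unit_vec tab E_def using sub by (intro ext sum.cong refl) (simp add: act)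
    also have "\<dots> = g ?a ?b ?c ?d"
    proof -
      let ?p = "Transposition.transpose ?a ?b" and ?q = "Transposition.transpose ?c ?d"
      have at: "?p ?a = ?b" "?q ?a = ?a" "?p ?c = ?c" "?q ?c = ?d" "?p ?d = ?d"
        using in01 by simp_all
      have "?a \<noteq> ?b" "?c \<noteq> ?d" using in01 by simp_all
      \<comment> \<open>The four elements have to be distinct for the sum over the enumerated set to
        have four terms.\<close>
      then have "id \<noteq> ?p" "id \<noteq> ?q" "?p \<noteq> ?q" "id \<noteq> ?p \<circ> ?q" "?p \<noteq> ?p \<circ> ?q" "?q \<noteq> ?p \<circ> ?q"
        using at by (metis id_apply comp_apply)+
      then show ?thesis
        unfolding col using in01
        by (intro ext) (simp add: sign_swap_id sign_compose permutation_swap_id g_def)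
    qed
    finally show "polytabloid \<mu> t = g ?a ?b ?c ?d" .
  qed
  have "{polytabloid \<mu> t | t. tableau \<mu> t} = ?G"
  proof (intro equalityI subsetI)
    fix v assume "v \<in> {polytabloid \<mu> t | t. tableau \<mu> t}"
    then show "v \<in> ?G" using poly in01 by blast
  next
    fix v assume "v \<in> ?G"
    then obtain a b c d where abc: "?D a b c d" and v: "v = g a b c d"
      by blast
    define h where "h x = (if x = (0, 0) then a else if x = (1, 0) then b else if x = (0, 1) then c else d)" for x :: "nat \<times> nat"
    obtain t where t: "tableau \<mu> t" "\<And>x. x \<in> ?K \<Longrightarrow> t x = h x"
      by (rule ex_tableau[OF in_cells, of h]) (use abc size in \<open>auto simp: h_def inj_on_def\<close>)
    have "v = polytabloid \<mu> t"
      unfolding poly[OF t(1)] v using t(2)[of "(0, 0)"] t(2)[of "(1, 0)"] t(2)[of "(0, 1)"] t(2)[of "(1, 1)"] by (simp add: h_def)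
    then show "v \<in> {polytabloid \<mu> t | t. tableau \<mu> t}"
      using t(1) by blast
  qed
  then have specht: "specht \<mu> = cfun.span ?G"
    by (simp only: specht_def)
  \<comment> \<open>\<open>E a a\<close> is the unit vector of a list whose second row has one
    element, hence no tabloid of shape \<open>\<mu>\<close>. It is subtracted so that sums can run
    over all of \<open>{1..n}\<close>.\<close>
  define S where "S a = (\<lambda>T'. (\<Sum>b\<in>{1..n}. E a b T') - E a a T')" for a
  define A where "A = (\<lambda>T'. \<Sum>a\<in>{1..n}. S a T')"
  define N :: complex where "N = of_nat n"
  have N: "N - 1 \<noteq> 0" "N - 2 \<noteq> 0"
  proof -
    have "N - 1 = of_nat (n - 1)" "N - 2 = of_nat (n - 2)"
      using n by (simp_all add: N_def of_nat_diff)
    moreover have "n - 1 \<noteq> 0" "n - 2 \<noteq> 0"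
      using n by simp_all
    ultimately show "N - 1 \<noteq> 0" "N - 2 \<noteq> 0"
      by (simp_all only: of_nat_eq_0_iff not_False_eq_True)
  qed
  \<comment> \<open>The coefficients are forced by zero vertex sums: at \<open>a\<close> the sum is
    \<open>1 - N / (N - 2) + 2 / (N - 2)\<close>, and at a vertex off the edge
    \<open>- 2 / (N - 2) + 2 / (N - 2)\<close>. The outer 1/2 compensates for each edge being
    indexed twice.\<close>
  define w where "w a b = (\<lambda>T'. (E a b T' - (S a T' + S b T') / (N - 2) + A T' / ((N - 1) * (N - 2))) / 2)" for a b
  have ET: "E a b (T x y) = of_bool (a = x \<and> b = y) + of_bool (a = y \<and> b = x)" if "x \<noteq> y" for a b x y
    using that by (auto simp: E_def unit_vec_def T_def doubleton_eq_iff)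
  have ST: "S a (T x y) = of_bool (a = x) + of_bool (a = y)" if "x \<in> {1..n}" "y \<in> {1..n}" "x \<noteq> y" for a x y
    using that by (simp add: S_def ET sum.distrib of_bool_conj if_distrib[of "\<lambda>x. x * _"] cong: if_cong)
  have AT: "A (T x y) = 2" if "x \<in> {1..n}" "y \<in> {1..n}" "x \<noteq> y" for x y
    using that by (simp add: A_def ST sum.distrib of_bool_def)
  let ?I = "Sigma {1..n} (\<lambda>b. {1..n} - {b})"
  have "trace_on (cfun.span ?G) (\<lambda>v T. v (tabloid_act (inv p) T))
      = (\<Sum>i\<in>?I. w (fst i) (snd i) (tabloid_act (inv p) (T (fst i) (snd i))))"
  proof (rule trace_on_span_comp[where T = "\<lambda>i. T (fst i) (snd i)" and w = "\<lambda>i. w (fst i) (snd i)"])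
    fix i assume "i \<in> ?I"
    moreover obtain b d where i: "i = (b, d)"
      by (cases i)
    ultimately have bd: "b \<in> {1..n}" "d \<in> {1..n}" "b \<noteq> d"
      by auto
    have "w b d = (\<lambda>x. (1 / (2 * ((N - 1) * (N - 2)))) * (\<Sum>a\<in>{1..n} - set [b, d]. \<Sum>c\<in>{1..n} - set [a, b, d]. g a b c d) x)"
    proof
      fix x
      \<comment> \<open>Both sums are extended to all of \<open>{1..n}\<close> and corrected at the
        excluded points; the diagonal vectors \<open>E a a\<close> introduced in this way
        cancel.\<close>
      have "(\<Sum>a\<in>{1..n} - set [b, d]. \<Sum>c\<in>{1..n} - set [a, b, d]. g a b c d x)
          = (\<Sum>a\<in>{1..n} - set [b, d]. (N - 2) * E b d x - (N - 2) * E a d x - S b x + S a x)"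
      proof (rule sum.cong[OF refl])
        fix a assume a: "a \<in> {1..n} - set [b, d]"
        have "(\<Sum>c\<in>{1..n} - set [a, b, d]. g a b c d x)
           = (\<Sum>c\<in>{1..n}. g a b c d x) - (g a b a d x + (g a b b d x + (g a b d d x + 0)))"
          using a bd by (subst sum_remove_points) auto
        also have "(\<Sum>c\<in>{1..n}. g a b c d x) = N * E b d x - N * E a d x - (S b x + E b b x) + (S a x + E a a x)"
          by (simp add: g_def S_def N_def sum.distrib sum_subtractf algebra_simps)
        finally show "(\<Sum>c\<in>{1..n} - set [a, b, d]. g a b c d x) = (N - 2) * E b d x - (N - 2) * E a d x - S b x + S a x"
          using E_commute[of a b] by (simp add: g_def algebra_simps)
      qed
      also have "\<dots> = (\<Sum>a\<in>{1..n}. (N - 2) * E b d x - (N - 2) * E a d x - S b x + S a x)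
          - (((N - 2) * E b d x - (N - 2) * E b d x - S b x + S b x) + (((N - 2) * E b d x - (N - 2) * E d d x - S b x + S d x) + 0))"
        using bd by (subst sum_remove_points) auto
      also have "(\<Sum>a\<in>{1..n}. (N - 2) * E b d x - (N - 2) * E a d x - S b x + S a x)
          = N * (N - 2) * E b d x - (N - 2) * (S d x + E d d x) - N * S b x + A x"
      proof -
        have "(\<Sum>a\<in>{1..n}. E a d x) = S d x + E d d x"
          unfolding S_def using E_commute by simp
        then show ?thesis
          by (simp add: A_def N_def sum.distrib sum_subtractf sum_distrib_left[symmetric] mult.assoc)
      qed
      finally have "(\<Sum>a\<in>{1..n} - set [b, d]. \<Sum>c\<in>{1..n} - set [a, b, d]. g a b c d x)
          = (N - 1) * (N - 2) * E b d x - (N - 1) * (S b x + S d x) + A x"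
        by (simp add: algebra_simps)
      moreover have "w b d x = (1 / (2 * ((N - 1) * (N - 2)))) * ((N - 1) * (N - 2) * E b d x - (N - 1) * (S b x + S d x) + A x)"
      proof -
        have "(1 / (2 * ((N - 1) * (N - 2)))) * ((N - 1) * (N - 2) * e - (N - 1) * s + z) = (e - s / (N - 2) + z / ((N - 1) * (N - 2))) / 2" for e s z
          using N by (simp add: divide_simps) (simp add: algebra_simps)
        then show ?thesis by (simp only: w_def)
      qed
      ultimately show "w b d x = (1 / (2 * ((N - 1) * (N - 2)))) * (\<Sum>a\<in>{1..n} - set [b, d]. \<Sum>c\<in>{1..n} - set [a, b, d]. g a b c d) x"
        by (simp only: sum_fun_apply)
    qed
    also have "\<dots> \<in> cfun.span ?G"
      using bd by (intro cfun.span_scale cfun.span_sum cfun.span_base) fastforce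
    finally show "w (fst i) (snd i) \<in> cfun.span ?G"
      by (simp add: i)
  next
    fix v x assume "v \<in> ?G"
    then obtain a b c d where abc: "?D a b c d" and v: "v = g a b c d"
      by blast
    have pick: "(\<Sum>i\<in>?I. E b c (T (fst i) (snd i)) * w (fst i) (snd i) x) = 2 * w b c x"
      if "b \<in> {1..n}" "c \<in> {1..n}" "b \<noteq> c" for b c
    proof -
      have "(\<Sum>i\<in>?I. E b c (T (fst i) (snd i)) * w (fst i) (snd i) x)
        = (\<Sum>i\<in>?I. (if i = (b, c) then w b c x else 0) + (if i = (c, b) then w c b x else 0))"
      proof (rule sum.cong[OF refl])
        fix i assume "i \<in> ?I"
        then have "\<exists>y z. i = (y, z) \<and> y \<noteq> z"
          by auto
        then obtain y z where i: "i = (y, z)" and yz: "y \<noteq> z"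
          by (elim exE conjE)
        show "E b c (T (fst i) (snd i)) * w (fst i) (snd i) x
          = (if i = (b, c) then w b c x else 0) + (if i = (c, b) then w c b x else 0)"
          unfolding i fst_conv snd_conv ET[OF yz] prod.inject
          using yz by (cases "b = y"; cases "c = z"; cases "b = z"; cases "c = y") simp_all
      qed
      also have "\<dots> = w b c x + w c b x"
        using that unfolding sum.distrib by (subst (1 2) sum.delta) auto
      also have "w c b x = w b c x"
        by (simp add: w_def E_commute[of b c] add.commute)
      finally show ?thesis by simp
    qed
    have "(\<Sum>i\<in>?I. v (T (fst i) (snd i)) * w (fst i) (snd i) x)
       = 2 * w b d x - 2 * w a d x - 2 * w b c x + 2 * w a c x"
      unfolding v g_def distrib_right left_diff_distrib sum.distrib sum_subtractf
      using abc by (simp only: pick not_sym simp_thms)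
    \<comment> \<open>The \<open>S\<close> part is additive over the endpoints of an edge and the
      \<open>A\<close> part is constant, so both vanish in the alternating sum over a
      4-cycle.\<close>
    also have "\<dots> = v x"
    proof -
      have w2: "2 * w a b x = E a b x - (S a x + S b x) / (N - 2) + A x / ((N - 1) * (N - 2))" for a b
        unfolding w_def by (simp only: nonzero_mult_div_cancel_left times_divide_eq_right zero_neq_numeral[symmetric] not_False_eq_True)
      show ?thesis
        unfolding v g_def w2 by (simp add: add_divide_distrib)
    qed
    finally show "(\<Sum>i\<in>?I. v (T (fst i) (snd i)) * w (fst i) (snd i) x) = v x" .
  next
    fix v assume "v \<in> ?G"
    then obtain a b c d where abc: "?D a b c d" and v: "v = g a b c d"
      by blast
    have "(\<lambda>T. v (tabloid_act (inv p) T)) = g (p a) (p b) (p c) (p d)"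
      by (simp add: v g_def E_act)
    moreover have "?D (p a) (p b) (p c) (p d)"
      using abc p_in p_eq by blast
    ultimately show "(\<lambda>T. v (tabloid_act (inv p) T)) \<in> ?G"
      by blast
  qed simp
  also have "\<dots> = (\<Sum>x\<in>{1..n}. \<Sum>y\<in>{1..n} - {x}. w x y (tabloid_act (inv p) (T x y)))"
    by (subst sum.Sigma) (auto simp: case_prod_unfold)
  also have "\<dots> = (\<Sum>x\<in>{1..n}. \<Sum>y\<in>{1..n} - {x}.
      (of_bool (p x = x \<and> p y = y) + of_bool (p x = y \<and> p y = x)) / 2
      - (of_bool (p x = x) + of_bool (p x = y) + of_bool (p y = x) + of_bool (p y = y)) / (2 * (N - 2))
      + 1 / ((N - 1) * (N - 2)))"
  proof (intro sum.cong refl)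
    fix x y assume xy: "x \<in> {1..n}" "y \<in> {1..n} - {x}"
    then have xy': "y \<in> {1..n}" "x \<noteq> y" by auto
    have S_act: "S c (tabloid_act (inv p) T') = S (p c) T'" for c T'
      unfolding S_def E_act by (simp only: sum_p[of "\<lambda>b. E (p c) b T'"])
    have A_act: "A (tabloid_act (inv p) T') = A T'" for T'
      unfolding A_def S_act by (rule sum_p)
    show "w x y (tabloid_act (inv p) (T x y)) = (of_bool (p x = x \<and> p y = y) + of_bool (p x = y \<and> p y = x)) / 2
      - (of_bool (p x = x) + of_bool (p x = y) + of_bool (p y = x) + of_bool (p y = y)) / (2 * (N - 2))
      + 1 / ((N - 1) * (N - 2))"
      unfolding w_def E_act S_act A_act ET[OF xy'(2)] ST[OF xy(1) xy'] AT[OF xy(1) xy']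
      by (simp add: add_divide_distrib diff_divide_distrib)
  qed
  also have "\<dots> = (fixed_pairs n p + swapped_pairs n p) / 2
      - ((N - 1) * fixed_points n p + (N - fixed_points n p) + (N - fixed_points n p) + (N - 1) * fixed_points n p) / (2 * (N - 2))
      + N * (N - 1) * (1 / ((N - 1) * (N - 2)))"
  proof -
    have "(\<Sum>x\<in>{1..n}. \<Sum>y\<in>{1..n} - {x}. 1 / ((N - 1) * (N - 2))) = N * (N - 1) * (1 / ((N - 1) * (N - 2)))"
      using n by (simp add: N_def of_nat_diff)
    then show ?thesis
      unfolding sum.distrib sum_subtractf sum_divide_distrib[symmetric] sum_off_diagonal N_def
        fixed_pairs_def[symmetric] swapped_pairs_def[symmetric] by (simp only:)
  qed
  also have "\<dots> = (fixed_pairs n p + swapped_pairs n p) / 2 - fixed_points n p"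
  proof -
    have "((N - 1) * f + (N - f) + (N - f) + (N - 1) * f) / (2 * (N - 2)) = f + N / (N - 2)" for f
      using N(2) by (simp add: divide_simps) (simp add: algebra_simps)
    moreover have "N * (N - 1) * (1 / ((N - 1) * (N - 2))) = N / (N - 2)"
      using N by simp
    ultimately show ?thesis by (simp only:) simp
  qed
  finally show ?thesis
    unfolding irr_char_def pad perm_act_eq specht .
qed

subsection \<open>Averages of increasing subsequences against the characters\<close>

lemma conj_class_sym:
  assumes "q \<in> conj_class n p"
  shows "p \<in> conj_class n q"
proof -
  obtain s where s: "s permutes {1..n}" "q = s \<circ> p \<circ> inv s"
    using assms by (auto simp: conj_class_def)
  have "p = inv s \<circ> q \<circ> inv (inv s)"
    using permutes_inverses[OF s(1)] by (simp add: s(2) permutes_inv_inv[OF s(1)] fun_eq_iff)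
  then show ?thesis
    using permutes_inv[OF s(1)] by (auto simp: conj_class_def)
qed

lemma conj_class_trans:
  assumes "q \<in> conj_class n p" "r \<in> conj_class n q"
  shows "r \<in> conj_class n p"
proof -
  obtain s u where s: "s permutes {1..n}" "q = s \<circ> p \<circ> inv s" and u: "u permutes {1..n}" "r = u \<circ> q \<circ> inv u"
    using assms by (auto simp: conj_class_def)
  have "inv (u \<circ> s) = inv s \<circ> inv u"
    using s(1) u(1) by (intro o_inv_distrib permutes_bij)
  then have "r = (u \<circ> s) \<circ> p \<circ> inv (u \<circ> s)"
    by (simp add: s u o_assoc)
  then show ?thesis
    using permutes_compose[OF s(1) u(1)] by (auto simp: conj_class_def)
qed

lemma conj_class_eq: "q \<in> conj_class n p \<Longrightarrow> conj_class n q = conj_class n p"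
  by (blast intro: conj_class_trans conj_class_sym)

lemma conj_class_refl: "p \<in> conj_class n p"
proof -
  have "p = id \<circ> p \<circ> inv id" by simp
  then show ?thesis
    unfolding conj_class_def using permutes_id by blast
qed

lemma conj_class_permutes:
  assumes "p permutes {1..n}" "q \<in> conj_class n p"
  shows "q permutes {1..n}"
  using assms by (auto simp: conj_class_def intro!: permutes_compose permutes_inv)

text \<open>After the sums are exchanged, \<open>N_id k n q\<close> is weighted by
  \<open>f p\<close> divided by the class size, summed over the \<open>p\<close> conjugate to
  \<open>q\<close>; all these terms are equal, which leaves \<open>f q\<close>.\<close>

lemma class_inner_M_id:
  assumes inv: "\<And>p q. p permutes {1..n} \<Longrightarrow> q permutes {1..n} \<Longrightarrow> f (q \<circ> p \<circ> inv q) = f p"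
  shows "class_inner n f (M_id k n) = (\<Sum>p | p permutes {1..n}. f p * of_nat (N_id k n p)) / fact n"
proof -
  let ?S = "{p. p permutes {1..n}}" and ?N = "\<lambda>p. of_nat (N_id k n p) :: complex"
    and ?c = "\<lambda>p. of_nat (card (conj_class n p)) :: complex"
  have fin: "finite ?S"
    by (rule finite_permutations) simp
  have sub: "conj_class n p \<subseteq> ?S" if "p \<in> ?S" for p
    using conj_class_permutes that by blast
  have "(\<Sum>p\<in>?S. f p * cnj (M_id k n p)) = (\<Sum>p\<in>?S. \<Sum>q\<in>conj_class n p. f p * ?N q / ?c p)"
    by (simp add: M_id_def sum_distrib_left sum_divide_distrib)
  also have "\<dots> = (\<Sum>p\<in>?S. \<Sum>q | q \<in> ?S \<and> q \<in> conj_class n p. f p * ?N q / ?c p)"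
    using sub by (intro sum.cong refl) blast
  also have "\<dots> = (\<Sum>q\<in>?S. \<Sum>p | p \<in> ?S \<and> q \<in> conj_class n p. f p * ?N q / ?c p)"
    by (rule sum.swap_restrict[OF fin fin])
  also have "\<dots> = (\<Sum>q\<in>?S. f q * ?N q)"
  proof (rule sum.cong[OF refl])
    fix q assume q: "q \<in> ?S"
    have "{p \<in> ?S. q \<in> conj_class n p} = conj_class n q"
      using sub[OF q] conj_class_sym by blast
    then have "(\<Sum>p | p \<in> ?S \<and> q \<in> conj_class n p. f p * ?N q / ?c p) = (\<Sum>p\<in>conj_class n q. f q * ?N q / ?c q)"
    proof (rule sum.cong)
      fix p assume p: "p \<in> conj_class n q"
      have "f p = f q"
        using p q inv by (auto simp: conj_class_def)
      then show "f p * ?N q / ?c p = f q * ?N q / ?c q"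
        by (simp add: conj_class_eq[OF p])
    qed
    moreover have "?c q \<noteq> 0"
      using conj_class_refl[of q n] sub[OF q] finite_subset[OF _ fin] by auto
    ultimately show "(\<Sum>p | p \<in> ?S \<and> q \<in> conj_class n p. f p * ?N q / ?c p) = f q * ?N q"
      by simp
  qed
  finally show ?thesis
    by (simp add: class_inner_def)
qed

lemma (in permuted_tabloids) sum_off_diagonal_p:
  fixes f :: "nat \<Rightarrow> nat \<Rightarrow> complex"
  shows "(\<Sum>a\<in>{1..n}. \<Sum>b\<in>{1..n} - {a}. f (p a) (p b)) = (\<Sum>a\<in>{1..n}. \<Sum>b\<in>{1..n} - {a}. f a b)"
proof -
  have "(\<Sum>a\<in>{1..n}. \<Sum>b\<in>{1..n} - {a}. f (p a) (p b)) = (\<Sum>a\<in>{1..n}. (\<Sum>b\<in>{1..n}. f (p a) (p b)) - f (p a) (p a))"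
    by (intro sum.cong refl) (simp add: sum_diff1)
  also have "\<dots> = (\<Sum>a\<in>{1..n}. (\<Sum>b\<in>{1..n}. f (p a) b) - f (p a) (p a))"
    by (simp only: sum_p[of "f (p a)" for a])
  also have "\<dots> = (\<Sum>a\<in>{1..n}. (\<Sum>b\<in>{1..n}. f a b) - f a a)"
    by (rule sum_p)
  also have "\<dots> = (\<Sum>a\<in>{1..n}. \<Sum>b\<in>{1..n} - {a}. f a b)"
    by (intro sum.cong refl) (simp add: sum_diff1)
  finally show ?thesis .
qed

lemma statistics_conj_invariant:
  assumes q: "q permutes {1..n}"
  shows "fixed_points n (q \<circ> p \<circ> inv q) = fixed_points n p"
    "fixed_pairs n (q \<circ> p \<circ> inv q) = fixed_pairs n p"
    "swapped_pairs n (q \<circ> p \<circ> inv q) = swapped_pairs n p"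
proof -
  interpret permuted_tabloids n q by unfold_locales (rule q)
  have e: "(q \<circ> p \<circ> inv q) (q a) = q b \<longleftrightarrow> p a = b" for a b
    using permutes_inverses(2)[OF q] p_eq by simp
  show "fixed_points n (q \<circ> p \<circ> inv q) = fixed_points n p"
    unfolding fixed_points_def by (subst sum_p[symmetric]) (simp only: e)
  show "fixed_pairs n (q \<circ> p \<circ> inv q) = fixed_pairs n p"
    unfolding fixed_pairs_def by (subst sum_off_diagonal_p[symmetric]) (simp only: e)
  show "swapped_pairs n (q \<circ> p \<circ> inv q) = swapped_pairs n p"
    unfolding swapped_pairs_def by (subst sum_off_diagonal_p[symmetric]) (simp only: e)
qed

lemma sum_of_bool_N_id:
  "(\<Sum>p | p permutes {1..n}. of_bool (Q p) * of_nat (N_id k n p)) =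
     (of_nat (\<Sum>p | p permutes {1..n} \<and> Q p. N_id k n p) :: complex)"
proof -
  have fin: "finite {p. p permutes {1..n}}"
    by (rule finite_permutations) simp
  have "(\<Sum>p | p permutes {1..n}. of_bool (Q p) * of_nat (N_id k n p)) =
      (\<Sum>p | p permutes {1..n}. if Q p then of_nat (N_id k n p) else (0 :: complex))"
    by (intro sum.cong) auto
  also have "\<dots> = (\<Sum>p\<in>{p \<in> {p. p permutes {1..n}}. Q p}. of_nat (N_id k n p))"
    by (rule sum.inter_filter[OF fin, symmetric])
  finally show ?thesis by simp
qed

definition average :: "nat \<Rightarrow> nat \<Rightarrow> ((nat \<Rightarrow> nat) \<Rightarrow> complex) \<Rightarrow> complex" where
  "average k n f = (\<Sum>p | p permutes {1..n}. f p * of_nat (N_id k n p)) / fact n"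

lemma average_linear:
  "average k n (\<lambda>p. f p + g p) = average k n f + average k n g"
  "average k n (\<lambda>p. f p - g p) = average k n f - average k n g"
  "average k n (\<lambda>p. f p / c) = average k n f / c"
  by (simp_all add: average_def distrib_right left_diff_distrib sum.distrib sum_subtractf
      add_divide_distrib diff_divide_distrib sum_divide_distrib mult.commute[of c])

lemma class_inner_irr_char:
  "class_inner n (irr_char (pad [] n)) (M_id k n) = average k n (\<lambda>_. 1)"
  "n \<ge> 2 \<Longrightarrow> class_inner n (irr_char (pad [1] n)) (M_id k n) = average k n (fixed_points n) - average k n (\<lambda>_. 1)"
  "n \<ge> 4 \<Longrightarrow> class_inner n (irr_char (pad [2] n)) (M_id k n)
     = (average k n (fixed_pairs n) + average k n (swapped_pairs n)) / 2 - average k n (fixed_points n)"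
  "n \<ge> 3 \<Longrightarrow> class_inner n (irr_char (pad [1, 1] n)) (M_id k n)
     = (average k n (fixed_pairs n) - average k n (swapped_pairs n)) / 2 - average k n (fixed_points n) + average k n (\<lambda>_. 1)"
proof -
  have *: "class_inner n f (M_id k n) = average k n g"
    if "\<And>p. p permutes {1..n} \<Longrightarrow> f p = g p" "\<And>p q. q permutes {1..n} \<Longrightarrow> g (q \<circ> p \<circ> inv q) = g p" for f g
  proof -
    have "class_inner n f (M_id k n) = class_inner n g (M_id k n)"
      unfolding class_inner_def using that by (intro arg_cong2[where f = "(/)"] sum.cong) auto
    then show ?thesis
      using class_inner_M_id[of n g k] that by (simp add: average_def)
  qed
  show "class_inner n (irr_char (pad [] n)) (M_id k n) = average k n (\<lambda>_. 1)"
    by (rule *) (simp_all add: irr_char_trivial)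
  have "n \<ge> 2 \<Longrightarrow> class_inner n (irr_char (pad [1] n)) (M_id k n) = average k n (\<lambda>p. fixed_points n p - 1)"
    by (rule *) (simp_all only: irr_char_standard statistics_conj_invariant)
  then show "n \<ge> 2 \<Longrightarrow> class_inner n (irr_char (pad [1] n)) (M_id k n) = average k n (fixed_points n) - average k n (\<lambda>_. 1)"
    unfolding average_linear .
  have "n \<ge> 4 \<Longrightarrow> class_inner n (irr_char (pad [2] n)) (M_id k n)
      = average k n (\<lambda>p. (fixed_pairs n p + swapped_pairs n p) / 2 - fixed_points n p)"
    by (rule *) (simp_all only: irr_char_two_row statistics_conj_invariant)
  then show "n \<ge> 4 \<Longrightarrow> class_inner n (irr_char (pad [2] n)) (M_id k n)
     = (average k n (fixed_pairs n) + average k n (swapped_pairs n)) / 2 - average k n (fixed_points n)"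
    unfolding average_linear .
  have "n \<ge> 3 \<Longrightarrow> class_inner n (irr_char (pad [1, 1] n)) (M_id k n)
      = average k n (\<lambda>p. (fixed_pairs n p - swapped_pairs n p) / 2 - fixed_points n p + 1)"
    by (rule *) (simp_all only: irr_char_hook statistics_conj_invariant)
  then show "n \<ge> 3 \<Longrightarrow> class_inner n (irr_char (pad [1, 1] n)) (M_id k n)
     = (average k n (fixed_pairs n) - average k n (swapped_pairs n)) / 2 - average k n (fixed_points n) + average k n (\<lambda>_. 1)"
    unfolding average_linear .
qed

section \<open>Closed forms of the averages as functions of \<open>n\<close>\<close>

definition odd_prod :: "nat \<Rightarrow> 'a \<Rightarrow> 'a :: field_char_0" where
  "odd_prod k x = 2 ^ (k - 1) * (\<Prod>i = 1..k - 1. 2 * x - 2 * of_nat i + 1) / fact (2 * k - 1)"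

lemma conv2_closed_form:
  assumes "n \<ge> 1" "k \<ge> 1"
  shows "of_nat (conv2 n k) = (of_nat ((2 * n) choose (2 * k - 1)) / 2 :: complex)"
proof -
  obtain m j where m: "n = Suc m" "k = Suc j"
    using assms by (metis Suc_le_D One_nat_def)
  have "2 * m + 2 = 2 * n" "2 * j + 1 = 2 * k - 1"
    using m by simp_all
  then show ?thesis
    using sum_binomial_sq_conv2[of m j] unfolding conv2_def marked_def m of_nat_sum of_nat_power lessThan_Suc_atMost diff_Suc_1
    by (simp only:)
qed

text \<open>Of the factors \<open>2 x - i\<close>, those with \<open>i\<close> even are twice the
  factors of a falling factorial of \<open>x\<close>, and those with \<open>i\<close> odd form the
  odd product. This is how \<open>C(2 n, 2 k - 1)\<close> becomes divisible by
  \<open>n! / (n - k)!\<close> with quotient a multiple of \<open>odd_prod\<close>.\<close>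

lemma falling_double:
  fixes x :: "'a :: field_char_0"
  shows "(\<Prod>i<2 * j + 1. 2 * x - of_nat i) = 2 * 2 ^ j * (\<Prod>i<Suc j. x - of_nat i) * (\<Prod>i = 1..j. 2 * x - 2 * of_nat i + 1)"
proof (induction j)
  case (Suc j)
  have "(\<Prod>i<2 * Suc j + 1. 2 * x - of_nat i) = (\<Prod>i<2 * j + 1. 2 * x - of_nat i) * (2 * x - of_nat (2 * j + 1)) * (2 * x - of_nat (2 * j + 2))"
    by simp
  also have "\<dots> = 2 * 2 ^ Suc j * (\<Prod>i<Suc (Suc j). x - of_nat i) * (\<Prod>i = 1..Suc j. 2 * x - 2 * of_nat i + 1)"
    unfolding Suc by (simp add: algebra_simps)
  finally show ?case .
qed simp

text \<open>For \<open>n < k\<close> the left side is zero, whereas \<open>odd_prod\<close> has only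
  half-integer roots and is nonzero at every integer; the bound \<open>n \<ge> k\<close> originates
  here.\<close>

lemma conv2_ratio:
  assumes "k \<ge> 1" "k \<le> n"
  shows "of_nat (conv2 n k) * fact (n - k) / fact n = odd_prod k (of_nat n :: complex)"
proof -
  obtain j where j: "k = Suc j" using assms by (metis Suc_le_D One_nat_def)
  define P :: complex where "P = (\<Prod>i<Suc j. of_nat n - of_nat i)"
  have "of_nat (n choose k) = P / fact k"
    by (simp add: binomial_gbinomial gbinomial_prod_rev P_def j atLeast0LessThan)
  then have P: "P = fact n / fact (n - k)"
    using assms by (simp add: binomial_fact field_simps)
  have "of_nat ((2 * n) choose (2 * j + 1)) = (\<Prod>i<2 * j + 1. 2 * of_nat n - of_nat i) / (fact (2 * j + 1) :: complex)"
    by (simp add: binomial_gbinomial gbinomial_prod_rev atLeast0LessThan)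
  also have "\<dots> = 2 * P * odd_prod k (of_nat n)"
    unfolding falling_double P_def by (simp add: odd_prod_def j)
  finally have "of_nat ((2 * n) choose (2 * k - 1)) = 2 * P * odd_prod k (of_nat n)"
    by (simp add: j)
  then have "of_nat (conv2 n k) = P * odd_prod k (of_nat n)"
    using conv2_closed_form[of n k] assms by simp
  then show ?thesis
    by (simp add: P)
qed

lemma conv3_closed_form:
  assumes "n \<ge> 2" "k \<ge> 2"
  shows "2 * of_nat (conv3 (n - 2) (k - 2)) = (of_nat n * of_nat ((n - 1) choose (k - 1)) * of_nat ((n - 1) choose (k - 2)) :: complex)"
proof -
  obtain m j where m: "n = m + 2" "k = j + 2"
    using assms by (metis le_add_diff_inverse2)
  have "of_nat (conv3 m j) = (of_nat (m + 2) / 2 * of_nat (Suc m choose Suc j) * of_nat (Suc m choose j) :: complex)"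
    using sum_binomial_sq_conv3[of m j] unfolding conv3_def of_nat_sum of_nat_power .
  moreover have "n - 2 = m" "k - 2 = j" "n - 1 = Suc m" "k - 1 = Suc j"
    using m by simp_all
  ultimately show ?thesis
    by (simp only: m) (simp only: times_divide_eq_left times_divide_eq_right nonzero_mult_div_cancel_left zero_neq_numeral[symmetric] not_False_eq_True)
qed

text \<open>For \<open>k > m\<close> both sides are zero, so quantities built from this ratio alone
  are given by one formula for all \<open>n\<close>.\<close>

lemma binomial_sq_ratio:
  "of_nat (m choose k) ^ 2 * fact (m - k) / fact m = (of_nat (m choose k) / fact k :: complex)"
proof (cases "k \<le> m")
  case True
  then show ?thesis by (simp add: binomial_fact power2_eq_square field_simps)
qed (simp add: binomial_eq_0)

lemma average_one: "average k n (\<lambda>_. 1) = of_nat (n choose k) / fact k"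
proof -
  have "(\<Sum>p | p permutes {1..n}. 1 * of_nat (N_id k n p)) = (of_nat ((n choose k)\<^sup>2 * fact (n - k)) :: complex)"
    unfolding sum_N_id[symmetric] by simp
  then show ?thesis
    unfolding average_def using binomial_sq_ratio[of n k] by simp
qed

lemma average_sum:
  "average k n (\<lambda>p. \<Sum>a\<in>A. f a p) = (\<Sum>a\<in>A. average k n (f a))"
  unfolding average_def sum_distrib_right sum_divide_distrib[symmetric] by (subst sum.swap) simp

lemma average_of_bool:
  "average k n (\<lambda>p. of_bool (Q p)) = of_nat (\<Sum>p | p permutes {1..n} \<and> Q p. N_id k n p) / fact n"
  unfolding average_def sum_of_bool_N_id ..

lemma average_fixed_points:
  assumes "k \<ge> 1" "n \<ge> k"
  shows "average k n (fixed_points n) = of_nat ((n - 1) choose k) / fact k + odd_prod k (of_nat n)"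
proof -
  have "average k n (fixed_points n) = of_nat (\<Sum>a\<in>{1..n}. \<Sum>p | p permutes {1..n} \<and> p a = a. N_id k n p) / fact n"
    unfolding fixed_points_def average_sum average_of_bool of_nat_sum sum_divide_distrib ..
  also have "\<dots> = of_nat n * (of_nat ((n - 1) choose k) ^ 2 * fact (n - 1 - k)) / fact n + of_nat (conv2 n k) * fact (n - k) / fact n"
    unfolding sum_fixed_points_N_id by (simp add: add_divide_distrib diff_commute mult.assoc)
  also have "of_nat n * (of_nat ((n - 1) choose k) ^ 2 * fact (n - 1 - k)) / fact n
      = of_nat ((n - 1) choose k) ^ 2 * fact (n - 1 - k) / (fact (n - 1) :: complex)"
    using assms by (simp add: fact_reduce[of n])
  finally show ?thesis
    unfolding binomial_sq_ratio conv2_ratio[OF assms] .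
qed

text \<open>The share of the fixed pairs with both points in \<open>I\<close>. There is none for
  \<open>k = 1\<close>, where \<open>k - 2\<close> would be truncated to 0 and give a wrong
  value.\<close>

definition pair_term :: "nat \<Rightarrow> 'a \<Rightarrow> 'a :: field_char_0" where
  "pair_term k x = (if k \<ge> 2 then ((x - 1) gchoose (k - 2)) / fact (k - 1) else 0)"

lemma of_nat_fact_reduce2:
  assumes "n \<ge> 2"
  shows "fact n = of_nat n * (of_nat (n - 1) * (fact (n - 2) :: complex))"
proof -
  obtain m where "n = Suc (Suc m)"
    using assms by (metis add_2_eq_Suc le_Suc_ex)
  then show ?thesis by simp
qed

text \<open>The summands belong to no, one or two fixed points in \<open>I\<close>. With exactly one
  in \<open>I\<close>, the other is deleted and \<open>conv2_ratio\<close> is applied to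
  \<open>n - 1\<close> points, which requires \<open>n \<ge> k + 1\<close>.\<close>

lemma average_fixed_pairs:
  assumes "k \<ge> 1" "n \<ge> k + 1"
  shows "average k n (fixed_pairs n) = of_nat ((n - 2) choose k) / fact k + 2 * odd_prod k (of_nat n - 1) + pair_term k (of_nat n)"
proof -
  have n: "n \<ge> 2" using assms by simp
  have r: "of_nat (conv2 (n - 1) k) * fact (n - 1 - k) / fact (n - 1) = odd_prod k (of_nat n - 1 :: complex)"
    using conv2_ratio[of k "n - 1"] assms n by (simp add: of_nat_diff)
  have "average k n (fixed_pairs n) = of_nat (\<Sum>a\<in>{1..n}. \<Sum>b\<in>{1..n} - {a}. \<Sum>p | p permutes {1..n} \<and> p a = a \<and> p b = b. N_id k n p) / fact n"
    unfolding fixed_pairs_def average_sum average_of_bool of_nat_sum sum_divide_distrib ..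
  also have "\<dots> = of_nat n * of_nat (n - 1) * (of_nat ((n - 2) choose k) ^ 2 * fact (n - 2 - k)) / fact n
      + of_nat n * (2 * (of_nat (conv2 (n - 1) k) * fact (n - 1 - k))) / fact n
      + of_nat (if n \<ge> 2 \<and> k \<ge> 2 then 2 * conv3 (n - 2) (k - 2) else 0) * fact (n - k) / fact n"
    unfolding sum_fixed_pairs_N_id of_nat_add of_nat_mult of_nat_fact of_nat_power add_divide_distrib
    by (simp add: diff_commute[of n] mult_ac)
  also have "of_nat n * of_nat (n - 1) * (of_nat ((n - 2) choose k) ^ 2 * fact (n - 2 - k)) / fact n
      = of_nat ((n - 2) choose k) ^ 2 * fact (n - 2 - k) / (fact (n - 2) :: complex)"
    using n by (simp add: of_nat_fact_reduce2)
  also have "of_nat n * (2 * (of_nat (conv2 (n - 1) k) * fact (n - 1 - k))) / fact n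
      = 2 * (of_nat (conv2 (n - 1) k) * fact (n - 1 - k) / (fact (n - 1) :: complex))"
    using n by (simp add: fact_reduce[of n])
  also have "of_nat (if n \<ge> 2 \<and> k \<ge> 2 then 2 * conv3 (n - 2) (k - 2) else 0) * fact (n - k) / fact n = pair_term k (of_nat n :: complex)"
  proof (cases "k \<ge> 2")
    case True
    have c: "of_nat (if n \<ge> 2 \<and> k \<ge> 2 then 2 * conv3 (n - 2) (k - 2) else 0)
        = (of_nat n * of_nat ((n - 1) choose (k - 1)) * of_nat ((n - 1) choose (k - 2)) :: complex)"
      using conv3_closed_form[OF n True] n True by simp
    have b: "of_nat ((n - 1) choose (k - 1)) = fact (n - 1) / (fact (k - 1) * (fact (n - k) :: complex))"
      using assms by (subst binomial_fact) auto
    have f: "fact n = of_nat n * (fact (n - 1) :: complex)"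
      using n by (intro fact_reduce) simp
    have m: "(of_nat n - 1 :: complex) = of_nat (n - 1)"
      using n by (simp add: of_nat_diff)
    have "of_nat (if n \<ge> 2 \<and> k \<ge> 2 then 2 * conv3 (n - 2) (k - 2) else 0) * fact (n - k) / fact n
        = of_nat n * (fact (n - 1) / (fact (k - 1) * fact (n - k))) * of_nat ((n - 1) choose (k - 2)) * fact (n - k)
          / (of_nat n * fact (n - 1) :: complex)"
      unfolding c b f ..
    also have "\<dots> = of_nat ((n - 1) choose (k - 2)) / fact (k - 1)"
    proof -
      have "w * (x / (y * z)) * v * z / (w * x) = v / y" if "w \<noteq> 0" "x \<noteq> 0" "z \<noteq> 0" for v w x y z :: complex
        using that by simp
      then show ?thesis
        using n by simp
    qed
    finally show ?thesis
      using True unfolding pair_term_def m binomial_gbinomial by (simp only: if_True)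
  qed (simp add: pair_term_def)
  finally show ?thesis
    unfolding binomial_sq_ratio r .
qed

text \<open>In contrast to fixed pairs, the deleted point contributes no factor \<open>n\<close>, so
  reducing \<open>n!\<close> to \<open>(n - 1)!\<close> leaves a division by
  \<open>n\<close>.\<close>

lemma average_swapped_pairs:
  assumes "k \<ge> 1" "n \<ge> k + 1"
  shows "average k n (swapped_pairs n) = of_nat ((n - 2) choose k) / fact k
    + 2 * ((of_nat k * (of_nat ((n - 1) choose k) / fact k) + odd_prod k (of_nat n - 1)) / of_nat n)"
proof -
  have n: "n \<ge> 2" using assms by simp
  have r: "of_nat (conv2 (n - 1) k) * fact (n - 1 - k) / fact (n - 1) = odd_prod k (of_nat n - 1 :: complex)"
    using conv2_ratio[of k "n - 1"] assms n by (simp add: of_nat_diff)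
  have "average k n (swapped_pairs n) = of_nat (\<Sum>a\<in>{1..n}. \<Sum>b\<in>{1..n} - {a}. \<Sum>p | p permutes {1..n} \<and> p a = b \<and> p b = a. N_id k n p) / fact n"
    unfolding swapped_pairs_def average_sum average_of_bool of_nat_sum sum_divide_distrib ..
  also have "\<dots> = of_nat n * of_nat (n - 1) * (of_nat ((n - 2) choose k) ^ 2 * fact (n - 2 - k)) / fact n
      + 2 * ((of_nat k * (of_nat ((n - 1) choose k) ^ 2 * fact (n - 1 - k)) + of_nat (conv2 (n - 1) k) * fact (n - 1 - k)) / fact n)"
    unfolding sum_two_cycles_N_id of_nat_add of_nat_mult of_nat_fact of_nat_power add_divide_distrib
    by (simp add: diff_commute[of n] algebra_simps add_divide_distrib)
  also have "of_nat n * of_nat (n - 1) * (of_nat ((n - 2) choose k) ^ 2 * fact (n - 2 - k)) / fact n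
      = of_nat ((n - 2) choose k) ^ 2 * fact (n - 2 - k) / (fact (n - 2) :: complex)"
    using n by (simp add: of_nat_fact_reduce2)
  also have "(of_nat k * (of_nat ((n - 1) choose k) ^ 2 * fact (n - 1 - k)) + of_nat (conv2 (n - 1) k) * fact (n - 1 - k)) / fact n
      = (of_nat k * (of_nat ((n - 1) choose k) ^ 2 * fact (n - 1 - k) / fact (n - 1))
        + of_nat (conv2 (n - 1) k) * fact (n - 1 - k) / fact (n - 1)) / (of_nat n :: complex)"
    using n by (simp add: fact_reduce[of n] add_divide_distrib mult.commute)
  finally show ?thesis
    unfolding binomial_sq_ratio r .
qed

definition swap_term :: "nat \<Rightarrow> 'a \<Rightarrow> 'a :: field_char_0" where
  "swap_term k x = of_nat k * (((x - 1) gchoose k) / fact k) + odd_prod k (x - 1)"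

text \<open>This and the next three expressions are generic in the field, so that each can be read
  both at complex numbers and at the indeterminate \<open>X\<close>.\<close>

definition coeff_empty :: "nat \<Rightarrow> 'a \<Rightarrow> 'a :: field_char_0" where
  "coeff_empty k x = (x gchoose k) / fact k"

definition coeff_one :: "nat \<Rightarrow> 'a \<Rightarrow> 'a :: field_char_0" where
  "coeff_one k x = ((x - 1) gchoose k) / fact k + odd_prod k x - (x gchoose k) / fact k"

definition coeff_two :: "nat \<Rightarrow> 'a \<Rightarrow> 'a :: field_char_0" where
  "coeff_two k x = ((x - 2) gchoose k) / fact k + odd_prod k (x - 1) + pair_term k x / 2 + swap_term k x / x
     - ((x - 1) gchoose k) / fact k - odd_prod k x"

definition coeff_one_one :: "nat \<Rightarrow> 'a \<Rightarrow> 'a :: field_char_0" where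
  "coeff_one_one k x = odd_prod k (x - 1) + pair_term k x / 2 - swap_term k x / x
     - ((x - 1) gchoose k) / fact k - odd_prod k x + (x gchoose k) / fact k"

lemma class_inner_coeff:
  assumes "k \<ge> 1"
  shows "class_inner n (irr_char (pad [] n)) (M_id k n) = coeff_empty k (of_nat n)"
    "n \<ge> k \<Longrightarrow> n \<ge> 2 \<Longrightarrow> class_inner n (irr_char (pad [1] n)) (M_id k n) = coeff_one k (of_nat n)"
    "n \<ge> k + 1 \<Longrightarrow> n \<ge> 4 \<Longrightarrow> class_inner n (irr_char (pad [2] n)) (M_id k n) = coeff_two k (of_nat n)"
    "n \<ge> k + 1 \<Longrightarrow> n \<ge> 3 \<Longrightarrow> class_inner n (irr_char (pad [1, 1] n)) (M_id k n) = coeff_one_one k (of_nat n)"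
proof -
  have m: "of_nat (n - i) = (of_nat n - of_nat i :: complex)" if "n \<ge> i" for i
    using that by (rule of_nat_diff)
  show "class_inner n (irr_char (pad [] n)) (M_id k n) = coeff_empty k (of_nat n)"
    by (simp add: class_inner_irr_char average_one coeff_empty_def binomial_gbinomial)
  show "class_inner n (irr_char (pad [1] n)) (M_id k n) = coeff_one k (of_nat n)" if "n \<ge> k" "n \<ge> 2"
    using that m[of 1] average_fixed_points[OF assms, of n]
    by (simp add: class_inner_irr_char(2)[unfolded One_nat_def] average_one coeff_one_def binomial_gbinomial)
  show "class_inner n (irr_char (pad [2] n)) (M_id k n) = coeff_two k (of_nat n)" if "n \<ge> k + 1" "n \<ge> 4"
    unfolding class_inner_irr_char(3)[OF that(2)] average_fixed_pairs[OF assms that(1)] average_swapped_pairs[OF assms that(1)]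
    using that m[of 1] m[of 2] average_fixed_points[OF assms, of n]
    by (simp add: coeff_two_def swap_term_def binomial_gbinomial add_divide_distrib)
  show "class_inner n (irr_char (pad [1, 1] n)) (M_id k n) = coeff_one_one k (of_nat n)" if "n \<ge> k + 1" "n \<ge> 3"
    unfolding class_inner_irr_char(4)[OF that(2)] average_fixed_pairs[OF assms that(1)] average_swapped_pairs[OF assms that(1)]
    using that m[of 1] m[of 2] average_fixed_points[OF assms, of n]
    by (simp add: coeff_one_one_def swap_term_def binomial_gbinomial add_divide_distrib diff_divide_distrib average_one)
qed

section \<open>Comparison with the stated formulas\<close>

lemma gbinomial_pascal: "(x gchoose Suc k) = ((x - 1) gchoose k) + ((x - 1 :: 'a :: field_char_0) gchoose Suc k)"
  using gbinomial_Suc_Suc[of "x - 1" k] by simp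

lemma coeff_one_eq:
  fixes x :: "'a :: field_char_0"
  assumes "k \<ge> 1"
  shows "coeff_one k x = 2 ^ (k - 1) * (\<Prod>i = 1..k - 1. 2 * x - 2 * of_nat i + 1) / fact (2 * k - 1)
       - 1 / fact k * ((x - 1) gchoose (k - 1))"
proof -
  obtain j where j: "k = Suc j" using assms by (metis Suc_le_D One_nat_def)
  show ?thesis
    unfolding coeff_one_def odd_prod_def j gbinomial_pascal[of x] by (simp add: add_divide_distrib)
qed

text \<open>Replacing \<open>x\<close> by \<open>x - 1\<close> shifts the odd factors by one place,
  so the two products share the factors for \<open>i = 2..k - 1\<close> and differ only in one
  factor at an end.\<close>

lemma odd_prod_split:
  fixes x :: "'a :: field_char_0"
  assumes "k \<ge> 2"
  defines "P \<equiv> 2 ^ (k - 1) * (\<Prod>i = 2..k - 1. 2 * x - 2 * of_nat i + 1) / fact (2 * k - 1)"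
  shows "odd_prod k x = (2 * x - 1) * P" "odd_prod k (x - 1) = (2 * x - 2 * of_nat k + 1) * P"
proof -
  have "(\<Prod>i = 1..k - 1. 2 * x - 2 * of_nat i + 1) = (2 * x - 1) * (\<Prod>i = 2..k - 1. 2 * x - 2 * of_nat i + 1)"
    using assms(1) by (subst prod.atLeast_Suc_atMost) (simp_all add: numeral_2_eq_2 algebra_simps)
  then show "odd_prod k x = (2 * x - 1) * P"
    by (simp add: odd_prod_def P_def)
  have "(\<Prod>i = 1..k - 1. 2 * (x - 1) - 2 * of_nat i + 1) = (\<Prod>i = 2..k. 2 * x - 2 * of_nat i + 1)"
    by (rule prod.reindex_bij_witness[where i = "\<lambda>i. i - 1" and j = Suc]) (auto simp: algebra_simps)
  also have "\<dots> = (2 * x - 2 * of_nat k + 1) * (\<Prod>i = 2..k - 1. 2 * x - 2 * of_nat i + 1)"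
  proof -
    obtain j where "k = Suc j" "2 \<le> Suc j" using assms(1) by (metis Suc_le_D One_nat_def numeral_2_eq_2)
    then show ?thesis by (simp add: prod.nat_ivl_Suc' mult.commute)
  qed
  finally show "odd_prod k (x - 1) = (2 * x - 2 * of_nat k + 1) * P"
    by (simp add: odd_prod_def P_def)
qed

text \<open>Pascal's rule reduces the binomials, except the common term \<open>w\<close>, to upper
  entry \<open>x - 2\<close> and lower entries \<open>k - 2\<close>, \<open>k - 1\<close>,
  \<open>k\<close>, and the odd products reduce to multiples of \<open>P\<close>. What remains is a
  rational identity in these quantities.\<close>

lemma coeff_two_eq:
  fixes x :: "'a :: field_char_0"
  assumes "k \<ge> 2" "x \<noteq> 0"
  shows "coeff_two k x = - (1 / (x * fact k)) * ((x - 2) gchoose (k - 1))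
         + 1 / (2 * fact (k - 1)) * ((x - 1) gchoose (k - 2))
         - 2 ^ (k - 1) * ((2 * of_nat k - 4) * x + (2 * of_nat k - 1))
             * (\<Prod>i = 2..k - 1. 2 * x - 2 * of_nat i + 1) / (x * fact (2 * k - 1))"
    and "coeff_one_one k x = 1 / fact k * ((x - 2) gchoose (k - 2))
         + 1 / (x * fact k) * ((x - 2) gchoose (k - 1))
         + 1 / (2 * fact (k - 1)) * ((x - 1) gchoose (k - 2))
         - 2 ^ (k - 1) * (2 * of_nat k * x - (2 * of_nat k - 1))
             * (\<Prod>i = 2..k - 1. 2 * x - 2 * of_nat i + 1) / (x * fact (2 * k - 1))"
proof -
  define P where "P = 2 ^ (k - 1) * (\<Prod>i = 2..k - 1. 2 * x - 2 * of_nat i + 1) / fact (2 * k - 1)"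
  have P: "2 ^ (k - 1) * c * (\<Prod>i = 2..k - 1. 2 * x - 2 * of_nat i + 1) / (x * fact (2 * k - 1)) = c * P / x" for c
    by (simp add: P_def mult_ac)
  obtain j where j: "k = Suc (Suc j)"
    using assms by (metis add_2_eq_Suc le_Suc_ex)
  define f where "f = (fact k :: 'a)"
  define a where "a = ((x - 2) gchoose Suc j)"
  define b where "b = ((x - 2) gchoose j)"
  define d where "d = ((x - 2) gchoose k)"
  define w where "w = 1 / (2 * fact (k - 1)) * ((x - 1) gchoose (k - 2))"
  have f: "f \<noteq> 0" by (simp add: f_def)
  have x2: "x - 1 - 1 = x - 2" by simp
  have c1: "((x - 1) gchoose k) = a + d"
    unfolding a_def d_def j gbinomial_pascal[of "x - 1"] x2 ..
  have c2: "((x - 1) gchoose Suc j) = b + a"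
    unfolding a_def b_def gbinomial_pascal[of "x - 1"] x2 ..
  have c0: "(x gchoose k) = (b + a) + (a + d)"
    unfolding c1[symmetric] c2[symmetric] j by (rule gbinomial_pascal)
  \<comment> \<open>Absorption turns the binomial part of \<open>swap_term\<close> into a multiple
    of \<open>a\<close>; splitting \<open>(x - 1) / x\<close> as \<open>1 - 1 / x\<close> then
    produces the terms with denominator \<open>x * fact k\<close>.\<close>
  have absorb: "of_nat k * (a + d) = (x - 1) * a"
    using gbinomial_absorption[of "Suc j" "x - 1"] unfolding j[symmetric] c1 x2 a_def[symmetric] .
  have pt: "pair_term k x / 2 = w"
    using assms by (simp add: pair_term_def w_def)
  have R: "swap_term k x / x = (x - 1) * a / (f * x) + (2 * x - 2 * of_nat k + 1) * P / x"
    unfolding swap_term_def odd_prod_split(2)[OF assms(1), of x, folded P_def] c1 times_divide_eq_right absorb f_def[symmetric]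
    by (simp add: add_divide_distrib)
  have k: "k - 1 = Suc j" "k - 2 = j"
    using j by simp_all
  have "coeff_two k x = d / f + (2 * x - 2 * of_nat k + 1) * P + w
      + ((x - 1) * a / (f * x) + (2 * x - 2 * of_nat k + 1) * P / x) - (a + d) / f - (2 * x - 1) * P"
    unfolding coeff_two_def R pt odd_prod_split[OF assms(1), of x, folded P_def] c1 f_def[symmetric] d_def[symmetric] ..
  also have "\<dots> = - (1 / (x * f)) * a + w - ((2 * of_nat k - 4) * x + (2 * of_nat k - 1)) * P / x"
    using f assms(2) by (simp add: field_simps)
  finally show "coeff_two k x = - (1 / (x * fact k)) * ((x - 2) gchoose (k - 1))
         + 1 / (2 * fact (k - 1)) * ((x - 1) gchoose (k - 2))
         - 2 ^ (k - 1) * ((2 * of_nat k - 4) * x + (2 * of_nat k - 1))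
             * (\<Prod>i = 2..k - 1. 2 * x - 2 * of_nat i + 1) / (x * fact (2 * k - 1))"
    unfolding P unfolding w_def a_def f_def k .
  have "coeff_one_one k x = (2 * x - 2 * of_nat k + 1) * P + w
      - ((x - 1) * a / (f * x) + (2 * x - 2 * of_nat k + 1) * P / x) - (a + d) / f - (2 * x - 1) * P + ((b + a) + (a + d)) / f"
    unfolding coeff_one_one_def R pt odd_prod_split[OF assms(1), of x, folded P_def] c0 c1 f_def[symmetric] ..
  also have "\<dots> = 1 / f * b + 1 / (x * f) * a + w - (2 * of_nat k * x - (2 * of_nat k - 1)) * P / x"
    using f assms(2) by (simp add: field_simps)
  finally show "coeff_one_one k x = 1 / fact k * ((x - 2) gchoose (k - 2))
         + 1 / (x * fact k) * ((x - 2) gchoose (k - 1))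
         + 1 / (2 * fact (k - 1)) * ((x - 1) gchoose (k - 2))
         - 2 ^ (k - 1) * (2 * of_nat k * x - (2 * of_nat k - 1))
             * (\<Prod>i = 2..k - 1. 2 * x - 2 * of_nat i + 1) / (x * fact (2 * k - 1))"
    unfolding P unfolding w_def a_def b_def f_def k .
qed

subsection \<open>Polynomial representatives\<close>

text \<open>The factors are \<open>- (2 i + 1)\<close>, and \<open>(2 k - 1)!\<close> is the product
  of the odd numbers up to \<open>2 k - 1\<close> times \<open>2^(k-1) (k-1)!\<close>.\<close>

lemma odd_prod_minus_one:
  assumes "k \<ge> 1"
  shows "odd_prod k (- 1) = ((- 1) ^ (k - 1) / fact (k - 1) :: 'a :: field_char_0)"
proof -
  obtain j where j: "k = Suc j" using assms by (metis Suc_le_D One_nat_def)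
  have "2 ^ j * (\<Prod>i = 1..j. 2 * (- 1) - 2 * of_nat i + 1) * fact j = ((- 1) ^ j * fact (2 * j + 1) :: 'a)"
  proof (induction j)
    case (Suc j)
    have "2 ^ Suc j * (\<Prod>i = 1..Suc j. 2 * (- 1) - 2 * of_nat i + 1) * fact (Suc j)
       = (2 ^ j * (\<Prod>i = 1..j. 2 * (- 1) - 2 * of_nat i + 1) * fact j) * (- (of_nat (2 * j + 2) * of_nat (2 * j + 3)) :: 'a)"
      by (simp add: algebra_simps)
    also have "\<dots> = (- 1) ^ Suc j * fact (2 * Suc j + 1)"
      unfolding Suc by (simp add: algebra_simps)
    finally show ?case .
  qed simp
  moreover have "k - 1 = j" "2 * k - 1 = 2 * j + 1"
    using j by simp_all
  ultimately show ?thesis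
    unfolding odd_prod_def by (subst frac_eq_eq) (simp_all only: fact_nonzero not_False_eq_True)
qed

text \<open>At 0 the binomial part is \<open>(- 1)^k / (k - 1)!\<close> and the odd product is its
  negative. This makes \<open>swap_term k x / x\<close> a polynomial.\<close>

lemma swap_term_zero:
  assumes "k \<ge> 1"
  shows "swap_term k 0 = (0 :: 'a :: field_char_0)"
proof -
  obtain j where j: "k = Suc j" using assms by (metis Suc_le_D One_nat_def)
  have "((- 1 :: 'a) gchoose k) = (- 1) ^ k"
    using gbinomial_negated_upper[of "- 1 :: 'a" k] by (simp add: binomial_gbinomial[symmetric])
  moreover have "of_nat k * (c / fact k) = (c / fact j :: 'a)" for c
    using of_nat_neq_0[of j, where 'a = 'a] by (simp add: j fact_Suc del: of_nat_Suc)
  ultimately show ?thesis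
    unfolding swap_term_def using odd_prod_minus_one[OF assms, where 'a = 'a] j by simp
qed

text \<open>One polynomial witnesses both the rational function and the values on \<open>S\<close>.
  Restricting to \<open>S\<close> allows 0 to be left out, where \<open>f z / z\<close> is 0 by
  convention and may differ from the polynomial.\<close>

definition same_poly :: "complex set \<Rightarrow> complex poly fract \<Rightarrow> (complex \<Rightarrow> complex) \<Rightarrow> bool" where
  "same_poly S r f \<longleftrightarrow> (\<exists>p. to_fract p = r \<and> (\<forall>z\<in>S. poly p z = f z))"

lemma same_polyI: "to_fract p = r \<Longrightarrow> (\<And>z. z \<in> S \<Longrightarrow> poly p z = f z) \<Longrightarrow> same_poly S r f"
  unfolding same_poly_def by blast

lemma same_poly_X: "same_poly S X (\<lambda>z. z)"
  by (rule same_polyI[of "[:0, 1:]"]) auto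

lemma same_poly_add: "same_poly S r f \<Longrightarrow> same_poly S s g \<Longrightarrow> same_poly S (r + s) (\<lambda>z. f z + g z)"
  unfolding same_poly_def by (metis poly_add to_fract_add)

lemma same_poly_diff: "same_poly S r f \<Longrightarrow> same_poly S s g \<Longrightarrow> same_poly S (r - s) (\<lambda>z. f z - g z)"
  unfolding same_poly_def by (metis poly_diff to_fract_diff)

lemma same_poly_mult: "same_poly S r f \<Longrightarrow> same_poly S s g \<Longrightarrow> same_poly S (r * s) (\<lambda>z. f z * g z)"
  unfolding same_poly_def by (metis poly_mult to_fract_mult)

lemma to_fract_of_nat: "to_fract (of_nat m) = of_nat m"
  by (induction m) simp_all

lemma same_poly_of_nat: "same_poly S (of_nat m) (\<lambda>_. of_nat m)"
  by (rule same_polyI[OF to_fract_of_nat]) (simp add: of_nat_poly)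

lemma same_poly_numeral: "same_poly S (numeral m) (\<lambda>_. numeral m)"
  using same_poly_of_nat[of S "numeral m"] by simp

lemma same_poly_1: "same_poly S 1 (\<lambda>_. 1)" and same_poly_0: "same_poly S 0 (\<lambda>_. 0)"
  using same_poly_of_nat[of S 1] same_poly_of_nat[of S 0] by simp_all

lemma same_poly_inverse_of_nat: "same_poly S (inverse (of_nat m)) (\<lambda>_. inverse (of_nat m))"
proof (cases "m = 0")
  case False
  have "to_fract [:inverse (of_nat m):] * of_nat m = to_fract ([:inverse (of_nat m):] * of_nat m)"
    by (simp only: to_fract_mult to_fract_of_nat)
  also have "[:inverse (of_nat m):] * of_nat m = (1 :: complex poly)"
    using False by (simp add: of_nat_poly one_pCons)
  finally have "to_fract [:inverse (of_nat m):] = inverse (of_nat m :: complex poly fract)"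
    by (metis inverse_unique mult.commute to_fract_1)
  then show ?thesis
    by (rule same_polyI) simp
qed (simp add: same_poly_0)

lemma same_poly_divide_of_nat:
  "same_poly S r f \<Longrightarrow> same_poly S (r / of_nat m) (\<lambda>z. f z / of_nat m)"
  unfolding divide_inverse by (rule same_poly_mult[OF _ same_poly_inverse_of_nat])

lemma same_poly_divide_fact: "same_poly S r f \<Longrightarrow> same_poly S (r / fact m) (\<lambda>z. f z / fact m)"
  using same_poly_divide_of_nat[of S r f "fact m"] by (simp only: of_nat_fact)

lemma same_poly_divide_numeral: "same_poly S r f \<Longrightarrow> same_poly S (r / numeral m) (\<lambda>z. f z / numeral m)"
  using same_poly_divide_of_nat[of S r f "numeral m"] by (simp only: of_nat_numeral)

lemma same_poly_prod:
  "(\<And>i. i \<in> A \<Longrightarrow> same_poly S (r i) (f i)) \<Longrightarrow> same_poly S (\<Prod>i\<in>A. r i) (\<lambda>z. \<Prod>i\<in>A. f i z)"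
  by (induction A rule: infinite_finite_induct) (simp_all add: same_poly_1 same_poly_mult)

lemma same_poly_power: "same_poly S r f \<Longrightarrow> same_poly S (r ^ m) (\<lambda>z. f z ^ m)"
  by (induction m) (simp_all add: same_poly_1 same_poly_mult)

lemma same_poly_gbinomial: "same_poly S r f \<Longrightarrow> same_poly S (r gchoose k) (\<lambda>z. f z gchoose k)"
  unfolding gbinomial_prod_rev
  by (intro same_poly_divide_fact same_poly_prod same_poly_diff same_poly_of_nat)

lemma same_poly_odd_prod: "same_poly S r f \<Longrightarrow> same_poly S (odd_prod k r) (\<lambda>z. odd_prod k (f z))"
  unfolding odd_prod_def
  by (intro same_poly_divide_fact same_poly_prod same_poly_diff same_poly_add same_poly_mult same_poly_of_nat
      same_poly_numeral same_poly_1 same_poly_power)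

lemma same_poly_pair_term: "same_poly S (pair_term k X) (pair_term k)"
proof (cases "k \<ge> 2")
  case True
  then show ?thesis
    using same_poly_divide_fact[OF same_poly_gbinomial[OF same_poly_diff[OF same_poly_X same_poly_1]], of S "k - 2" "k - 1"]
    by (simp add: pair_term_def[abs_def])
qed (simp add: pair_term_def[abs_def] same_poly_0)

text \<open>The root at 0 gives the polynomial a factor \<open>X\<close>, and the cofactor
  represents the quotient away from 0.\<close>

lemma same_poly_divide_X:
  assumes "same_poly UNIV r f" "f 0 = 0"
  shows "same_poly (- {0}) (r / X) (\<lambda>z. f z / z)"
proof -
  obtain p where p: "to_fract p = r" "\<And>z. poly p z = f z"
    using assms(1) by (auto simp: same_poly_def)
  have "[:- 0, 1:] dvd p"
    using assms(2) p(2)[of 0] by (subst poly_eq_0_iff_dvd[symmetric]) simp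
  then obtain q where q: "p = [:0, 1:] * q"
    by (auto elim: dvdE)
  show ?thesis
  proof (rule same_polyI[of q])
    have "r = X * to_fract q"
      unfolding p(1)[symmetric] q by (rule to_fract_mult)
    then show "to_fract q = r / X"
      by (simp del: to_fract_mult)
  next
    fix z :: complex assume "z \<in> - {0}"
    then show "poly q z = f z / z"
      using p(2)[of z] by (simp add: q field_simps)
  qed
qed

lemma same_poly_swap_term:
  assumes "k \<ge> 1"
  shows "same_poly (- {0}) (swap_term k X / X) (\<lambda>z. swap_term k z / z)"
proof (rule same_poly_divide_X)
  show "same_poly UNIV (swap_term k X) (swap_term k)"
    unfolding swap_term_def[abs_def]
    by (intro same_poly_add same_poly_mult same_poly_of_nat same_poly_divide_fact same_poly_gbinomial
        same_poly_diff same_poly_X same_poly_1 same_poly_odd_prod)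
qed (rule swap_term_zero[OF assms])

lemma same_poly_coeff:
  "same_poly S (coeff_empty k X) (coeff_empty k)"
  "same_poly S (coeff_one k X) (coeff_one k)"
  "k \<ge> 1 \<Longrightarrow> same_poly (- {0}) (coeff_two k X) (coeff_two k)"
  "k \<ge> 1 \<Longrightarrow> same_poly (- {0}) (coeff_one_one k X) (coeff_one_one k)"
  unfolding coeff_empty_def[abs_def] coeff_one_def[abs_def] coeff_two_def[abs_def] coeff_one_one_def[abs_def]
  by (intro same_poly_add same_poly_diff same_poly_divide_fact same_poly_gbinomial same_poly_odd_prod
      same_poly_divide_numeral same_poly_X same_poly_1 same_poly_numeral same_poly_pair_term same_poly_swap_term; assumption)+

text \<open>Two polynomials that agree at all large natural numbers differ by one with infinitely
  many roots, so the definite description in \<open>a_id\<close> is unique.\<close>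

lemma a_id_eqI:
  assumes "\<And>n. n \<ge> n0 \<Longrightarrow> poly p (of_nat n) = class_inner n (irr_char (pad \<nu> n)) (M_id k n)"
  shows "a_id \<nu> k = p"
  unfolding a_id_def
proof (rule the_equality)
  show "\<forall>\<^sub>F n in sequentially. poly p (of_nat n) = class_inner n (irr_char (pad \<nu> n)) (M_id k n)"
    using assms by (auto simp: eventually_sequentially)
next
  fix q assume "\<forall>\<^sub>F n in sequentially. poly q (of_nat n) = class_inner n (irr_char (pad \<nu> n)) (M_id k n)"
  then obtain n1 where n1: "\<And>n. n \<ge> n1 \<Longrightarrow> poly q (of_nat n) = class_inner n (irr_char (pad \<nu> n)) (M_id k n)"
    by (auto simp: eventually_sequentially)
  have "(of_nat :: nat \<Rightarrow> complex) ` {max n0 n1..} \<subseteq> {z. poly (q - p) z = 0}"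
    using assms n1 by auto
  moreover have "infinite ((of_nat :: nat \<Rightarrow> complex) ` {max n0 n1..})"
    by (subst finite_image_iff) (auto simp: inj_on_def infinite_Ici)
  ultimately have "infinite {z. poly (q - p) z = 0}"
    using finite_subset by blast
  then have "q - p = 0"
    using poly_roots_finite by blast
  then show "q = p" by simp
qed

lemma a_id_of_same_poly:
  assumes r: "same_poly S r f" and n0: "of_nat ` {n0..} \<subseteq> S"
    and f: "\<And>n. n \<ge> n0 \<Longrightarrow> class_inner n (irr_char (pad \<nu> n)) (M_id k n) = f (of_nat n)"
  shows "to_fract (a_id \<nu> k) = r"
    and "n \<ge> n0 \<Longrightarrow> poly (a_id \<nu> k) (of_nat n) = class_inner n (irr_char (pad \<nu> n)) (M_id k n)"
proof -
  obtain p where p: "to_fract p = r" "\<And>z. z \<in> S \<Longrightarrow> poly p z = f z"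
    using r by (auto simp: same_poly_def)
  have v: "poly p (of_nat n) = class_inner n (irr_char (pad \<nu> n)) (M_id k n)" if "n \<ge> n0" for n
    using that n0 p(2)[of "of_nat n"] f[of n] by auto
  then have "a_id \<nu> k = p"
    by (rule a_id_eqI)
  then show "to_fract (a_id \<nu> k) = r"
    "n \<ge> n0 \<Longrightarrow> poly (a_id \<nu> k) (of_nat n) = class_inner n (irr_char (pad \<nu> n)) (M_id k n)"
    using p(1) v by auto
qed

theorem theorem2p13:
  fixes k :: nat
  assumes "k \<ge> 1"
  shows
    "to_fract (a_id [] k) = 1 / fact k * (X gchoose k) \<and>
     to_fract (a_id [1] k) =
       2 ^ (k - 1) * (\<Prod>i = 1..k - 1. 2 * X - 2 * of_nat i + 1) / fact (2 * k - 1)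
       - 1 / fact k * ((X - 1) gchoose (k - 1)) \<and>
     (k \<ge> 2 \<longrightarrow>
       to_fract (a_id [2] k) =
         - (1 / (X * fact k)) * ((X - 2) gchoose (k - 1))
         + 1 / (2 * fact (k - 1)) * ((X - 1) gchoose (k - 2))
         - 2 ^ (k - 1) * ((2 * of_nat k - 4) * X + (2 * of_nat k - 1))
             * (\<Prod>i = 2..k - 1. 2 * X - 2 * of_nat i + 1) / (X * fact (2 * k - 1))) \<and>
     (k \<ge> 2 \<longrightarrow>
       to_fract (a_id [1, 1] k) =
         1 / fact k * ((X - 2) gchoose (k - 2))
         + 1 / (X * fact k) * ((X - 2) gchoose (k - 1))
         + 1 / (2 * fact (k - 1)) * ((X - 1) gchoose (k - 2))
         - 2 ^ (k - 1) * (2 * of_nat k * X - (2 * of_nat k - 1))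
             * (\<Prod>i = 2..k - 1. 2 * X - 2 * of_nat i + 1) / (X * fact (2 * k - 1))) \<and>
     (\<forall>n. is_partition (pad [] n) n \<longrightarrow>
       poly (a_id [] k) (of_nat n) = class_inner n (irr_char (pad [] n)) (M_id k n)) \<and>
     (\<forall>n \<ge> k. is_partition (pad [1] n) n \<longrightarrow>
       poly (a_id [1] k) (of_nat n) = class_inner n (irr_char (pad [1] n)) (M_id k n)) \<and>
     (\<forall>\<nu> \<in> {[2], [1, 1]}. \<forall>n \<ge> k + 1. is_partition (pad \<nu> n) n \<longrightarrow>
       poly (a_id \<nu> k) (of_nat n) = class_inner n (irr_char (pad \<nu> n)) (M_id k n))"
proof (intro conjI impI allI ballI)
  have X0: "X \<noteq> 0" by simp
  have pos: "(of_nat :: nat \<Rightarrow> complex) ` {m..} \<subseteq> - {0}" if "m \<ge> 1" for m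
    using that by auto
  note a0 = a_id_of_same_poly[OF same_poly_coeff(1), of 0 UNIV "[]" k k]
  \<comment> \<open>The thresholds 2, 4 and 3 are the least \<open>n\<close> for which
    \<open>(n - 1, 1)\<close>, \<open>(n - 2, 2)\<close> and \<open>(n - 2, 1, 1)\<close> are
    partitions, and from there on the character formulas hold.\<close>
  note a1 = a_id_of_same_poly[OF same_poly_coeff(2), of "max k 2" UNIV "[1]" k k]
  note a2 = a_id_of_same_poly[OF same_poly_coeff(3)[OF assms], of "max (k + 1) 4" "[2]" k]
  note a11 = a_id_of_same_poly[OF same_poly_coeff(4)[OF assms], of "max (k + 1) 3" "[1, 1]" k]
  show "to_fract (a_id [] k) = 1 / fact k * (X gchoose k)"
    using a0(1) class_inner_coeff(1)[OF assms] by (simp add: coeff_empty_def)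
  show "to_fract (a_id [1] k) =
       2 ^ (k - 1) * (\<Prod>i = 1..k - 1. 2 * X - 2 * of_nat i + 1) / fact (2 * k - 1)
       - 1 / fact k * ((X - 1) gchoose (k - 1))"
    unfolding coeff_one_eq[OF assms, symmetric]
    by (rule a1(1)) (use class_inner_coeff(2)[OF assms] in auto)
  show "to_fract (a_id [2] k) =
         - (1 / (X * fact k)) * ((X - 2) gchoose (k - 1))
         + 1 / (2 * fact (k - 1)) * ((X - 1) gchoose (k - 2))
         - 2 ^ (k - 1) * ((2 * of_nat k - 4) * X + (2 * of_nat k - 1))
             * (\<Prod>i = 2..k - 1. 2 * X - 2 * of_nat i + 1) / (X * fact (2 * k - 1))" if "k \<ge> 2"
    unfolding coeff_two_eq(1)[OF that X0, symmetric]
    by (rule a2(1)) (use class_inner_coeff(3)[OF assms] in auto)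
  show "to_fract (a_id [1, 1] k) =
         1 / fact k * ((X - 2) gchoose (k - 2))
         + 1 / (X * fact k) * ((X - 2) gchoose (k - 1))
         + 1 / (2 * fact (k - 1)) * ((X - 1) gchoose (k - 2))
         - 2 ^ (k - 1) * (2 * of_nat k * X - (2 * of_nat k - 1))
             * (\<Prod>i = 2..k - 1. 2 * X - 2 * of_nat i + 1) / (X * fact (2 * k - 1))" if "k \<ge> 2"
    unfolding coeff_two_eq(2)[OF that X0, symmetric]
    by (rule a11(1)) (use class_inner_coeff(4)[OF assms] in auto)
  show "poly (a_id [] k) (of_nat n) = class_inner n (irr_char (pad [] n)) (M_id k n)" for n
    by (rule a0(2)) (use class_inner_coeff(1)[OF assms] in auto)
  show "poly (a_id [1] k) (of_nat n) = class_inner n (irr_char (pad [1] n)) (M_id k n)"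
    if "k \<le> n" "is_partition (pad [1] n) n" for n
  proof (rule a1(2))
    show "max k 2 \<le> n"
      using that by (simp add: is_partition_def pad_def)
  qed (use class_inner_coeff(2)[OF assms] in auto)
  show "poly (a_id \<nu> k) (of_nat n) = class_inner n (irr_char (pad \<nu> n)) (M_id k n)"
    if \<nu>: "\<nu> \<in> {[2], [1, 1]}" and n: "k + 1 \<le> n" "is_partition (pad \<nu> n) n" for \<nu> n
  proof (cases "\<nu> = [2]")
    case True
    show ?thesis
      unfolding True
    proof (rule a2(2))
      \<comment> \<open>The padded list is weakly decreasing, so its first row is at least the
        second; despite truncated subtraction this gives \<open>n \<ge> 4\<close>.\<close>
      have "n - 2 \<ge> 2"
        using n True by (simp add: is_partition_def pad_def)
      then show "max (k + 1) 4 \<le> n"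
        using n(1) by simp
    qed (use class_inner_coeff(3)[OF assms] in auto)
  next
    case False
    with \<nu> have \<nu>': "\<nu> = [1, 1]" by simp
    show ?thesis
      unfolding \<nu>'
    proof (rule a11(2))
      have "n - 2 \<ge> 1"
        using n \<nu>' by (simp add: is_partition_def pad_def numeral_2_eq_2)
      then show "max (k + 1) 3 \<le> n"
        using n(1) by simp
    qed (use class_inner_coeff(4)[OF assms] in auto)
  qed
qed

end
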